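(* Let $n\in\mathbb{N}$ and $H=\mathbb{C}^n\otimes L^2(0,\infty)$. Let $\phi: M_n(\mathbb{C})\to M_n(\mathbb{C})$ be a unital completely positive map with no negative eigenvalues, and let $\nu$ be a normalized unbounded boundary weight over $L^2(0,\infty)$. Then the map $\rho\mapsto\omega(\rho)$ from $M_n(\mathbb{C})^*$ into boundary weights on $\mathfrak{A}(H)$ defined by $$\omega(\rho)(A)=\rho(\phi(\Omega_\nu(A))),\qquad A\in\mathfrak{A}(H),$$ is completely positive. Furthermore, the maps $\hat\pi_t:=\omega_t(I+\hat\Lambda\omega_t)^{-1}$ define normal completely positive contractions $\pi_t^\#$ of $B(H)$ into $M_n(\mathbb{C})$ (via $\hat\pi_t(\rho)=\rho\circ\pi_t^\#$ for all $\rho \in M_n(\mathbb{C})^*$) for all $t>0$ if and only if $\phi$ is $q$-positive.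
   Context: A linear map $\phi:M_n(\mathbb{C})\to M_n(\mathbb{C})$ is $q$-positive if it has no negative eigenvalues and $\phi(I+t\phi)^{-1}$ is completely positive for all $t\ge 0$ (here $I$ is the identity map). Identify $H=\mathbb{C}^n\otimes L^2(0,\infty)$ with $L^2((0,\infty);\mathbb{C}^n)$ and $B(H)$ with $M_n(B(L^2(0,\infty)))$. Let $U_t$ be the right shift by $t$ on $H$: $(U_tf)(x)=f(x-t)$ for $x>t$ and $0$ otherwise; let $V_t$ be the same on $L^2(0,\infty)$. Let $\Lambda:M_n(\mathbb{C})\to B(H)$ be $(\Lambda(A)f)(x)=e^{-x}Af(x)$; for $n=1$, $\Lambda(1)\in B(L^2(0,\infty))$ is multiplication by $e^{-x}$. The null boundary algebra is $\mathfrak{A}(H)=\sqrt{I-\Lambda(I)}\,B(H)\sqrt{I-\Lambda(I)}=M_n(\mathfrak{A}(L^2(0,\infty)))$. A boundary weight on $\mathfrak{A}(H)$ is a linear functional $\mu$ on $\mathfrak{A}(H)$ such that $A\mapsto\mu(\sqrt{I-\Lambda(I)}A\sqrt{I-\Lambda(I)})$ is a normal functional on $B(H)$. A boundary weight $\nu$ over $L^2(0,\infty)$ (i.e. on $\mathfrak{A}(L^2(0,\infty))$) is always taken positive; it is normalized if $\nu(I-\Lambda(1))=1$, and unbounded if there is no $r>0$ with $|\nu(B)|\le r\|B\|$ for all $B\in\mathfrak{A}(L^2(0,\infty))$. $\Omega_\nu:\mathfrak{A}(H)\to M_n(\mathbb{C})$ sends $(A_{ij})$ to $(\nu(A_{ij}))$.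 For $t>0$, the truncated map $\omega_t:M_n(\mathbb{C})^*\to B(H)_*$ is $\omega_t(\rho)(A)=\omega(\rho)(U_tU_t^*AU_tU_t^* )$, and $\hat\Lambda:B(H)_*\to M_n(\mathbb{C})^*$ is $\hat\Lambda(\eta)=\eta\circ\Lambda$. The map $\rho\mapsto\omega(\rho)$ is completely positive if for every $m$ and every matrix $(\rho_{ij})_{i,j=1}^m$ of functionals in $M_n(\mathbb{C})^*$ with $\sum_{i,j}\rho_{ij}(B_{ij})\ge 0$ for all positive $(B_{ij})\in M_m(M_n(\mathbb{C}))$, one has $\sum_{i,j}\omega(\rho_{ij})(A_{ij})\ge 0$ for all positive $(A_{ij})\in M_m(\mathfrak{A}(H))$. *)

theory Defs
  imports "HOL-Analysis.Analysis"
begin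

section \<open>Complex scalars\<close>

class complex_normed = real_normed_vector +
  fixes scaleC :: "complex \<Rightarrow> 'a \<Rightarrow> 'a"  (infixr \<open>*\<^sub>C\<close> 75)
  assumes scaleC_add_right: "c *\<^sub>C (x + y) = c *\<^sub>C x + c *\<^sub>C y"
    and scaleC_add_left: "(c + d) *\<^sub>C x = c *\<^sub>C x + d *\<^sub>C x"
    and scaleC_scaleC: "c *\<^sub>C d *\<^sub>C x = (c * d) *\<^sub>C x"
    and scaleC_of_real: "of_real r *\<^sub>C x = r *\<^sub>R x"
    and norm_scaleC: "norm (c *\<^sub>C x) = cmod c * norm x"

class complex_inner = complex_normed + real_inner

text \<open>
  The real inner product of a complex inner product space is the real part of the
  hermitian one, so the latter is recovered as below. It is antilinear in the first argument
  (see \<open>cinner_complex\<close>, \<open>cinner_vec\<close> and \<open>cinner_L2\<close>).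
\<close>

definition cinner :: "'a::complex_inner \<Rightarrow> 'a \<Rightarrow> complex" where
  "cinner x y = Complex (x \<bullet> y) ((\<i> *\<^sub>C x) \<bullet> y)"

instantiation complex :: complex_inner
begin

definition scaleC_complex :: "complex \<Rightarrow> complex \<Rightarrow> complex" where
  "scaleC_complex c x = c * x"

instance
  by standard (auto simp: scaleC_complex_def algebra_simps norm_mult scaleR_conv_of_real)

end

lemma cinner_complex: "cinner (x::complex) y = cnj x * y"
  by (simp add: cinner_def scaleC_complex_def inner_complex_def complex_eq_iff)

instantiation vec :: (complex_normed, finite) complex_normed
begin

definition scaleC_vec :: "complex \<Rightarrow> 'a ^ 'b \<Rightarrow> 'a ^ 'b" where
  "scaleC_vec c x = (\<chi> i. c *\<^sub>C x $ i)"

instance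
proof
  fix c :: complex and x :: "'a ^ 'b"
  show "norm (c *\<^sub>C x) = cmod c * norm x"
    by (simp add: scaleC_vec_def norm_vec_def norm_scaleC L2_set_right_distrib)
qed (auto simp: scaleC_vec_def vec_eq_iff scaleC_add_right scaleC_add_left scaleC_scaleC
      scaleC_of_real)

end

instance vec :: (complex_inner, finite) complex_inner ..

lemma cinner_vec: "cinner x y = (\<Sum>i\<in>UNIV. cinner (x $ i) (y $ i))"
  by (simp add: cinner_def inner_vec_def scaleC_vec_def complex_eq_iff)

instantiation blinfun :: (real_normed_vector, complex_normed) complex_normed
begin

lift_definition scaleC_blinfun ::
  "complex \<Rightarrow> 'a \<Rightarrow>\<^sub>L 'b \<Rightarrow> 'a \<Rightarrow>\<^sub>L 'b" is "\<lambda>c A x. c *\<^sub>C A x"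
proof -
  fix c and A :: "'a \<Rightarrow> 'b" assume "bounded_linear A"
  then interpret bounded_linear A .
  obtain K where K: "\<And>x. norm (A x) \<le> norm x * K" using bounded by blast
  show "bounded_linear (\<lambda>x. c *\<^sub>C A x)"
  proof (rule bounded_linear_intro[where K = "cmod c * K"])
    fix x y and r :: real
    show "c *\<^sub>C A (x + y) = c *\<^sub>C A x + c *\<^sub>C A y" by (simp add: add scaleC_add_right)
    show "c *\<^sub>C A (r *\<^sub>R x) = r *\<^sub>R c *\<^sub>C A x"
      by (simp add: scaleR scaleC_scaleC mult.commute flip: scaleC_of_real)
    show "norm (c *\<^sub>C A x) \<le> norm x * (cmod c * K)"
      using mult_left_mono[OF K[of x], of "cmod c"] by (simp add: norm_scaleC algebra_simps)
  qed
qed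

instance
proof
  fix c d :: complex and A B :: "'a \<Rightarrow>\<^sub>L 'b" and r :: real
  show "c *\<^sub>C (A + B) = c *\<^sub>C A + c *\<^sub>C B" by transfer (simp add: scaleC_add_right)
  show "(c + d) *\<^sub>C A = c *\<^sub>C A + d *\<^sub>C A" by transfer (simp add: scaleC_add_left)
  show "c *\<^sub>C d *\<^sub>C A = (c * d) *\<^sub>C A" by transfer (simp add: scaleC_scaleC)
  show "of_real r *\<^sub>C A = r *\<^sub>R A" by transfer (simp add: scaleC_of_real)
  show "norm (c *\<^sub>C A) = cmod c * norm A"
  proof transfer
    fix c :: complex and A :: "'a \<Rightarrow> 'b" assume "bounded_linear A"
    then have "onorm (\<lambda>x. cmod c *\<^sub>R A x) = cmod c * onorm A" by (simp add: onorm_scaleR)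
    then show "onorm (\<lambda>x. c *\<^sub>C A x) = cmod c * onorm A" by (simp add: onorm_def norm_scaleC)
  qed
qed

end

definition clinear :: "('a::complex_normed \<Rightarrow> 'b::complex_normed) \<Rightarrow> bool" where
  "clinear f \<longleftrightarrow> (\<forall>x y. f (x + y) = f x + f y) \<and> (\<forall>c x. f (c *\<^sub>C x) = c *\<^sub>C f x)"

definition clinear_on :: "'a::complex_normed set \<Rightarrow> ('a \<Rightarrow> 'b::complex_normed) \<Rightarrow> bool" where
  "clinear_on S f \<longleftrightarrow>
    (\<forall>x\<in>S. \<forall>y\<in>S. f (x + y) = f x + f y) \<and> (\<forall>c. \<forall>x\<in>S. f (c *\<^sub>C x) = c *\<^sub>C f x)"


section \<open>The Hilbert spaces $L^2((0,\infty);E)$\<close>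

abbreviation half_line :: "real measure" where
  "half_line \<equiv> restrict_space lborel {0<..}"

definition square_integrable ::
  "(real \<Rightarrow> 'a::{complex_inner, second_countable_topology}) \<Rightarrow> bool" where
  "square_integrable f \<longleftrightarrow>
    f \<in> borel_measurable half_line \<and> integrable half_line (\<lambda>x. (norm (f x))\<^sup>2)"

definition L2_eq ::
  "(real \<Rightarrow> 'a::{complex_inner, second_countable_topology}) \<Rightarrow> (real \<Rightarrow> 'a) \<Rightarrow> bool" where
  "L2_eq f g \<longleftrightarrow>
    square_integrable f \<and> square_integrable g \<and> (AE x in half_line. f x = g x)"

lemma square_integrable_0: "square_integrable (\<lambda>x. 0)"
  by (simp add: square_integrable_def)

lemma square_integrable_add:
  assumes f: "square_integrable f" and g: "square_integrable g"
  shows "square_integrable (\<lambda>x. f x + g x)"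
proof -
  have [measurable]: "f \<in> borel_measurable half_line" "g \<in> borel_measurable half_line"
    using f g by (auto simp: square_integrable_def)
  have "integrable half_line (\<lambda>x. 2 * ((norm (f x))\<^sup>2 + (norm (g x))\<^sup>2))"
    using f g by (auto simp: square_integrable_def)
  then have "integrable half_line (\<lambda>x. (norm (f x + g x))\<^sup>2)"
  proof (rule Bochner_Integration.integrable_bound)
    have "(norm (f x + g x))\<^sup>2 \<le> 2 * ((norm (f x))\<^sup>2 + (norm (g x))\<^sup>2)" for x
    proof -
      have "(norm (f x + g x))\<^sup>2 \<le> (norm (f x) + norm (g x))\<^sup>2"
        by (intro power_mono norm_triangle_ineq) auto
      also have "\<dots> \<le> 2 * ((norm (f x))\<^sup>2 + (norm (g x))\<^sup>2)"
        using zero_le_power2[of "norm (f x) - norm (g x)"]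
        by (simp add: power2_eq_square algebra_simps)
      finally show ?thesis .
    qed
    then show "AE x in half_line. norm ((norm (f x + g x))\<^sup>2)
        \<le> norm (2 * ((norm (f x))\<^sup>2 + (norm (g x))\<^sup>2))" by simp
  qed measurable
  then show ?thesis by (simp add: square_integrable_def)
qed

lemma square_integrable_scaleR:
  assumes "square_integrable f"
  shows "square_integrable (\<lambda>x. r *\<^sub>R f x)"
  using assms by (auto simp: square_integrable_def power_mult_distrib)

lemma bounded_linear_scaleC: "bounded_linear (\<lambda>x::'a::complex_normed. c *\<^sub>C x)"
proof -
  have "bounded_linear (blinfun_apply (c *\<^sub>C (id_blinfun :: 'a \<Rightarrow>\<^sub>L 'a)))"
    by (rule blinfun.bounded_linear_right)
  then show ?thesis by (simp add: scaleC_blinfun.rep_eq)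
qed

lemma square_integrable_scaleC:
  assumes "square_integrable f"
  shows "square_integrable (\<lambda>x. c *\<^sub>C f x)"
proof -
  have "(\<lambda>x. c *\<^sub>C f x) \<in> borel_measurable half_line"
    using assms bounded_linear.linear[OF bounded_linear_scaleC]
    by (auto simp: square_integrable_def intro!: borel_measurable_continuous_onI
        measurable_compose[where f = f and g = "\<lambda>x. c *\<^sub>C x"]
        linear_continuous_on bounded_linear_scaleC)
  then show ?thesis
    using assms by (auto simp: square_integrable_def norm_scaleC power_mult_distrib)
qed

lemma integrable_inner:
  assumes f: "square_integrable f" and g: "square_integrable g"
  shows "integrable half_line (\<lambda>x. f x \<bullet> g x)"
proof -
  have [measurable]: "f \<in> borel_measurable half_line" "g \<in> borel_measurable half_line"
    using f g by (auto simp: square_integrable_def)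
  have "integrable half_line (\<lambda>x. (norm (f x))\<^sup>2 + (norm (g x))\<^sup>2)"
    using f g by (auto simp: square_integrable_def)
  then show ?thesis
  proof (rule Bochner_Integration.integrable_bound)
    have "\<bar>f x \<bullet> g x\<bar> \<le> (norm (f x))\<^sup>2 + (norm (g x))\<^sup>2" for x
    proof -
      have "\<bar>f x \<bullet> g x\<bar> \<le> norm (f x) * norm (g x)" by (rule Cauchy_Schwarz_ineq2)
      also have "\<dots> \<le> (norm (f x))\<^sup>2 + (norm (g x))\<^sup>2"
        using zero_le_power2[of "norm (f x) - norm (g x)"]
          mult_nonneg_nonneg[OF norm_ge_zero[of "f x"] norm_ge_zero[of "g x"]]
        unfolding power2_eq_square right_diff_distrib left_diff_distrib
          mult.commute[of "norm (g x)" "norm (f x)"] by linarith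
      finally show ?thesis .
    qed
    then show "AE x in half_line. norm (f x \<bullet> g x)
        \<le> norm ((norm (f x))\<^sup>2 + (norm (g x))\<^sup>2)" by simp
  qed measurable
qed

quotient_type (overloaded) 'a L2 =
  "real \<Rightarrow> 'a::{complex_inner, second_countable_topology}" / partial: L2_eq
proof (rule part_equivpI)
  show "\<exists>f. L2_eq f f"
    by (rule exI[of _ "\<lambda>x. 0"]) (simp add: L2_eq_def square_integrable_0)
  show "symp L2_eq" by (rule sympI) (auto simp: L2_eq_def)
  show "transp L2_eq" by (rule transpI) (auto simp: L2_eq_def)
qed

instantiation L2 :: ("{complex_inner, second_countable_topology}") real_inner
begin

lift_definition zero_L2 :: "'a L2" is "\<lambda>x. 0"
  by (simp add: L2_eq_def square_integrable_0)

lift_definition plus_L2 :: "'a L2 \<Rightarrow> 'a L2 \<Rightarrow> 'a L2" is "\<lambda>f g x. f x + g x"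
  by (auto simp: L2_eq_def square_integrable_add)

lift_definition scaleR_L2 :: "real \<Rightarrow> 'a L2 \<Rightarrow> 'a L2" is "\<lambda>r f x. r *\<^sub>R f x"
  by (auto simp: L2_eq_def square_integrable_scaleR)

lift_definition inner_L2 :: "'a L2 \<Rightarrow> 'a L2 \<Rightarrow> real"
  is "\<lambda>f g. \<integral>x. f x \<bullet> g x \<partial>half_line"
proof -
  fix f f' g g' :: "real \<Rightarrow> 'a"
  assume eq: "L2_eq f f'" "L2_eq g g'"
  then have "AE x in half_line. f x \<bullet> g x = f' x \<bullet> g' x" by (auto simp: L2_eq_def)
  with eq show "(\<integral>x. f x \<bullet> g x \<partial>half_line) = (\<integral>x. f' x \<bullet> g' x \<partial>half_line)"
    by (intro integral_cong_AE borel_measurable_integrable integrable_inner)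
      (auto simp: L2_eq_def)
qed

definition uminus_L2 :: "'a L2 \<Rightarrow> 'a L2" where "- f = (-1) *\<^sub>R (f :: 'a L2)"
definition minus_L2 :: "'a L2 \<Rightarrow> 'a L2 \<Rightarrow> 'a L2" where "f - g = f + - (g :: 'a L2)"
definition norm_L2 :: "'a L2 \<Rightarrow> real" where "norm f = sqrt (f \<bullet> (f :: 'a L2))"
definition dist_L2 :: "'a L2 \<Rightarrow> 'a L2 \<Rightarrow> real" where "dist f g = norm (f - (g :: 'a L2))"
definition sgn_L2 :: "'a L2 \<Rightarrow> 'a L2" where "sgn f = inverse (norm f) *\<^sub>R (f :: 'a L2)"
definition uniformity_L2 :: "('a L2 \<times> 'a L2) filter" where
  "uniformity_L2 = (INF e\<in>{0<..}. principal {(f, g :: 'a L2). dist f g < e})"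
definition open_L2 :: "'a L2 set \<Rightarrow> bool" where
  "open_L2 U \<longleftrightarrow> (\<forall>f\<in>U. eventually (\<lambda>(g, h). g = f \<longrightarrow> h \<in> (U :: 'a L2 set)) uniformity)"

instance
proof
  fix f g h :: "'a L2" and r s :: real and U :: "'a L2 set"
  show "f + g + h = f + (g + h)"
    by transfer (auto simp: L2_eq_def add.assoc intro!: square_integrable_add)
  show "f + g = g + f"
    by transfer (auto simp: L2_eq_def add.commute intro!: square_integrable_add)
  show "0 + f = f" by transfer (auto simp: L2_eq_def)
  show "- f + f = 0" unfolding uminus_L2_def
    by transfer (auto simp: L2_eq_def square_integrable_0)
  show "f - g = f + - g" by (simp add: minus_L2_def)
  show "r *\<^sub>R (f + g) = r *\<^sub>R f + r *\<^sub>R g"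
    by transfer (auto simp: L2_eq_def scaleR_add_right
        intro!: square_integrable_add square_integrable_scaleR)
  show "(r + s) *\<^sub>R f = r *\<^sub>R f + s *\<^sub>R f"
    by transfer (auto simp: L2_eq_def scaleR_add_left
        intro!: square_integrable_add square_integrable_scaleR)
  show "r *\<^sub>R s *\<^sub>R f = (r * s) *\<^sub>R f"
    by transfer (auto simp: L2_eq_def intro!: square_integrable_scaleR)
  show "1 *\<^sub>R f = f" by transfer (auto simp: L2_eq_def)
  show "dist f g = norm (f - g)" by (simp add: dist_L2_def)
  show "sgn f = inverse (norm f) *\<^sub>R f" by (simp add: sgn_L2_def)
  show "uniformity = (INF e\<in>{0<..}. principal {(f, g :: 'a L2). dist f g < e})"
    by (simp add: uniformity_L2_def)
  show "open U \<longleftrightarrow> (\<forall>f\<in>U. eventually (\<lambda>(g, h). g = f \<longrightarrow> h \<in> U) uniformity)"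
    by (simp add: open_L2_def)
  show "f \<bullet> g = g \<bullet> f" by transfer (simp add: inner_commute)
  show "(f + g) \<bullet> h = f \<bullet> h + g \<bullet> h"
    by transfer (simp add: inner_add_left L2_eq_def integrable_inner)
  show "(r *\<^sub>R f) \<bullet> g = r * (f \<bullet> g)" by transfer simp
  show "0 \<le> f \<bullet> f" by transfer simp
  show "f \<bullet> f = 0 \<longleftrightarrow> f = 0"
  proof transfer
    fix f :: "real \<Rightarrow> 'a" assume "L2_eq f f"
    then have f: "square_integrable f" by (simp add: L2_eq_def)
    show "(\<integral>x. f x \<bullet> f x \<partial>half_line) = 0 \<longleftrightarrow> L2_eq f (\<lambda>x. 0)"
      using integral_nonneg_eq_0_iff_AE[OF integrable_inner[OF f f]] f
      by (simp add: L2_eq_def square_integrable_0)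
  qed
  show "norm f = sqrt (f \<bullet> f)" by (simp add: norm_L2_def)
qed

end

instantiation L2 :: ("{complex_inner, second_countable_topology}") complex_inner
begin

lift_definition scaleC_L2 :: "complex \<Rightarrow> 'a L2 \<Rightarrow> 'a L2" is "\<lambda>c f x. c *\<^sub>C f x"
  by (auto simp: L2_eq_def square_integrable_scaleC)

instance
proof
  fix f g :: "'a L2" and r :: real and c d :: complex
  show "c *\<^sub>C (f + g) = c *\<^sub>C f + c *\<^sub>C g"
    by transfer (auto simp: L2_eq_def scaleC_add_right
        intro!: square_integrable_add square_integrable_scaleC)
  show "(c + d) *\<^sub>C f = c *\<^sub>C f + d *\<^sub>C f"
    by transfer (auto simp: L2_eq_def scaleC_add_left
        intro!: square_integrable_add square_integrable_scaleC)
  show "c *\<^sub>C d *\<^sub>C f = (c * d) *\<^sub>C f"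
    by transfer (auto simp: L2_eq_def scaleC_scaleC intro!: square_integrable_scaleC)
  show "of_real r *\<^sub>C f = r *\<^sub>R f"
    by transfer (auto simp: L2_eq_def scaleC_of_real intro!: square_integrable_scaleR)
  have "(c *\<^sub>C f) \<bullet> (c *\<^sub>C f) = (cmod c)\<^sup>2 * (f \<bullet> f)"
    by transfer (simp add: dot_square_norm norm_scaleC power_mult_distrib)
  then show "norm (c *\<^sub>C f) = cmod c * norm f"
    by (simp add: norm_eq_sqrt_inner real_sqrt_mult)
qed

end

text \<open>
  \<open>rep_L2 f\<close> is some square integrable function in the class \<open>f\<close>, and \<open>abs_L2\<close> maps a square
  integrable function to its class.
\<close>

lemma L2_eq_rep_abs: "square_integrable f \<Longrightarrow> L2_eq (rep_L2 (abs_L2 f)) f"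
  by (rule Quotient3_rep_abs[OF Quotient3_L2]) (simp add: L2_eq_def)

lemma abs_rep_L2: "abs_L2 (rep_L2 f) = f"
  by (simp add: Quotient3_abs_rep[OF Quotient3_L2])

lemma square_integrable_rep: "square_integrable (rep_L2 f)"
  using Quotient3_rep_reflp[OF Quotient3_L2, of f] by (simp add: L2_eq_def)

lemma inner_L2_rep: "f \<bullet> g = (\<integral>x. rep_L2 f x \<bullet> rep_L2 g x \<partial>half_line)"
  by (simp add: inner_L2_def)

lemma power2_norm_L2: "(norm f)\<^sup>2 = (\<integral>x. (norm (rep_L2 f x))\<^sup>2 \<partial>half_line)"
  by (simp add: inner_L2_rep flip: dot_square_norm)

lemma abs_L2_eq: "L2_eq f g \<Longrightarrow> abs_L2 f = abs_L2 g"
  by (rule Quotient3_rel_abs[OF Quotient3_L2])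

lemma plus_L2_rep: "f + g = abs_L2 (\<lambda>x. rep_L2 f x + rep_L2 g x)"
  by (simp add: plus_L2_def)

lemma scaleR_L2_rep: "r *\<^sub>R f = abs_L2 (\<lambda>x. r *\<^sub>R rep_L2 f x)"
  by (simp add: scaleR_L2_def)

lemma scaleC_L2_rep: "c *\<^sub>C f = abs_L2 (\<lambda>x. c *\<^sub>C rep_L2 f x)"
  by (simp add: scaleC_L2_def)

lemma cinner_L2:
  "cinner f g = (\<integral>x. cinner (rep_L2 f x) (rep_L2 g x) \<partial>half_line)"
proof -
  let ?f = "rep_L2 f" and ?g = "rep_L2 g"
  note sq = square_integrable_rep[of f] square_integrable_rep[of g]
  have isq: "square_integrable (\<lambda>x. \<i> *\<^sub>C ?f x)" by (rule square_integrable_scaleC[OF sq(1)])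
  have eq: "L2_eq (rep_L2 (\<i> *\<^sub>C f)) (\<lambda>x. \<i> *\<^sub>C ?f x)"
    unfolding scaleC_L2_rep by (rule L2_eq_rep_abs[OF isq])
  have im: "(\<i> *\<^sub>C f) \<bullet> g = (\<integral>x. (\<i> *\<^sub>C ?f x) \<bullet> ?g x \<partial>half_line)"
    unfolding inner_L2_rep
    using eq by (intro integral_cong_AE borel_measurable_integrable integrable_inner isq sq
        square_integrable_rep) (auto simp: L2_eq_def)
  have c: "cinner (?f x) (?g x) = of_real (?f x \<bullet> ?g x) + \<i> * of_real ((\<i> *\<^sub>C ?f x) \<bullet> ?g x)" for x
    by (simp add: cinner_def complex_eq_iff)
  have "(\<integral>x. cinner (?f x) (?g x) \<partial>half_line) =
      (\<integral>x. of_real (?f x \<bullet> ?g x) \<partial>half_line)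
      + (\<integral>x. \<i> * of_real ((\<i> *\<^sub>C ?f x) \<bullet> ?g x) \<partial>half_line)"
    unfolding c by (intro Bochner_Integration.integral_add integrable_mult_right integrable_of_real
        integrable_inner isq sq)
  also have "\<dots> = of_real (f \<bullet> g) + \<i> * of_real ((\<i> *\<^sub>C f) \<bullet> g)"
    by (simp add: im inner_L2_rep[of f g])
  finally show ?thesis by (simp add: cinner_def complex_eq_iff)
qed


section \<open>Operators\<close>

text \<open>
  The type of bounded operators of the library consists of real-linear maps; \<open>B(H)\<close> is the
  subset of the complex-linear ones.
\<close>

definition bounded_ops :: "('a::complex_inner \<Rightarrow>\<^sub>L 'a) set" where
  "bounded_ops = {A. clinear (blinfun_apply A)}"

definition adj :: "('a::complex_inner \<Rightarrow>\<^sub>L 'b::complex_inner) \<Rightarrow> 'b \<Rightarrow>\<^sub>L 'a" where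
  "adj A = (THE B. \<forall>f g. cinner (blinfun_apply A f) g = cinner f (blinfun_apply B g))"

text \<open>The operator which acts pointwise: \<open>(pointwise T f)(x) = T x (f x)\<close>.\<close>

definition pointwise ::
  "(real \<Rightarrow> 'a \<Rightarrow> 'b) \<Rightarrow> 'a::{complex_inner, second_countable_topology} L2 \<Rightarrow>\<^sub>L
    'b::{complex_inner, second_countable_topology} L2" where
  "pointwise T = Blinfun (\<lambda>f. abs_L2 (\<lambda>x. T x (rep_L2 f x)))"

definition shift ::
  "real \<Rightarrow> 'a::{complex_inner, second_countable_topology} L2 \<Rightarrow>\<^sub>L 'a L2" where
  "shift t = Blinfun (\<lambda>f. abs_L2 (\<lambda>x. if x > t then rep_L2 f (x - t) else 0))"

text \<open>\<open>Blinfun\<close> is meaningful only for bounded linear maps, hence the following checks.\<close>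

lemma bounded_linear_abs_L2:
  fixes F :: "(real \<Rightarrow> 'a::{complex_inner, second_countable_topology}) \<Rightarrow>
    real \<Rightarrow> 'b::{complex_inner, second_countable_topology}"
  assumes resp: "\<And>f g. L2_eq f g \<Longrightarrow> L2_eq (F f) (F g)"
    and add: "\<And>f g. F (\<lambda>x. f x + g x) = (\<lambda>x. F f x + F g x)"
    and scale: "\<And>r f. F (\<lambda>x. r *\<^sub>R f x) = (\<lambda>x. r *\<^sub>R F f x)"
    and bound: "\<And>f. square_integrable f \<Longrightarrow>
      (\<integral>x. (norm (F f x))\<^sup>2 \<partial>half_line) \<le> K\<^sup>2 * (\<integral>x. (norm (f x))\<^sup>2 \<partial>half_line)"
  shows "bounded_linear (\<lambda>f. abs_L2 (F (rep_L2 f)))"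
proof (rule bounded_linear_intro)
  have refl: "L2_eq (F f) (F f)" if "square_integrable f" for f
    using resp[of f f] that by (simp add: L2_eq_def)
  fix f g :: "'a L2" and r :: real
  have sF: "square_integrable (F (rep_L2 f))" for f
    using refl[OF square_integrable_rep] by (simp add: L2_eq_def)
  have rep: "L2_eq (rep_L2 (abs_L2 (F (rep_L2 f)))) (F (rep_L2 f))" for f
    by (rule L2_eq_rep_abs[OF sF])
  show "abs_L2 (F (rep_L2 (f + g))) = abs_L2 (F (rep_L2 f)) + abs_L2 (F (rep_L2 g))"
  proof -
    have "L2_eq (F (rep_L2 (f + g))) (F (\<lambda>x. rep_L2 f x + rep_L2 g x))"
      unfolding plus_L2_rep
      by (intro resp L2_eq_rep_abs square_integrable_add square_integrable_rep)
    then have "L2_eq (F (rep_L2 (f + g)))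
        (\<lambda>x. rep_L2 (abs_L2 (F (rep_L2 f))) x + rep_L2 (abs_L2 (F (rep_L2 g))) x)"
      using rep[of f] rep[of g] unfolding add by (auto simp: L2_eq_def intro!: square_integrable_add)
    then show ?thesis unfolding plus_L2_rep[of "abs_L2 _"] by (rule abs_L2_eq)
  qed
  show "abs_L2 (F (rep_L2 (r *\<^sub>R f))) = r *\<^sub>R abs_L2 (F (rep_L2 f))"
  proof -
    have "L2_eq (F (rep_L2 (r *\<^sub>R f))) (F (\<lambda>x. r *\<^sub>R rep_L2 f x))"
      unfolding scaleR_L2_rep
      by (intro resp L2_eq_rep_abs square_integrable_scaleR square_integrable_rep)
    then have "L2_eq (F (rep_L2 (r *\<^sub>R f))) (\<lambda>x. r *\<^sub>R rep_L2 (abs_L2 (F (rep_L2 f))) x)"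
      using rep[of f] unfolding scale by (auto simp: L2_eq_def intro!: square_integrable_scaleR)
    then show ?thesis unfolding scaleR_L2_rep[of r "abs_L2 _"] by (rule abs_L2_eq)
  qed
  have "(norm (abs_L2 (F (rep_L2 f))))\<^sup>2 = (\<integral>x. (norm (F (rep_L2 f) x))\<^sup>2 \<partial>half_line)"
    unfolding power2_norm_L2 using rep[of f]
    by (intro integral_cong_AE) (auto simp: L2_eq_def square_integrable_def)
  also have "\<dots> \<le> K\<^sup>2 * (norm f)\<^sup>2"
    unfolding power2_norm_L2 by (rule bound[OF square_integrable_rep])
  finally have "(norm (abs_L2 (F (rep_L2 f))))\<^sup>2 \<le> (norm f * \<bar>K\<bar>)\<^sup>2"
    by (simp add: power_mult_distrib mult.commute)
  then show "norm (abs_L2 (F (rep_L2 f))) \<le> norm f * \<bar>K\<bar>"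
    by (rule power2_le_imp_le) simp
qed

context
  fixes T :: "real \<Rightarrow> 'a::{complex_inner, second_countable_topology} \<Rightarrow>
    'b::{complex_inner, second_countable_topology}" and K :: real
  assumes lin: "\<And>x. linear (T x)"
    and bound: "\<And>x v. 0 < x \<Longrightarrow> norm (T x v) \<le> K * norm v"
    and meas: "\<And>f. f \<in> borel_measurable half_line \<Longrightarrow>
      (\<lambda>x. T x (f x)) \<in> borel_measurable half_line"
begin

lemma AE_pointwise_bound: "AE x in half_line. (norm (T x (f x)))\<^sup>2 \<le> K\<^sup>2 * (norm (f x))\<^sup>2"
proof (rule AE_I2)
  fix x :: real assume "x \<in> space half_line"
  then have "0 < x" by (simp add: space_restrict_space)
  from power_mono[OF bound[OF this], of "f x" 2]
  show "(norm (T x (f x)))\<^sup>2 \<le> K\<^sup>2 * (norm (f x))\<^sup>2" by (simp add: power_mult_distrib)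
qed

lemma square_integrable_pointwise:
  assumes f: "square_integrable f"
  shows "square_integrable (\<lambda>x. T x (f x))"
proof -
  have "integrable half_line (\<lambda>x. (norm (T x (f x)))\<^sup>2)"
  proof (rule Bochner_Integration.integrable_bound[of _ "\<lambda>x. K\<^sup>2 * (norm (f x))\<^sup>2"])
    show "integrable half_line (\<lambda>x. K\<^sup>2 * (norm (f x))\<^sup>2)"
      using f by (simp add: square_integrable_def)
    show "(\<lambda>x. (norm (T x (f x)))\<^sup>2) \<in> borel_measurable half_line"
      using meas[of f] f by (simp add: square_integrable_def)
  qed (use AE_pointwise_bound[of f] in simp)
  then show ?thesis using meas[of f] f by (simp add: square_integrable_def)
qed

lemma bounded_linear_pointwise: "bounded_linear (\<lambda>f. abs_L2 (\<lambda>x. T x (rep_L2 f x)))"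
proof (rule bounded_linear_abs_L2[where F = "\<lambda>f x. T x (f x)" and K = K])
  show "L2_eq (\<lambda>x. T x (f x)) (\<lambda>x. T x (g x))" if "L2_eq f g" for f g
    using that by (auto simp: L2_eq_def square_integrable_pointwise)
  show "(\<lambda>x. T x (f x + g x)) = (\<lambda>x. T x (f x) + T x (g x))" for f g
    by (simp add: linear_add[OF lin])
  show "(\<lambda>x. T x (r *\<^sub>R f x)) = (\<lambda>x. r *\<^sub>R T x (f x))" for r f
    by (simp add: linear_scale[OF lin])
  show "(\<integral>x. (norm (T x (f x)))\<^sup>2 \<partial>half_line) \<le> K\<^sup>2 * (\<integral>x. (norm (f x))\<^sup>2 \<partial>half_line)"
    if f: "square_integrable f" for f
    using integral_mono_AE[OF _ _ AE_pointwise_bound[of f]] square_integrable_pointwise[OF f] f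
    by (simp add: square_integrable_def)
qed

lemma rep_pointwise: "L2_eq (rep_L2 (pointwise T f)) (\<lambda>x. T x (rep_L2 f x))"
  unfolding pointwise_def bounded_linear_Blinfun_apply[OF bounded_linear_pointwise]
  by (intro L2_eq_rep_abs square_integrable_pointwise square_integrable_rep)

end

lemma half_line_translate:
  fixes h :: "real \<Rightarrow> real"
  assumes t: "0 \<le> t" and int: "integrable half_line h"
  shows "integrable half_line (\<lambda>x. if x > t then h (x - t) else 0)"
    and "(\<integral>x. (if x > t then h (x - t) else 0) \<partial>half_line) = (\<integral>x. h x \<partial>half_line)"
proof -
  have eq: "(\<lambda>x. indicator {0<..} x *\<^sub>R (if x > t then h (x - t) else 0))
      = (\<lambda>x. indicator {0<..} (- t + 1 * x) *\<^sub>R h (- t + 1 * x))"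
    using t by (auto simp: indicator_def fun_eq_iff)
  have i: "integrable lborel (\<lambda>x. indicator {0<..} x *\<^sub>R h x)"
    using int by (subst (asm) integrable_restrict_space) (auto simp: set_integrable_def)
  show "integrable half_line (\<lambda>x. if x > t then h (x - t) else 0)"
    using lborel_integrable_real_affine[OF i, of 1 "- t"]
    by (subst integrable_restrict_space) (simp_all add: set_integrable_def eq del: real_scaleR_def)
  show "(\<integral>x. (if x > t then h (x - t) else 0) \<partial>half_line) = (\<integral>x. h x \<partial>half_line)"
    using lborel_integral_real_affine[of 1 "\<lambda>x. indicator {0<..} x *\<^sub>R h x" "- t"]
    by (subst (1 2) integral_restrict_space)
      (simp_all add: set_lebesgue_integral_def eq del: real_scaleR_def)
qed

lemma half_line_translate_measurable:
  fixes f :: "real \<Rightarrow> 'a::{complex_inner, second_countable_topology}"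
  assumes f: "f \<in> borel_measurable half_line"
  shows "(\<lambda>x. if x > t then f (x - t) else 0) \<in> borel_measurable half_line"
proof -
  have "(\<lambda>x. if x \<in> {0<..} then f x else 0) \<in> borel_measurable borel"
    using f by (subst (asm) measurable_restrict_space_iff[where c = 0]) auto
  then have "(\<lambda>x. if x - t \<in> {0<..} then f (x - t) else 0) \<in> borel_measurable borel"
    by (rule measurable_compose[rotated]) simp
  then show ?thesis by (intro measurable_restrict_space1) (simp add: measurable_lborel1)
qed

lemma half_line_translate_AE:
  assumes t: "0 \<le> t" and P: "AE x in half_line. P x"
  shows "AE x in half_line. t < x \<longrightarrow> P (x - t)"
proof -
  have "AE x in lborel. x \<in> {0<..} \<longrightarrow> P x"
    using P by (simp add: AE_restrict_space_iff)
  then have "AE x in lborel. x - t \<in> {0<..} \<longrightarrow> P (x - t)"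
  proof (rule AE_E3)
    fix N assume N: "\<And>x. x \<in> space lborel - N \<Longrightarrow> x \<in> {0<..} \<longrightarrow> P x" "N \<in> null_sets lborel"
    show ?thesis
    proof (rule AE_I'[OF null_sets_translation[OF N(2), of t]], rule subsetI)
      fix x assume "x \<in> {x \<in> space lborel. \<not> (x - t \<in> {0<..} \<longrightarrow> P (x - t))}"
      then show "x \<in> {x. x - t \<in> N}" using N(1)[of "x - t"] by auto
    qed
  qed
  then show ?thesis
    by (auto simp: AE_restrict_space_iff)
qed

context
  fixes t :: real
  assumes t: "0 \<le> t"
begin

lemma norm_shift_fun:
  "(\<lambda>x. (norm (if x > t then f (x - t) else 0))\<^sup>2)
    = (\<lambda>x. if x > t then (norm (f (x - t)))\<^sup>2 else 0)"
  by auto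

lemma square_integrable_shift:
  "square_integrable f \<Longrightarrow> square_integrable (\<lambda>x. if x > t then f (x - t) else 0)"
  using half_line_translate(1)[OF t, of "\<lambda>x. (norm (f x))\<^sup>2"]
  unfolding square_integrable_def norm_shift_fun by (auto intro: half_line_translate_measurable)

lemma bounded_linear_shift:
  "bounded_linear (\<lambda>f. abs_L2 (\<lambda>x. if x > t then rep_L2 f (x - t) else 0))"
proof (rule bounded_linear_abs_L2[where F = "\<lambda>f x. if x > t then f (x - t) else 0" and K = 1])
  show "L2_eq (\<lambda>x. if x > t then f (x - t) else 0) (\<lambda>x. if x > t then g (x - t) else 0)"
    if "L2_eq f g" for f g :: "real \<Rightarrow> 'a"
    using that square_integrable_shift[of f] square_integrable_shift[of g]
      half_line_translate_AE[OF t, of "\<lambda>x. f x = g x"]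
    by (auto simp: L2_eq_def)
  show "(\<integral>x. (norm (if x > t then f (x - t) else 0))\<^sup>2 \<partial>half_line)
      \<le> 1\<^sup>2 * (\<integral>x. (norm (f x))\<^sup>2 \<partial>half_line)"
    if "square_integrable f" for f :: "real \<Rightarrow> 'a"
    using that half_line_translate(2)[OF t, of "\<lambda>x. (norm (f x))\<^sup>2"]
    unfolding norm_shift_fun by (simp add: square_integrable_def)
qed auto

lemma rep_shift: "L2_eq (rep_L2 (shift t f)) (\<lambda>x. if x > t then rep_L2 f (x - t) else 0)"
  unfolding shift_def bounded_linear_Blinfun_apply[OF bounded_linear_shift]
  by (intro L2_eq_rep_abs square_integrable_shift square_integrable_rep)

end


section \<open>The null boundary algebra\<close>

text \<open>
  \<open>(Lambda T f)(x) = e\<^sup>-\<^sup>x T (f x)\<close>. The map $\Lambda$ is \<open>\<lambda>A. Lambda ((*v) A)\<close> on the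
  matrices \<open>A\<close>, and \<open>Lambda id\<close> is both $\Lambda(I)$ on the vector-valued space and $\Lambda(1)$ on
  the scalar one.
\<close>

definition Lambda ::
  "('a \<Rightarrow> 'a) \<Rightarrow> 'a::{complex_inner, second_countable_topology} L2 \<Rightarrow>\<^sub>L 'a L2" where
  "Lambda T = pointwise (\<lambda>x v. exp (- x) *\<^sub>R T v)"

text \<open>The square root of \<open>I - Lambda id\<close>, see \<open>sqrt_complement_square\<close> and
  \<open>sqrt_complement_positive\<close>.\<close>

definition sqrt_complement :: "'a::{complex_inner, second_countable_topology} L2 \<Rightarrow>\<^sub>L 'a L2" where
  "sqrt_complement = pointwise (\<lambda>x v. sqrt (1 - exp (- x)) *\<^sub>R v)"

definition positive_op :: "('a::complex_inner \<Rightarrow>\<^sub>L 'a) \<Rightarrow> bool" where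
  "positive_op A \<longleftrightarrow> (\<forall>f. cinner f (blinfun_apply A f) \<in> \<real>\<^sub>\<ge>\<^sub>0)"

lemma rep_Lambda:
  fixes T :: "'a::{complex_inner, second_countable_topology} \<Rightarrow> 'a"
  assumes T: "bounded_linear T"
  shows "L2_eq (rep_L2 (Lambda T f)) (\<lambda>x. exp (- x) *\<^sub>R T (rep_L2 f x))"
  unfolding Lambda_def
proof (rule rep_pointwise)
  interpret bounded_linear T by (rule T)
  show "linear (\<lambda>v. exp (- x) *\<^sub>R T v)" for x :: real
    by (rule linearI) (simp_all add: add scaleR algebra_simps)
  show "norm (exp (- x) *\<^sub>R T v) \<le> onorm T * norm v" if "0 < x" for x v
  proof -
    have "exp (- x) * norm (T v) \<le> 1 * norm (T v)" by (rule mult_right_mono) (use that in auto)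
    then show ?thesis using onorm[OF T, of v] by simp
  qed
  show "(\<lambda>x. exp (- x) *\<^sub>R T (g x)) \<in> borel_measurable half_line"
    if "g \<in> borel_measurable half_line" for g
    using that by (intro borel_measurable_scaleR measurable_compose[OF that]
        borel_measurable_continuous_onI linear_continuous_on T) (auto simp: measurable_restrict_space1)
qed

lemma rep_sqrt_complement:
  "L2_eq (rep_L2 (sqrt_complement f)) (\<lambda>x. sqrt (1 - exp (- x)) *\<^sub>R rep_L2 f x)"
  unfolding sqrt_complement_def
proof (rule rep_pointwise)
  show "linear ((*\<^sub>R) (sqrt (1 - exp (- x))))" for x :: real
    by (rule linearI) (simp_all add: algebra_simps)
  show "norm (sqrt (1 - exp (- x)) *\<^sub>R v) \<le> 1 * norm v" if "0 < x" for x and v :: 'a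
    using that by (intro order_trans[OF eq_refl[OF norm_scaleR]] mult_right_mono) auto
  show "(\<lambda>x. sqrt (1 - exp (- x)) *\<^sub>R g x) \<in> borel_measurable half_line"
    if "g \<in> borel_measurable half_line" for g :: "real \<Rightarrow> 'a"
    using that by (intro borel_measurable_scaleR that measurable_restrict_space1) auto
qed

lemma L2_eqI: "L2_eq (rep_L2 f) (rep_L2 g) \<Longrightarrow> f = g"
  by (simp add: Quotient3_rel_rep[OF Quotient3_L2])

lemma sqrt_complement_square:
  "sqrt_complement o\<^sub>L sqrt_complement = id_blinfun - Lambda id"
proof (rule blinfun_eqI, rule L2_eqI)
  fix f :: "'a L2"
  have "id_blinfun f - Lambda id f = f + (-1) *\<^sub>R Lambda id f" by simp
  moreover have "L2_eq (rep_L2 (f + (-1) *\<^sub>R Lambda id f))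
      (\<lambda>x. rep_L2 f x + rep_L2 ((-1) *\<^sub>R Lambda id f) x)"
    unfolding plus_L2_rep
    by (intro L2_eq_rep_abs square_integrable_add square_integrable_rep)
  moreover have "L2_eq (rep_L2 ((-1) *\<^sub>R Lambda id f)) (\<lambda>x. (-1) *\<^sub>R rep_L2 (Lambda id f) x)"
    unfolding scaleR_L2_rep[of "-1"]
    by (intro L2_eq_rep_abs square_integrable_scaleR square_integrable_rep)
  ultimately have "AE x in half_line. rep_L2 (id_blinfun f - Lambda id f) x
      = rep_L2 f x - exp (- x) *\<^sub>R rep_L2 f x"
    using rep_Lambda[OF bounded_linear_ident, of f] by (auto simp: L2_eq_def id_def)
  moreover have "AE x in half_line. rep_L2 (sqrt_complement (sqrt_complement f)) x
      = sqrt (1 - exp (- x)) *\<^sub>R sqrt (1 - exp (- x)) *\<^sub>R rep_L2 f x"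
    using rep_sqrt_complement[of f] rep_sqrt_complement[of "sqrt_complement f"]
    by (auto simp: L2_eq_def)
  moreover have "AE x in half_line. 0 < x" by (rule AE_I2) (simp add: space_restrict_space)
  ultimately have "AE x in half_line. rep_L2 (sqrt_complement (sqrt_complement f)) x
      = rep_L2 (id_blinfun f - Lambda id f) x"
    by eventually_elim (simp add: scaleR_diff_left)
  then show "L2_eq (rep_L2 ((sqrt_complement o\<^sub>L sqrt_complement) f))
      (rep_L2 ((id_blinfun - Lambda id) f))"
    by (simp add: L2_eq_def square_integrable_rep minus_blinfun.rep_eq)
qed

lemma sqrt_complement_positive: "positive_op sqrt_complement"
  unfolding positive_op_def
proof
  fix f :: "'a L2"
  have ortho: "(\<i> *\<^sub>C v) \<bullet> v = 0" for v :: 'a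
  proof -
    have "norm ((1 + \<i>) *\<^sub>C v) ^ 2 = 2 * (norm v)\<^sup>2"
      by (simp add: norm_scaleC power_mult_distrib cmod_def)
    moreover have "(1 + \<i>) *\<^sub>C v = v + \<i> *\<^sub>C v"
      using scaleC_of_real[of 1 v] by (simp add: scaleC_add_left)
    moreover have "(norm (v + \<i> *\<^sub>C v))\<^sup>2 = (norm v)\<^sup>2 + 2 * ((\<i> *\<^sub>C v) \<bullet> v) + (norm (\<i> *\<^sub>C v))\<^sup>2"
      by (simp add: inner_add_left inner_add_right inner_commute flip: dot_square_norm)
    ultimately show ?thesis by (simp add: norm_scaleC)
  qed
  have pos: "AE x in half_line. 0 < x" by (rule AE_I2) (simp add: space_restrict_space)
  have S: "AE x in half_line. rep_L2 (sqrt_complement f) x = sqrt (1 - exp (- x)) *\<^sub>R rep_L2 f x"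
    using rep_sqrt_complement[of f] by (simp add: L2_eq_def)
  have I: "AE x in half_line. rep_L2 (\<i> *\<^sub>C f) x = \<i> *\<^sub>C rep_L2 f x"
    unfolding scaleC_L2_rep[of \<i> f]
    using L2_eq_rep_abs[OF square_integrable_scaleC[OF square_integrable_rep[of f], of \<i>]]
    by (simp add: L2_eq_def)
  have "0 \<le> f \<bullet> sqrt_complement f"
    unfolding inner_L2_rep
    by (rule integral_nonneg_AE) (use S pos in eventually_elim, simp)
  moreover have "(\<i> *\<^sub>C f) \<bullet> sqrt_complement f = 0"
    unfolding inner_L2_rep
    by (rule integral_eq_zero_AE) (use S I in eventually_elim, simp add: ortho)
  ultimately show "cinner f (sqrt_complement f) \<in> \<real>\<^sub>\<ge>\<^sub>0"
    by (simp add: cinner_def complex_nonneg_Reals_iff)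
qed

definition null_boundary_algebra ::
  "('a::{complex_inner, second_countable_topology} L2 \<Rightarrow>\<^sub>L 'a L2) set" where
  "null_boundary_algebra = {sqrt_complement o\<^sub>L B o\<^sub>L sqrt_complement |B. B \<in> bounded_ops}"

text \<open>
  Normal functionals on \<open>B(H)\<close> are the \<open>\<sigma>\<close>-weakly continuous ones, that is, those of
  the form $A \mapsto \sum_k \langle f_k, A g_k\rangle$.
\<close>

definition normal_functional :: "(('a::complex_inner \<Rightarrow>\<^sub>L 'a) \<Rightarrow> complex) \<Rightarrow> bool" where
  "normal_functional \<eta> \<longleftrightarrow> (\<exists>f g :: nat \<Rightarrow> 'a.
    summable (\<lambda>k. (norm (f k))\<^sup>2) \<and> summable (\<lambda>k. (norm (g k))\<^sup>2) \<and>
    (\<forall>A\<in>bounded_ops. (\<lambda>k. cinner (f k) (blinfun_apply A (g k))) sums \<eta> A))"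

text \<open>Only the values of a boundary weight on \<open>null_boundary_algebra\<close> are meaningful.\<close>

definition boundary_weight ::
  "(('a::{complex_inner, second_countable_topology} L2 \<Rightarrow>\<^sub>L 'a L2) \<Rightarrow> complex) \<Rightarrow> bool" where
  "boundary_weight \<mu> \<longleftrightarrow> clinear_on null_boundary_algebra \<mu> \<and>
    normal_functional (\<lambda>A. \<mu> (sqrt_complement o\<^sub>L A o\<^sub>L sqrt_complement))"

definition positive_weight ::
  "(('a::{complex_inner, second_countable_topology} L2 \<Rightarrow>\<^sub>L 'a L2) \<Rightarrow> complex) \<Rightarrow> bool" where
  "positive_weight \<nu> \<longleftrightarrow>
    (\<forall>B\<in>null_boundary_algebra. positive_op B \<longrightarrow> \<nu> B \<in> \<real>\<^sub>\<ge>\<^sub>0)"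

definition normalized_weight :: "((complex L2 \<Rightarrow>\<^sub>L complex L2) \<Rightarrow> complex) \<Rightarrow> bool" where
  "normalized_weight \<nu> \<longleftrightarrow> \<nu> (id_blinfun - Lambda id) = 1"

definition unbounded_weight :: "((complex L2 \<Rightarrow>\<^sub>L complex L2) \<Rightarrow> complex) \<Rightarrow> bool" where
  "unbounded_weight \<nu> \<longleftrightarrow>
    \<not> (\<exists>r>0. \<forall>B\<in>null_boundary_algebra. cmod (\<nu> B) \<le> r * norm B)"


section \<open>Complete positivity\<close>

text \<open>
  Positivity of a matrix $(A_{ij})_{i,j<m}$ of operators on \<open>K\<close>, as an operator on $K^m$.
\<close>

definition positive_block :: "nat \<Rightarrow> (nat \<Rightarrow> nat \<Rightarrow> 'a \<Rightarrow> 'a::complex_inner) \<Rightarrow> bool" where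
  "positive_block m A \<longleftrightarrow>
    (\<forall>h. (\<Sum>i<m. \<Sum>j<m. cinner (h i) (A i j (h j))) \<in> \<real>\<^sub>\<ge>\<^sub>0)"

text \<open>
  \<open>D\<close> is the domain of the map \<open>\<psi>\<close>; \<open>act\<close> and \<open>act'\<close> tell how elements of the domain and the
  codomain act as operators (\<open>blinfun_apply\<close> on \<open>B(H)\<close>, \<open>(*v)\<close> on matrices).
\<close>

definition completely_positive ::
  "'x set \<Rightarrow> ('x \<Rightarrow> 'a \<Rightarrow> 'a::complex_inner) \<Rightarrow> ('y \<Rightarrow> 'b \<Rightarrow> 'b::complex_inner) \<Rightarrow>
    ('x::complex_normed \<Rightarrow> 'y::complex_normed) \<Rightarrow> bool" where
  "completely_positive D act act' \<psi> \<longleftrightarrow> clinear_on D \<psi> \<and>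
    (\<forall>m B. (\<forall>i<m. \<forall>j<m. B i j \<in> D) \<longrightarrow> positive_block m (\<lambda>i j. act (B i j)) \<longrightarrow>
      positive_block m (\<lambda>i j. act' (\<psi> (B i j))))"

type_synonym 'n cmat = "complex ^ 'n ^ 'n"

type_synonym 'n hilbert_ops = "(complex ^ 'n) L2 \<Rightarrow>\<^sub>L (complex ^ 'n) L2"

definition matrix_dual :: "('n::finite cmat \<Rightarrow> complex) set" where
  "matrix_dual = {\<rho>. clinear \<rho>}"

definition cp_weight_map ::
  "(('n::finite cmat \<Rightarrow> complex) \<Rightarrow> 'n hilbert_ops \<Rightarrow> complex) \<Rightarrow> bool" where
  "cp_weight_map \<omega> \<longleftrightarrow> (\<forall>m \<rho>.
    (\<forall>i<m. \<forall>j<m. \<rho> i j \<in> matrix_dual) \<longrightarrow>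
    (\<forall>B. positive_block m (\<lambda>i j. (*v) (B i j)) \<longrightarrow>
      (\<Sum>i<m. \<Sum>j<m. \<rho> i j (B i j)) \<in> \<real>\<^sub>\<ge>\<^sub>0) \<longrightarrow>
    (\<forall>A. (\<forall>i<m. \<forall>j<m. A i j \<in> null_boundary_algebra) \<longrightarrow>
      positive_block m (\<lambda>i j. blinfun_apply (A i j)) \<longrightarrow>
      (\<Sum>i<m. \<Sum>j<m. \<omega> (\<rho> i j) (A i j)) \<in> \<real>\<^sub>\<ge>\<^sub>0))"

definition no_negative_eigenvalues :: "('n::finite cmat \<Rightarrow> 'n cmat) \<Rightarrow> bool" where
  "no_negative_eigenvalues \<phi> \<longleftrightarrow> \<not> (\<exists>r<0. \<exists>X. X \<noteq> 0 \<and> \<phi> X = r *\<^sub>R X)"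

definition q_positive :: "('n::finite cmat \<Rightarrow> 'n cmat) \<Rightarrow> bool" where
  "q_positive \<phi> \<longleftrightarrow> no_negative_eigenvalues \<phi> \<and>
    (\<forall>t\<ge>0. completely_positive UNIV (*v) (*v) (\<phi> \<circ> inv (\<lambda>X. X + t *\<^sub>R \<phi> X)))"


section \<open>The weight map and its truncations\<close>

text \<open>The $(i,j)$ entry of an operator under $B(H) = M_n(B(L^2(0,\infty)))$.\<close>

definition entry :: "'n::finite hilbert_ops \<Rightarrow> 'n \<Rightarrow> 'n \<Rightarrow> complex L2 \<Rightarrow>\<^sub>L complex L2" where
  "entry A i j = pointwise (\<lambda>x v. v $ i) o\<^sub>L A o\<^sub>L pointwise (\<lambda>x c. axis j c)"

lemma rep_component:
  "L2_eq (rep_L2 (pointwise (\<lambda>x v. v $ i) f)) (\<lambda>x. rep_L2 (f :: (complex ^ 'n::finite) L2) x $ i)"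
proof (rule rep_pointwise)
  show "norm (v $ i) \<le> 1 * norm v" for v :: "complex ^ 'n" using Finite_Cartesian_Product.norm_nth_le[of v i] by simp
  show "(\<lambda>x. g x $ i) \<in> borel_measurable half_line"
    if "g \<in> borel_measurable half_line" for g :: "real \<Rightarrow> complex ^ 'n"
    by (rule measurable_compose[OF that])
      (intro borel_measurable_continuous_onI continuous_intros)
qed (rule linearI; simp)

lemma rep_axis:
  fixes i :: "'n::finite"
  shows "L2_eq (rep_L2 (pointwise (\<lambda>x c. axis i c) f)) (\<lambda>x. axis i (rep_L2 (f :: complex L2) x))"
proof (rule rep_pointwise)
  have lin: "linear (axis i :: complex \<Rightarrow> complex ^ 'n)"
    by (rule linearI) (auto simp: axis_def vec_eq_iff)
  then show "linear (axis i :: complex \<Rightarrow> complex ^ 'n)" .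
  show "norm (axis i c) \<le> 1 * norm c" for c :: complex
    by (simp add: norm_eq_sqrt_inner[of "axis i c"] inner_axis_axis flip: norm_eq_sqrt_inner)
  show "(\<lambda>x. axis i (g x)) \<in> borel_measurable half_line"
    if "g \<in> borel_measurable half_line" for g :: "real \<Rightarrow> complex"
    by (rule measurable_compose[OF that])
      (intro borel_measurable_continuous_onI linear_continuous_on
        linear_conv_bounded_linear[THEN iffD1] lin)
qed

definition Omega ::
  "((complex L2 \<Rightarrow>\<^sub>L complex L2) \<Rightarrow> complex) \<Rightarrow> 'n::finite hilbert_ops \<Rightarrow> 'n cmat" where
  "Omega \<nu> A = (\<chi> i j. \<nu> (entry A i j))"

definition omega ::
  "('n cmat \<Rightarrow> 'n cmat) \<Rightarrow> ((complex L2 \<Rightarrow>\<^sub>L complex L2) \<Rightarrow> complex) \<Rightarrow>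
    ('n::finite cmat \<Rightarrow> complex) \<Rightarrow> 'n hilbert_ops \<Rightarrow> complex" where
  "omega \<phi> \<nu> \<rho> A = \<rho> (\<phi> (Omega \<nu> A))"

definition truncated ::
  "(('n::finite cmat \<Rightarrow> complex) \<Rightarrow> 'n hilbert_ops \<Rightarrow> complex) \<Rightarrow> real \<Rightarrow>
    ('n cmat \<Rightarrow> complex) \<Rightarrow> 'n hilbert_ops \<Rightarrow> complex" where
  "truncated \<omega> t \<rho> A =
    \<omega> \<rho> (shift t o\<^sub>L adj (shift t) o\<^sub>L A o\<^sub>L shift t o\<^sub>L adj (shift t))"

definition Lambda_hat :: "('n::finite hilbert_ops \<Rightarrow> complex) \<Rightarrow> 'n cmat \<Rightarrow> complex" where
  "Lambda_hat \<eta> = (\<lambda>A. \<eta> (Lambda ((*v) A)))"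

text \<open>The map $I + \hat\Lambda\omega_t$ on the dual of the matrix algebra.\<close>

definition resolvent_map ::
  "(('n::finite cmat \<Rightarrow> complex) \<Rightarrow> 'n hilbert_ops \<Rightarrow> complex) \<Rightarrow> real \<Rightarrow>
    ('n cmat \<Rightarrow> complex) \<Rightarrow> 'n cmat \<Rightarrow> complex" where
  "resolvent_map \<omega> t \<rho> = (\<lambda>A. \<rho> A + Lambda_hat (truncated \<omega> t \<rho>) A)"

definition pi_hat ::
  "(('n::finite cmat \<Rightarrow> complex) \<Rightarrow> 'n hilbert_ops \<Rightarrow> complex) \<Rightarrow> real \<Rightarrow>
    ('n cmat \<Rightarrow> complex) \<Rightarrow> 'n hilbert_ops \<Rightarrow> complex" where
  "pi_hat \<omega> t \<rho> = truncated \<omega> t (inv_into matrix_dual (resolvent_map \<omega> t) \<rho>)"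

definition normal_map :: "('n::finite hilbert_ops \<Rightarrow> 'n cmat) \<Rightarrow> bool" where
  "normal_map \<pi> \<longleftrightarrow> (\<forall>\<rho>\<in>matrix_dual. normal_functional (\<lambda>A. \<rho> (\<pi> A)))"

text \<open>
  The library norm of a matrix is the Frobenius norm, hence the explicit operator norm.
\<close>

definition contraction :: "('n::finite hilbert_ops \<Rightarrow> 'n cmat) \<Rightarrow> bool" where
  "contraction \<pi> \<longleftrightarrow> (\<forall>A\<in>bounded_ops. onorm ((*v) (\<pi> A)) \<le> norm A)"

end

theory Submission
  imports Defs
begin


text \<open>
  Write $\psi_s = \phi(I + s\phi)^{-1}$ for $s \ge 0$, let $E_t = U_t U_t^*$ be the projection onto
  $L^2(t,\infty)$, and let $\nu_t(A) = \nu(E_t A E_t)$. For $t > 0$ the operator $E_t$ factors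
  through $\sqrt{I - \Lambda(I)}$ with a bounded quotient, so $\nu_t$ is a positive normal
  functional on all of $B(L^2(0,\infty))$.

  Since $\Omega_{\nu_t}(\Lambda(A)) = a_t A$ with $a_t = \nu_t(\Lambda(1)) \ge 0$, the map
  $I + \hat\Lambda\omega_t$ sends $\rho$ to $\rho \circ (I + a_t\phi)$. It is bijective because
  $\phi$ has no negative eigenvalue, and therefore
  $\pi_t^\# = \psi_{a_t} \circ \Omega_{\nu_t}$ (\<open>pi_hat_omega\<close>). The maps $\Omega_\nu$ and
  $\Omega_{\nu_t}$ are completely positive because $\nu$ and $\nu_t$ are positive
  (\<open>Omega_positive_block\<close>); this gives the complete positivity of $\omega$, and that of
  $\pi_t^\#$ when $\phi$ is $q$-positive. Moreover $\pi_t^\#(I) = c_t I$ with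
  $c_t = \nu_t(1)/(1 + a_t)$, and $\nu_t(1) - a_t = \nu(E_t(1 - \Lambda(1))E_t) \le
  \nu(1 - \Lambda(1)) = 1$, so that $c_t \le 1$. Complete positivity then bounds the norm of
  $\pi_t^\#$ by $c_t$: apply it to the positive matrix with diagonal entries $\|A\|$ and
  off-diagonal entries $A$ and $A^*$. For operators $A$ whose adjoint is not at hand one first
  compresses $A$ to a finite-dimensional subspace, where the adjoint is a finite sum, and passes
  to the limit by normality (\<open>normal_functional_bound\<close>).

  Conversely, testing complete positivity of $\pi_t^\#$ on the operators $\Lambda(B)$ gives that of
  $\psi_{a_t}$ as soon as $a_t > 0$ (\<open>resolvent_cp_of_generalized_rep\<close>). The numbers $a_t$ are
  unbounded: a bound $C$ would yield $|\nu_t(A)| \le \nu_t(1)\|A\| \le (1 + C)\|A\|$ for all $t$,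
  and letting $t \to 0$ one finds that $\nu$ is bounded (\<open>mass_unbounded\<close>). So every $s \ge 0$
  lies below some $a_t$, and complete positivity passes from $\psi_s$ down to $\psi_r$ for
  $r \le s$, because $\psi_r$ is the limit of an iteration built from $\psi_s$ with nonnegative
  coefficients (\<open>resolvent_cp_mono\<close>).
\<close>

section \<open>The hermitian inner product\<close>

text \<open>
  Polarization: multiplication by $i$ preserves the norm, hence the real inner product.
\<close>

lemma inner_imaginary_unit:
  fixes x y :: "'a::complex_inner"
  shows "(\<i> *\<^sub>C x) \<bullet> (\<i> *\<^sub>C y) = x \<bullet> y"
proof -
  have n: "(\<i> *\<^sub>C z) \<bullet> (\<i> *\<^sub>C z) = z \<bullet> z" for z :: 'a
    using norm_scaleC[of \<i> z] by (simp add: norm_eq_sqrt_inner)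
  show ?thesis
    using n[of "x + y"] n[of x] n[of y]
    by (simp add: scaleC_add_right inner_add_left inner_add_right inner_commute)
qed

lemma scaleC_imaginary_unit: "\<i> *\<^sub>C \<i> *\<^sub>C x = - (x::'a::complex_normed)"
  using scaleC_of_real[of "-1" x] by (simp add: scaleC_scaleC)

lemma scaleC_one [simp]: "1 *\<^sub>C x = (x::'a::complex_normed)"
  using scaleC_of_real[of 1 x] by simp

lemma scaleC_zero [simp]: "0 *\<^sub>C x = (0::'a::complex_normed)" "c *\<^sub>C (0::'a) = 0"
  using scaleC_of_real[of 0 x] norm_scaleC[of c "0::'a"] by auto

lemma scaleC_split: "c *\<^sub>C x = Re c *\<^sub>R x + Im c *\<^sub>R (\<i> *\<^sub>C (x::'a::complex_normed))"
proof -
  have "c *\<^sub>C x = (of_real (Re c) + of_real (Im c) * \<i>) *\<^sub>C x"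
    by (simp add: complex_eq[of c, symmetric] mult.commute)
  then show ?thesis by (simp add: scaleC_add_left scaleC_of_real flip: scaleC_scaleC)
qed

lemma cinner_commute: "cinner x y = cnj (cinner y (x::'a::complex_inner))"
proof -
  have "(\<i> *\<^sub>C y) \<bullet> x = - ((\<i> *\<^sub>C x) \<bullet> y)"
    using inner_imaginary_unit[of "\<i> *\<^sub>C y" x] by (simp add: scaleC_imaginary_unit inner_commute)
  then show ?thesis by (simp add: cinner_def complex_eq_iff inner_commute)
qed

lemma cinner_add_right: "cinner x (y + z) = cinner x y + cinner x (z::'a::complex_inner)"
  by (simp add: cinner_def complex_eq_iff inner_add_right)

lemma cinner_scaleC_right: "cinner x (c *\<^sub>C y) = c * cinner x (y::'a::complex_inner)"
proof -
  have "x \<bullet> (\<i> *\<^sub>C y) = - ((\<i> *\<^sub>C x) \<bullet> y)"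
    using inner_imaginary_unit[of "\<i> *\<^sub>C x" y] by (simp add: scaleC_imaginary_unit)
  then show ?thesis
    by (subst scaleC_split)
      (simp add: cinner_def complex_eq_iff inner_add_right inner_imaginary_unit)
qed

lemma cinner_add_left: "cinner (x + y) z = cinner x z + cinner y (z::'a::complex_inner)"
  by (subst (1 2 3) cinner_commute) (simp add: cinner_add_right)

lemma cinner_scaleC_left: "cinner (c *\<^sub>C x) y = cnj c * cinner x (y::'a::complex_inner)"
  by (subst (1 2) cinner_commute) (simp add: cinner_scaleC_right)

lemma cinner_scaleR: "cinner (r *\<^sub>R x) y = r * cinner x (y::'a::complex_inner)"
   "cinner x (r *\<^sub>R y) = r * cinner x y"
  by (simp_all add: cinner_scaleC_left cinner_scaleC_right flip: scaleC_of_real)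

lemma cinner_zero [simp]: "cinner 0 y = 0" "cinner y (0::'a::complex_inner) = 0"
  using cinner_scaleR(1)[of 0 y y] cinner_scaleR(2)[of y 0 y] by auto

lemma cinner_minus: "cinner (- x) y = - cinner x y" "cinner x (- y) = - cinner x (y::'a::complex_inner)"
  using cinner_scaleR(1)[of "-1" x y] cinner_scaleR(2)[of x "-1" y] by auto

lemma cinner_diff: "cinner (x - z) y = cinner x y - cinner z y"
  "cinner x (y - z) = cinner x y - cinner x (z::'a::complex_inner)"
  using cinner_add_left[of x "- z" y] cinner_add_right[of x y "- z"] by (auto simp: cinner_minus)

lemma cinner_sum_right: "cinner x (sum f I) = (\<Sum>i\<in>I. cinner x (f i::'a::complex_inner))"
  by (induction I rule: infinite_finite_induct) (auto simp: cinner_add_right)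

lemma cinner_sum_left: "cinner (sum f I) x = (\<Sum>i\<in>I. cinner (f i) (x::'a::complex_inner))"
  by (induction I rule: infinite_finite_induct) (auto simp: cinner_add_left)

lemma scaleC_sum_right: "c *\<^sub>C sum f I = (\<Sum>i\<in>I. c *\<^sub>C (f i::'a::complex_normed))"
  by (induction I rule: infinite_finite_induct) (auto simp: scaleC_add_right)

lemma cinner_self: "cinner x x = of_real ((norm (x::'a::complex_inner))\<^sup>2)"
proof -
  have "Im (cinner x x) = 0"
    using cinner_commute[of x x] by (simp add: complex_eq_iff)
  then show ?thesis by (simp add: cinner_def complex_eq_iff power2_norm_eq_inner)
qed

lemma cmod_cinner_le: "cmod (cinner x y) \<le> norm x * norm (y::'a::complex_inner)"
proof (cases "cinner x y = 0")
  case False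
  define c where "c = cnj (cinner x y) / cmod (cinner x y)"
  have c: "cmod c = 1" using False by (simp add: c_def norm_divide)
  have "c * cinner x y = of_real (cmod (cinner x y))"
    using False by (simp add: c_def complex_norm_square power2_eq_square mult.commute flip: complex_norm_square)
  then have "cmod (cinner x y) = Re (cinner x (c *\<^sub>C y))"
    by (simp add: cinner_scaleC_right)
  also have "\<dots> = x \<bullet> (c *\<^sub>C y)" by (simp add: cinner_def)
  also have "\<dots> \<le> norm x * norm (c *\<^sub>C y)" by (rule norm_cauchy_schwarz)
  finally show ?thesis by (simp add: norm_scaleC c)
qed simp

lemma cinner_eqI: "(\<And>x. cinner x y = cinner x z) \<Longrightarrow> y = (z::'a::complex_inner)"
  using cinner_self[of "y - z"] by (simp add: cinner_diff)

lemma nonneg_Reals_tendsto: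
  assumes "(f \<longlongrightarrow> l) F" "F \<noteq> bot" "\<And>x. f x \<in> \<real>\<^sub>\<ge>\<^sub>0"
  shows "l \<in> (\<real>\<^sub>\<ge>\<^sub>0 :: complex set)"
  by (rule Lim_in_closed_set[OF closed_nonneg_Reals_complex _ assms(2,1)]) (simp add: assms(3))

section \<open>Complex-linear maps and bounded operators\<close>

lemma clinear_add: "clinear f \<Longrightarrow> f (x + y) = f x + f y" by (simp add: clinear_def)
lemma clinear_scaleC: "clinear f \<Longrightarrow> f (c *\<^sub>C x) = c *\<^sub>C f x" by (simp add: clinear_def)
lemma clinear_scaleR: "clinear f \<Longrightarrow> f (r *\<^sub>R x) = r *\<^sub>R f x"
  by (simp add: clinear_def flip: scaleC_of_real)
lemma clinear_linear: "clinear f \<Longrightarrow> linear f"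
  by (rule linearI) (auto simp: clinear_add clinear_scaleR)
lemma clinear_zero: "clinear f \<Longrightarrow> f 0 = 0"
  using clinear_scaleC[of f 0 0] by simp
lemma clinear_sum: "clinear f \<Longrightarrow> f (sum g I) = (\<Sum>i\<in>I. f (g i))"
  by (induction I rule: infinite_finite_induct) (auto simp: clinear_add clinear_zero)
lemma clinear_compose: "clinear f \<Longrightarrow> clinear g \<Longrightarrow> clinear (\<lambda>x. f (g x))"
  by (simp add: clinear_def)

lemma clinear_on_UNIV: "clinear_on UNIV f \<longleftrightarrow> clinear f"
  by (simp add: clinear_on_def clinear_def)

lemma bounded_opsI: "(\<And>c x. blinfun_apply A (c *\<^sub>C x) = c *\<^sub>C A x) \<Longrightarrow> A \<in> bounded_ops"
  by (simp add: bounded_ops_def clinear_def blinfun.add_right)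

lemma bounded_ops_scaleC: "A \<in> bounded_ops \<Longrightarrow> blinfun_apply A (c *\<^sub>C x) = c *\<^sub>C A x"
  by (simp add: bounded_ops_def clinear_def)

lemma bounded_ops_clinear: "A \<in> bounded_ops \<Longrightarrow> clinear (blinfun_apply A)"
  by (simp add: bounded_ops_def)

lemma blinfun_apply_scaleC: "blinfun_apply (c *\<^sub>C A) x = c *\<^sub>C blinfun_apply A x"
  by (simp add: scaleC_blinfun.rep_eq)

lemma bounded_ops_add: "A \<in> bounded_ops \<Longrightarrow> B \<in> bounded_ops \<Longrightarrow> A + B \<in> bounded_ops"
  by (rule bounded_opsI) (simp add: bounded_ops_scaleC blinfun.add_left scaleC_add_right)

lemma bounded_ops_cscale: "A \<in> bounded_ops \<Longrightarrow> c *\<^sub>C A \<in> bounded_ops"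
  by (rule bounded_opsI) (simp add: bounded_ops_scaleC blinfun_apply_scaleC scaleC_scaleC mult.commute)

lemma bounded_ops_compose: "A \<in> bounded_ops \<Longrightarrow> B \<in> bounded_ops \<Longrightarrow> A o\<^sub>L B \<in> bounded_ops"
  by (rule bounded_opsI) (simp add: bounded_ops_scaleC)

lemma bounded_ops_zero: "0 \<in> bounded_ops"
  by (rule bounded_opsI) simp

lemma bounded_ops_id: "id_blinfun \<in> bounded_ops"
  by (rule bounded_opsI) simp



section \<open>Finite-rank compressions\<close>

definition orthonormal :: "'a::complex_inner set \<Rightarrow> bool" where
  "orthonormal C \<longleftrightarrow> finite C \<and> (\<forall>c\<in>C. \<forall>d\<in>C. cinner c d = (if c = d then 1 else 0))"

definition projection :: "'a::complex_inner set \<Rightarrow> 'a \<Rightarrow> 'a" where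
  "projection C x = (\<Sum>c\<in>C. cinner c x *\<^sub>C c)"

lemma cinner_projection:
  assumes "orthonormal C" "c \<in> C"
  shows "cinner c (projection C x) = cinner c x"
proof -
  have "cinner c (projection C x) = (\<Sum>d\<in>C. if d = c then cinner c x else 0)"
    unfolding projection_def cinner_sum_right cinner_scaleC_right
    using assms by (intro sum.cong refl) (auto simp: orthonormal_def)
  also have "\<dots> = cinner c x" using assms by (simp add: orthonormal_def)
  finally show ?thesis .
qed

text \<open>
  Gram--Schmidt: the vector to be added, minus its projection onto the vectors found so far, is
  normalized unless it vanishes.
\<close>

lemma orthonormal_extend:
  assumes "finite F"
  shows "\<exists>C. orthonormal C \<and> (\<forall>v\<in>F. projection C v = v)"
  using assms
proof induction
  case empty
  have "orthonormal {}" by (simp add: orthonormal_def)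
  then show ?case by blast
next
  case (insert v F)
  then obtain C where C: "orthonormal C" "\<And>w. w \<in> F \<Longrightarrow> projection C w = w" by blast
  show ?case
  proof (cases "projection C v = v")
    case False
    define u where "u = v - projection C v"
    define e where "e = inverse (norm u) *\<^sub>R u"
    have u0: "u \<noteq> 0" using False by (simp add: u_def)
    have perp: "cinner c u = 0" if "c \<in> C" for c
      using that C(1) by (simp add: u_def cinner_diff cinner_projection)
    have perp': "cinner c e = 0" "cinner e c = 0" if "c \<in> C" for c
      using perp[OF that] cinner_commute[of e c] by (simp_all add: e_def cinner_scaleR)
    have unit: "cinner e e = 1"
      using u0 by (simp add: e_def cinner_scaleR cinner_self power2_eq_square)
    have eC: "e \<notin> C" using perp' unit by force
    have C': "orthonormal (insert e C)"
      using C(1) perp' unit eC by (auto simp: orthonormal_def)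
    have P: "projection (insert e C) w = cinner e w *\<^sub>C e + projection C w" for w
      using C(1) eC by (simp add: projection_def orthonormal_def)
    have eP: "cinner e (projection C w) = 0" for w
      by (simp add: projection_def cinner_sum_right cinner_scaleC_right perp')
    have "projection (insert e C) w = w" if "w \<in> F" for w
      using eP[of w] by (simp add: P C(2)[OF that])
    moreover have "projection (insert e C) v = v"
    proof -
      have "v = u + projection C v" by (simp add: u_def)
      then have "cinner e v = cinner e u"
        using cinner_add_right[of e u "projection C v"] by (simp add: eP)
      also have "\<dots> = norm u"
        using u0 by (simp add: e_def cinner_scaleR cinner_self power2_eq_square)
      finally have "cinner e v *\<^sub>C e = u" using u0 by (simp add: e_def scaleC_of_real)
      then show ?thesis by (simp add: P u_def)
    qed
    ultimately show ?thesis using C' by blast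
  qed (use C in blast)
qed

lemma cinner_projection_left: "cinner (projection C x) y = cinner x (projection C y)"
proof -
  have "cinner (projection C x) y = (\<Sum>c\<in>C. cnj (cinner c x) * cinner c y)"
    by (simp add: projection_def cinner_sum_left cinner_scaleC_left)
  also have "\<dots> = (\<Sum>c\<in>C. cinner c y * cinner x c)"
    by (intro sum.cong refl) (subst cinner_commute[of x], simp)
  also have "\<dots> = cinner x (projection C y)"
    by (simp add: projection_def cinner_sum_right cinner_scaleC_right)
  finally show ?thesis .
qed

lemma projection_idem: "orthonormal C \<Longrightarrow> projection C (projection C x) = projection C x"
  by (subst projection_def) (simp add: cinner_projection, simp add: projection_def)

lemma norm_projection_le:
  assumes "orthonormal C"
  shows "norm (projection C x) \<le> norm x"
proof -
  have "of_real ((norm (projection C x))\<^sup>2) = cinner x (projection C x)"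
    using cinner_self[of "projection C x"]
    by (simp add: cinner_projection_left projection_idem[OF assms])
  then have "(norm (projection C x))\<^sup>2 \<le> norm x * norm (projection C x)"
    using cmod_cinner_le[of x "projection C x"] by (metis norm_of_real abs_power2)
  then show ?thesis
    by (cases "norm (projection C x) = 0") (simp_all add: power2_eq_square)
qed

lemma clinear_projection: "clinear (projection C)"
  by (simp add: clinear_def projection_def cinner_add_right scaleC_add_left sum.distrib
      cinner_scaleC_right scaleC_sum_right scaleC_scaleC)

lemma bounded_linear_projection: "orthonormal C \<Longrightarrow> bounded_linear (projection C)"
  by (rule bounded_linear_intro[where K = 1])
    (simp_all add: clinear_add[OF clinear_projection] clinear_scaleR[OF clinear_projection]
      norm_projection_le)

text \<open>
  A relation rather than the function \<open>adj\<close>: the latter, a definite description, says something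
  about an operator only once an adjoint has been exhibited.
\<close>

definition adjoint_pair :: "('a::complex_inner \<Rightarrow>\<^sub>L 'b::complex_inner) \<Rightarrow> ('b \<Rightarrow>\<^sub>L 'a) \<Rightarrow> bool" where
  "adjoint_pair A B \<longleftrightarrow> (\<forall>f g. cinner (blinfun_apply A f) g = cinner f (blinfun_apply B g))"

lemma adj_eqI: "adjoint_pair A B \<Longrightarrow> adj A = B"
  unfolding adj_def adjoint_pair_def
  by (rule the_equality) (blast, rule blinfun_eqI, rule cinner_eqI, metis)

text \<open>
  If $P$ is the projection onto the span of $C$, then
  $\langle PTPf, g\rangle = \sum_{d \in C} \overline{\langle d, f\rangle}\,\langle Td, Pg\rangle$,
  so the adjoint of $PTP$ is $g \mapsto \sum_{d \in C} \langle Td, Pg\rangle\, d$.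
\<close>

lemma compression_has_adjoint:
  assumes C: "orthonormal C" and T: "T \<in> bounded_ops"
  defines "P \<equiv> Blinfun (projection C)"
  shows "\<exists>B\<in>bounded_ops. adjoint_pair (P o\<^sub>L T o\<^sub>L P) B"
proof -
  have P: "blinfun_apply P = projection C"
    by (simp add: P_def bounded_linear_Blinfun_apply[OF bounded_linear_projection[OF C]])
  define b where "b y = (\<Sum>d\<in>C. cinner (blinfun_apply T d) (projection C y) *\<^sub>C d)" for y
  have bl: "bounded_linear b"
  proof (rule bounded_linear_intro[where K = "\<Sum>d\<in>C. norm (T d) * norm d"])
    interpret P: bounded_linear "projection C" by (rule bounded_linear_projection[OF C])
    show "b (x + y) = b x + b y" for x y
      by (simp add: b_def P.add cinner_add_right scaleC_add_left sum.distrib)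
    show "b (r *\<^sub>R x) = r *\<^sub>R b x" for r x
      by (simp add: b_def P.scaleR cinner_scaleR scaleR_sum_right scaleC_scaleC[symmetric] scaleC_of_real)
    show "norm (b x) \<le> norm x * (\<Sum>d\<in>C. norm (T d) * norm d)" for x
      unfolding b_def sum_distrib_left
    proof (rule sum_norm_le)
      fix d
      have "cmod (cinner (T d) (projection C x)) \<le> norm (T d) * norm x"
        by (rule order_trans[OF cmod_cinner_le mult_left_mono[OF norm_projection_le[OF C]]]) simp
      then show "norm (cinner (T d) (projection C x) *\<^sub>C d) \<le> norm x * (norm (T d) * norm d)"
        using mult_right_mono[of _ _ "norm d"] by (fastforce simp: norm_scaleC algebra_simps)
    qed
  qed
  have B: "blinfun_apply (Blinfun b) = b" by (rule bounded_linear_Blinfun_apply[OF bl])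
  have "Blinfun b \<in> bounded_ops"
    by (rule bounded_opsI) (simp add: B b_def projection_def cinner_scaleC_right cinner_sum_right
        scaleC_sum_right scaleC_scaleC sum_distrib_left mult.assoc)
  moreover have "adjoint_pair (P o\<^sub>L T o\<^sub>L P) (Blinfun b)"
    unfolding adjoint_pair_def
  proof (intro allI)
    fix f g
    have "cinner ((P o\<^sub>L T o\<^sub>L P) f) g = cinner (T (projection C f)) (projection C g)"
      by (simp add: P cinner_projection_left)
    also have "\<dots> = (\<Sum>d\<in>C. cnj (cinner d f) * cinner (T d) (projection C g))"
      unfolding projection_def[of C f]
      by (simp add: clinear_sum[OF bounded_ops_clinear[OF T]]
          bounded_ops_scaleC[OF T] cinner_sum_left cinner_scaleC_left)
    also have "\<dots> = (\<Sum>d\<in>C. cinner (T d) (projection C g) * cinner f d)"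
      by (intro sum.cong refl) (subst cinner_commute[of f], simp)
    also have "\<dots> = cinner f (b g)"
      by (simp add: b_def cinner_sum_right cinner_scaleC_right)
    finally show "cinner ((P o\<^sub>L T o\<^sub>L P) f) g = cinner f (Blinfun b g)" by (simp add: B)
  qed
  ultimately show ?thesis by blast
qed

section \<open>Normal functionals\<close>

lemma summable_product:
  assumes "summable (\<lambda>k. (f k)\<^sup>2)" "summable (\<lambda>k. (g k)\<^sup>2)"
  shows "summable (\<lambda>k::nat. f k * g k :: real)"
proof (rule summable_comparison_test[OF _ summable_add[OF assms]])
  have "\<bar>f k * g k\<bar> \<le> (f k)\<^sup>2 + (g k)\<^sup>2" for k
    using sum_squares_bound[of "\<bar>f k\<bar>" "\<bar>g k\<bar>"] mult_nonneg_nonneg[of "\<bar>f k\<bar>" "\<bar>g k\<bar>"]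
    by (simp add: abs_mult del: mult_nonneg_nonneg)
  then show "\<exists>N. \<forall>n\<ge>N. norm (f n * g n) \<le> (f n)\<^sup>2 + (g n)\<^sup>2" by simp
qed

text \<open>
  A norm bound for a normal functional may be checked on operators that have an adjoint. If
  $\eta(A) = \sum_k \langle f_k, A g_k\rangle$ and $P_N$ is a finite-rank projection fixing the first
  $N$ of the $f_k$ and $g_k$, then $P_N T P_N$ has an adjoint and norm at most $\|T\|$, and
  $\eta(P_N T P_N) \to \eta(T)$, since the $k$-th term is constant for $N > k$ and dominated by
  $\|T\| \|f_k\| \|g_k\|$.
\<close>

lemma normal_functional_bound:
  fixes \<eta> :: "('a::complex_inner \<Rightarrow>\<^sub>L 'a) \<Rightarrow> complex"
  assumes n: "normal_functional \<eta>"
    and bd: "\<And>A B. A \<in> bounded_ops \<Longrightarrow> B \<in> bounded_ops \<Longrightarrow> adjoint_pair A B \<Longrightarrow>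
      cmod (\<eta> A) \<le> K * norm A"
    and T: "T \<in> bounded_ops" and K: "0 \<le> K"
  shows "cmod (\<eta> T) \<le> K * norm T"
proof -
  obtain f g where fg: "summable (\<lambda>k::nat. (norm (f k))\<^sup>2)" "summable (\<lambda>k. (norm (g k))\<^sup>2)"
    and \<eta>: "\<And>A. A \<in> bounded_ops \<Longrightarrow> (\<lambda>k. cinner (f k) (blinfun_apply A (g k))) sums \<eta> A"
    using n by (auto simp: normal_functional_def)
  have "\<forall>N. \<exists>C. orthonormal C \<and> (\<forall>v\<in>f ` {..<N} \<union> g ` {..<N}. projection C v = v)"
    by (intro allI orthonormal_extend) simp
  then obtain C where C: "\<And>N. orthonormal (C N)"
    and fixed: "\<And>N k. k < N \<Longrightarrow> projection (C N) (f k) = f k"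
       "\<And>N k. k < N \<Longrightarrow> projection (C N) (g k) = g k"
    by (metis UnI1 UnI2 imageI lessThan_iff)
  define P where "P N = Blinfun (projection (C N))" for N
  have P: "blinfun_apply (P N) = projection (C N)" for N
    by (simp add: P_def bounded_linear_Blinfun_apply[OF bounded_linear_projection[OF C]])
  have Pb: "P N \<in> bounded_ops" for N
    by (rule bounded_opsI)
      (simp add: P projection_def cinner_scaleC_right scaleC_sum_right scaleC_scaleC)
  define T' where "T' N = P N o\<^sub>L T o\<^sub>L P N" for N
  have T'b: "T' N \<in> bounded_ops" for N by (simp add: T'_def bounded_ops_compose Pb T)
  have normP: "norm (P N) \<le> 1" for N
    by (rule norm_blinfun_bound) (simp_all add: P norm_projection_le[OF C])
  have normT': "norm (T' N) \<le> norm T" for N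
  proof (rule norm_blinfun_bound)
    fix x
    have "norm (T' N x) \<le> norm (T (projection (C N) x))"
      by (simp add: T'_def P norm_projection_le[OF C])
    also have "\<dots> \<le> norm T * norm (projection (C N) x)" by (rule norm_blinfun)
    also have "\<dots> \<le> norm T * norm x" by (intro mult_left_mono norm_projection_le[OF C]) simp
    finally show "norm (T' N x) \<le> norm T * norm x" .
  qed simp
  have bdT': "cmod (\<eta> (T' N)) \<le> K * norm T" for N
  proof -
    obtain B where "B \<in> bounded_ops" "adjoint_pair (T' N) B"
      using compression_has_adjoint[OF C T] unfolding T'_def P_def by blast
    from bd[OF T'b this] show ?thesis
      using mult_left_mono[OF normT' K] by (rule order_trans)
  qed
  have summand: "cmod (cinner (f k) (T' N (g k))) \<le> norm T * (norm (f k) * norm (g k))" for k N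
  proof -
    have "cmod (cinner (f k) (T' N (g k))) \<le> norm (f k) * (norm (T' N) * norm (g k))"
      by (rule order_trans[OF cmod_cinner_le mult_left_mono[OF norm_blinfun]]) simp
    also have "\<dots> \<le> norm (f k) * (norm T * norm (g k))"
      by (intro mult_left_mono mult_right_mono normT') auto
    finally show ?thesis by (simp add: algebra_simps)
  qed
  have "(\<lambda>N. \<Sum>k. cinner (f k) (T' N (g k))) \<longlonglongrightarrow> (\<Sum>k. cinner (f k) (T (g k)))"
  proof (rule tannerys_theorem[THEN conjunct2, THEN conjunct2])
    show "(\<lambda>N. cinner (f k) (T' N (g k))) \<longlonglongrightarrow> cinner (f k) (T (g k))" for k
    proof (rule tendsto_eventually)
      have "cinner (f k) (T' N (g k)) = cinner (f k) (T (g k))" if "k < N" for N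
        using fixed[OF that] cinner_projection_left[of "C N" "f k" "T (g k)"]
        by (simp add: T'_def P)
      then show "\<forall>\<^sub>F N in sequentially. cinner (f k) (T' N (g k)) = cinner (f k) (T (g k))"
        by (rule eventually_mono[OF eventually_gt_at_top[of k]])
    qed
    show "summable (\<lambda>k. norm T * (norm (f k) * norm (g k)))"
      by (intro summable_mult summable_product fg)
    show "\<forall>\<^sub>F (k, N) in sequentially \<times>\<^sub>F sequentially.
        norm (cinner (f k) (T' N (g k))) \<le> norm T * (norm (f k) * norm (g k))"
      by (rule always_eventually) (simp add: summand split_beta)
  qed simp
  then have "(\<lambda>N. \<eta> (T' N)) \<longlonglongrightarrow> \<eta> T"
    by (simp only: sums_unique[OF \<eta>[OF T], symmetric] sums_unique[OF \<eta>[OF T'b], symmetric])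
  then have "(\<lambda>N. cmod (\<eta> (T' N))) \<longlonglongrightarrow> cmod (\<eta> T)" by (rule tendsto_norm)
  then show ?thesis by (rule LIMSEQ_le_const2) (use bdT' in blast)
qed



section \<open>Operators acting pointwise\<close>

lemma AE_half_line_pos: "AE x in half_line. 0 < x"
  by (rule AE_I2) (simp add: space_restrict_space)

lemma L2_eq_AE: "L2_eq f g \<Longrightarrow> AE x in half_line. f x = g x"
  by (simp add: L2_eq_def)

lemma L2_AE_eqI: "AE x in half_line. rep_L2 f x = rep_L2 g x \<Longrightarrow> f = g"
  by (rule L2_eqI) (simp add: L2_eq_def square_integrable_rep)

lemma rep_add_AE: "AE x in half_line. rep_L2 (f + g) x = rep_L2 f x + rep_L2 g x"
  unfolding plus_L2_rep by (intro L2_eq_AE L2_eq_rep_abs square_integrable_add square_integrable_rep)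

lemma rep_scaleC_AE: "AE x in half_line. rep_L2 (c *\<^sub>C f) x = c *\<^sub>C rep_L2 f x"
  unfolding scaleC_L2_rep by (intro L2_eq_AE L2_eq_rep_abs square_integrable_scaleC square_integrable_rep)

lemma inner_L2_cong:
  assumes "AE x in half_line. rep_L2 f x \<bullet> rep_L2 g x = rep_L2 f' x \<bullet> rep_L2 g' x"
  shows "f \<bullet> g = f' \<bullet> g'"
  unfolding inner_L2_rep using assms
  by (intro integral_cong_AE borel_measurable_integrable integrable_inner square_integrable_rep)

text \<open>
  \<open>W\<close> is the operator $(Wf)(x) = T_x f(x)$, up to null sets. All identities between the concrete
  operators below are read off from the maps $T_x$.
\<close>

definition acts :: "('a::{complex_inner, second_countable_topology} L2 \<Rightarrow>\<^sub>L
    'b::{complex_inner, second_countable_topology} L2) \<Rightarrow> (real \<Rightarrow> 'a \<Rightarrow> 'b) \<Rightarrow> bool" where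
  "acts W T \<longleftrightarrow> (\<forall>f. AE x in half_line. rep_L2 (W f) x = T x (rep_L2 f x))"

lemma actsD: "acts W T \<Longrightarrow> AE x in half_line. rep_L2 (blinfun_apply W f) x = T x (rep_L2 f x)"
  by (simp add: acts_def)

lemma acts_eqI:
  assumes "acts W T" "acts W' T'" "\<And>x v. 0 < x \<Longrightarrow> T x v = T' x v"
  shows "W = W'"
proof (rule blinfun_eqI, rule L2_AE_eqI)
  fix f
  show "AE x in half_line. rep_L2 (W f) x = rep_L2 (W' f) x"
    using actsD[OF assms(1), of f] actsD[OF assms(2), of f] AE_half_line_pos
    by eventually_elim (simp add: assms(3))
qed

lemma acts_compose:
  assumes "acts W T" "acts W' T'"
  shows "acts (W o\<^sub>L W') (\<lambda>x v. T x (T' x v))"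
  unfolding acts_def
proof
  fix f
  show "AE x in half_line. rep_L2 ((W o\<^sub>L W') f) x = T x (T' x (rep_L2 f x))"
    using actsD[OF assms(1), of "W' f"] actsD[OF assms(2), of f]
    by eventually_elim simp
qed

lemma acts_add:
  assumes "acts W T" "acts W' T'"
  shows "acts (W + W') (\<lambda>x v. T x v + T' x v)"
  unfolding acts_def
proof
  fix f
  show "AE x in half_line. rep_L2 ((W + W') f) x = T x (rep_L2 f x) + T' x (rep_L2 f x)"
    using actsD[OF assms(1), of f] actsD[OF assms(2), of f] rep_add_AE[of "W f" "W' f"]
    by eventually_elim (simp add: blinfun.add_left)
qed

lemma acts_scaleC:
  assumes "acts W T"
  shows "acts (c *\<^sub>C W) (\<lambda>x v. c *\<^sub>C T x v)"
  unfolding acts_def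
proof
  fix f
  show "AE x in half_line. rep_L2 ((c *\<^sub>C W) f) x = c *\<^sub>C T x (rep_L2 f x)"
    using actsD[OF assms(1), of f] rep_scaleC_AE[of c "W f"]
    by eventually_elim (simp add: blinfun_apply_scaleC)
qed

lemma acts_id: "acts id_blinfun (\<lambda>x v. v)"
  by (simp add: acts_def)

lemma acts_apply_scaleC:
  assumes "acts W T" "\<And>x c v. 0 < x \<Longrightarrow> T x (c *\<^sub>C v) = c *\<^sub>C T x v"
  shows "blinfun_apply W (c *\<^sub>C f) = c *\<^sub>C W f"
proof (rule L2_AE_eqI)
  show "AE x in half_line. rep_L2 (W (c *\<^sub>C f)) x = rep_L2 (c *\<^sub>C W f) x"
    using actsD[OF assms(1), of f] actsD[OF assms(1), of "c *\<^sub>C f"] rep_scaleC_AE[of c f]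
      rep_scaleC_AE[of c "W f"] AE_half_line_pos
    by eventually_elim (simp add: assms(2))
qed

lemma acts_adjoint:
  assumes "acts W T" "acts W' T'" and ad: "\<And>x u v. 0 < x \<Longrightarrow> T x u \<bullet> v = u \<bullet> T' x v"
    and cl: "\<And>x c v. 0 < x \<Longrightarrow> T x (c *\<^sub>C v) = c *\<^sub>C T x v"
  shows "adjoint_pair W W'"
proof -
  have *: "W f \<bullet> g = f \<bullet> W' g" for f g
    by (rule inner_L2_cong, use actsD[OF assms(1), of f] actsD[OF assms(2), of g] AE_half_line_pos
      in eventually_elim) (simp add: ad)
  then show ?thesis
    by (simp add: adjoint_pair_def cinner_def flip: acts_apply_scaleC[OF assms(1) cl])
qed

section \<open>The cutoff projections\<close>

text \<open>
  The left shift drops the part of a function on $(0,t]$, so it does not increase the integral of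
  a nonnegative function.
\<close>

lemma half_line_left_translate:
  fixes h :: "real \<Rightarrow> real"
  assumes t: "0 \<le> t" and int: "integrable half_line h" and nn: "\<And>x. 0 \<le> h x"
  shows "integrable half_line (\<lambda>x. h (x + t))"
    and "(\<integral>x. h (x + t) \<partial>half_line) \<le> (\<integral>x. h x \<partial>half_line)"
proof -
  have i: "integrable lborel (\<lambda>x. indicator {0<..} x *\<^sub>R h x)"
    using int by (subst (asm) integrable_restrict_space) (auto simp: set_integrable_def)
  have eq0: "(\<lambda>x. indicator {t<..} x *\<^sub>R h x)
      = (\<lambda>x. indicator {t<..} x *\<^sub>R (indicator {0<..} x *\<^sub>R h x))"
    using t by (auto simp: indicator_def fun_eq_iff)
  have it: "integrable lborel (\<lambda>x. indicator {t<..} x *\<^sub>R h x)"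
    unfolding eq0 by (rule integrable_mult_indicator[OF _ i]) simp
  have eq: "(\<lambda>x. indicator {0<..} x *\<^sub>R h (x + t))
      = (\<lambda>x. indicator {t<..} (t + 1 * x) *\<^sub>R h (t + 1 * x))"
    by (auto simp: indicator_def fun_eq_iff add.commute)
  show "integrable half_line (\<lambda>x. h (x + t))"
    using lborel_integrable_real_affine[OF it, of 1 t]
    by (subst integrable_restrict_space) (simp_all add: set_integrable_def eq del: real_scaleR_def)
  have "(\<integral>x. h (x + t) \<partial>half_line) = (\<integral>x. indicator {t<..} x *\<^sub>R h x \<partial>lborel)"
    using lborel_integral_real_affine[of 1 "\<lambda>x. indicator {t<..} x *\<^sub>R h x" t]
    by (subst integral_restrict_space)
      (simp_all add: set_lebesgue_integral_def eq del: real_scaleR_def)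
  also have "\<dots> \<le> (\<integral>x. indicator {0<..} x *\<^sub>R h x \<partial>lborel)"
    using t nn by (intro integral_mono it i) (auto simp: indicator_def)
  also have "\<dots> = (\<integral>x. h x \<partial>half_line)"
    by (subst integral_restrict_space) (simp_all add: set_lebesgue_integral_def)
  finally show "(\<integral>x. h (x + t) \<partial>half_line) \<le> (\<integral>x. h x \<partial>half_line)" .
qed

lemma half_line_left_translate_measurable:
  fixes f :: "real \<Rightarrow> 'a::{complex_inner, second_countable_topology}"
  assumes t: "0 \<le> t" and f: "f \<in> borel_measurable half_line"
  shows "(\<lambda>x. f (x + t)) \<in> borel_measurable half_line"
proof -
  have "(\<lambda>x. if x \<in> {0<..} then f x else 0) \<in> borel_measurable borel"
    using f by (subst (asm) measurable_restrict_space_iff[where c = 0]) auto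
  then have "(\<lambda>x. if x + t \<in> {0<..} then f (x + t) else 0) \<in> borel_measurable borel"
    by (rule measurable_compose[rotated]) simp
  then have "(\<lambda>x. if x + t \<in> {0<..} then f (x + t) else 0) \<in> borel_measurable half_line"
    by (intro measurable_restrict_space1) (simp add: measurable_lborel1)
  then show ?thesis
    by (rule measurable_cong[THEN iffD1, rotated]) (use t in \<open>simp add: space_restrict_space\<close>)
qed

lemma half_line_left_translate_AE:
  assumes t: "0 \<le> t" and P: "AE x in half_line. P x"
  shows "AE x in half_line. P (x + t)"
proof -
  have "AE x in lborel. x \<in> {0<..} \<longrightarrow> P x"
    using P by (simp add: AE_restrict_space_iff)
  then have "AE x in lborel. x + t \<in> {0<..} \<longrightarrow> P (x + t)"
  proof (rule AE_E3)
    fix N assume N: "\<And>x. x \<in> space lborel - N \<Longrightarrow> x \<in> {0<..} \<longrightarrow> P x" "N \<in> null_sets lborel"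
    show ?thesis
    proof (rule AE_I'[OF null_sets_translation[OF N(2), of "- t"]], rule subsetI)
      fix x assume "x \<in> {x \<in> space lborel. \<not> (x + t \<in> {0<..} \<longrightarrow> P (x + t))}"
      then show "x \<in> {x. x - - t \<in> N}" using N(1)[of "x + t"] by auto
    qed
  qed
  then show ?thesis
    using t by (auto simp: AE_restrict_space_iff)
qed

text \<open>
  The adjoint of \<open>shift t\<close>, see \<open>adj_shift\<close>.
\<close>

definition left_shift :: "real \<Rightarrow> 'a::{complex_inner, second_countable_topology} L2 \<Rightarrow>\<^sub>L 'a L2" where
  "left_shift t = Blinfun (\<lambda>f. abs_L2 (\<lambda>x. rep_L2 f (x + t)))"

context
  fixes t :: real
  assumes t: "0 \<le> t"
begin

lemma square_integrable_left_shift: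
  "square_integrable f \<Longrightarrow> square_integrable (\<lambda>x. f (x + t))"
  using half_line_left_translate(1)[OF t, of "\<lambda>x. (norm (f x))\<^sup>2"]
  by (auto simp: square_integrable_def intro: half_line_left_translate_measurable[OF t])

lemma rep_left_shift: "L2_eq (rep_L2 (left_shift t f)) (\<lambda>x. rep_L2 f (x + t))"
proof -
  have "bounded_linear (\<lambda>f. abs_L2 (\<lambda>x. rep_L2 f (x + t)) :: 'a L2)"
  proof (rule bounded_linear_abs_L2[where F = "\<lambda>f x. f (x + t)" and K = 1])
    show "L2_eq (\<lambda>x. f (x + t)) (\<lambda>x. g (x + t))" if "L2_eq f g" for f g :: "real \<Rightarrow> 'a"
      using that half_line_left_translate_AE[OF t, of "\<lambda>x. f x = g x"]
      by (simp add: L2_eq_def square_integrable_left_shift)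
    show "(\<integral>x. (norm (f (x + t)))\<^sup>2 \<partial>half_line) \<le> 1\<^sup>2 * (\<integral>x. (norm (f x))\<^sup>2 \<partial>half_line)"
      if "square_integrable f" for f :: "real \<Rightarrow> 'a"
      using that half_line_left_translate(2)[OF t, of "\<lambda>x. (norm (f x))\<^sup>2"]
      by (simp add: square_integrable_def)
  qed auto
  then show ?thesis
    unfolding left_shift_def
    by (simp add: bounded_linear_Blinfun_apply L2_eq_rep_abs square_integrable_left_shift
        square_integrable_rep)
qed

lemma shift_scaleC: "shift t (c *\<^sub>C f) = c *\<^sub>C shift t f"
proof (rule L2_AE_eqI)
  show "AE x in half_line. rep_L2 (shift t (c *\<^sub>C f)) x = rep_L2 (c *\<^sub>C shift t f) x"
    using L2_eq_AE[OF rep_shift[OF t, of f]] L2_eq_AE[OF rep_shift[OF t, of "c *\<^sub>C f"]]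
      rep_scaleC_AE[of c "shift t f"] half_line_translate_AE[OF t rep_scaleC_AE[of c f]]
    by eventually_elim auto
qed

lemma adj_shift: "adj (shift t) = left_shift t"
proof (rule adj_eqI)
  have *: "shift t f \<bullet> g = f \<bullet> left_shift t g" for f g :: "'a L2"
  proof -
    let ?h = "\<lambda>x. rep_L2 f x \<bullet> rep_L2 g (x + t)"
    have h: "integrable half_line ?h"
      by (intro integrable_inner square_integrable_left_shift square_integrable_rep)
    have "shift t f \<bullet> g = (\<integral>x. (if x > t then ?h (x - t) else 0) \<partial>half_line)"
      unfolding inner_L2_rep
    proof (rule integral_cong_AE)
      show "AE x in half_line. rep_L2 (shift t f) x \<bullet> rep_L2 g x = (if x > t then ?h (x - t) else 0)"
        using L2_eq_AE[OF rep_shift[OF t, of f]] by eventually_elim simp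
    qed (intro borel_measurable_integrable integrable_inner square_integrable_rep
        half_line_translate(1)[OF t h])+
    also have "\<dots> = (\<integral>x. ?h x \<partial>half_line)" by (rule half_line_translate(2)[OF t h])
    also have "\<dots> = f \<bullet> left_shift t g"
      unfolding inner_L2_rep
    proof (rule integral_cong_AE)
      show "AE x in half_line. ?h x = rep_L2 f x \<bullet> rep_L2 (left_shift t g) x"
        using L2_eq_AE[OF rep_left_shift[of g]] by eventually_elim simp
    qed (intro borel_measurable_integrable integrable_inner square_integrable_rep h)+
    finally show ?thesis .
  qed
  show "adjoint_pair (shift t) (left_shift t :: 'a L2 \<Rightarrow>\<^sub>L 'a L2)"
    by (simp add: adjoint_pair_def cinner_def * flip: shift_scaleC)
qed

end

text \<open>
  The range projection of $U_t$, that is, multiplication by the indicator function of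
  $(t,\infty)$; see \<open>acts_cutoff\<close>.
\<close>

definition cutoff :: "real \<Rightarrow> 'a::{complex_inner, second_countable_topology} L2 \<Rightarrow>\<^sub>L 'a L2" where
  "cutoff t = shift t o\<^sub>L adj (shift t)"

lemma acts_cutoff:
  assumes t: "0 \<le> t"
  shows "acts (cutoff t) (\<lambda>x v. if t < x then v else 0)"
  unfolding acts_def cutoff_def adj_shift[OF t]
proof
  fix f :: "'a L2"
  show "AE x in half_line. rep_L2 ((shift t o\<^sub>L left_shift t) f) x = (if t < x then rep_L2 f x else 0)"
    using L2_eq_AE[OF rep_shift[OF t, of "left_shift t f"]]
      half_line_translate_AE[OF t L2_eq_AE[OF rep_left_shift[OF t, of f]]]
    by eventually_elim auto
qed

section \<open>Concrete pointwise operators\<close>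

definition mult_op :: "(real \<Rightarrow> real) \<Rightarrow> 'a::{complex_inner, second_countable_topology} L2 \<Rightarrow>\<^sub>L 'a L2" where
  "mult_op m = pointwise (\<lambda>x v. m x *\<^sub>R v)"

lemma acts_mult_op:
  assumes m: "m \<in> borel_measurable borel" and K: "\<And>x. 0 < x \<Longrightarrow> \<bar>m x\<bar> \<le> K"
  shows "acts (mult_op m) (\<lambda>x v. m x *\<^sub>R v)"
  unfolding acts_def mult_op_def
proof (intro allI L2_eq_AE, rule rep_pointwise[where K = K])
  show "linear ((*\<^sub>R) (m x))" for x :: real
    by (rule linearI) (simp_all add: algebra_simps)
  show "norm (m x *\<^sub>R v) \<le> K * norm v" if "0 < x" for x and v :: 'a
    using mult_right_mono[OF K[OF that], of "norm v"] by simp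
  show "(\<lambda>x. m x *\<^sub>R g x) \<in> borel_measurable half_line"
    if "g \<in> borel_measurable half_line" for g :: "real \<Rightarrow> 'a"
    using that m by (intro borel_measurable_scaleR that measurable_restrict_space1) auto
qed

lemma acts_sqrt_complement: "acts sqrt_complement (\<lambda>x v. sqrt (1 - exp (- x)) *\<^sub>R v)"
  by (simp add: acts_def L2_eq_AE[OF rep_sqrt_complement])

lemma acts_Lambda: "bounded_linear T \<Longrightarrow> acts (Lambda T) (\<lambda>x v. exp (- x) *\<^sub>R T v)"
  by (simp add: acts_def L2_eq_AE[OF rep_Lambda])

abbreviation component_op :: "'n::finite \<Rightarrow> (complex ^ 'n) L2 \<Rightarrow>\<^sub>L complex L2" where
  "component_op i \<equiv> pointwise (\<lambda>x v. v $ i)"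

abbreviation axis_op :: "'n::finite \<Rightarrow> complex L2 \<Rightarrow>\<^sub>L (complex ^ 'n) L2" where
  "axis_op i \<equiv> pointwise (\<lambda>x c. axis i c)"

lemma acts_component_op: "acts (component_op i) (\<lambda>x v. v $ i)"
  by (simp add: acts_def L2_eq_AE[OF rep_component])

lemma acts_axis_op: "acts (axis_op i) (\<lambda>x c. axis i c)"
  by (simp add: acts_def L2_eq_AE[OF rep_axis])

lemma scaleC_axis: "c *\<^sub>C axis i v = axis i (c * v)"
  by (simp add: axis_def vec_eq_iff scaleC_vec_def scaleC_complex_def)

lemma scaleC_vec_nth: "(c *\<^sub>C v) $ i = c *\<^sub>C (v $ i)"
  by (simp add: scaleC_vec_def)

lemma adjoint_axis_op: "adjoint_pair (axis_op i) (component_op i)"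
  by (rule acts_adjoint[OF acts_axis_op acts_component_op])
    (auto simp: inner_axis' scaleC_axis scaleC_complex_def)

lemma axis_op_scaleC: "axis_op i (c *\<^sub>C f) = c *\<^sub>C axis_op i f"
  by (rule acts_apply_scaleC[OF acts_axis_op]) (simp add: scaleC_axis scaleC_complex_def)

lemma component_op_scaleC: "component_op i (c *\<^sub>C f) = c *\<^sub>C component_op i f"
  by (rule acts_apply_scaleC[OF acts_component_op]) (simp add: scaleC_vec_nth)

lemma scaleC_scaleR_commute: "c *\<^sub>C r *\<^sub>R x = r *\<^sub>R c *\<^sub>C (x::'a::complex_normed)"
  by (simp add: scaleC_scaleC mult.commute flip: scaleC_of_real)

lemma acts_real_multiplier:
  fixes W :: "'a::{complex_inner, second_countable_topology} L2 \<Rightarrow>\<^sub>L 'a L2"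
  assumes "acts W (\<lambda>x v. m x *\<^sub>R v)"
  shows "W \<in> bounded_ops" "adjoint_pair W W"
proof -
  show "W \<in> bounded_ops"
    by (rule bounded_opsI, rule acts_apply_scaleC[OF assms]) (simp add: scaleC_scaleR_commute)
  show "adjoint_pair W W"
    by (rule acts_adjoint[OF assms assms]) (simp_all add: scaleC_scaleR_commute)
qed

text \<open>
  Multiplication by a scalar function commutes with taking coordinates.
\<close>

lemma entry_sandwich:
  fixes W W' :: "(complex ^ 'n::finite) L2 \<Rightarrow>\<^sub>L (complex ^ 'n) L2" and w w' :: "complex L2 \<Rightarrow>\<^sub>L complex L2"
  assumes "acts W (\<lambda>x v. m x *\<^sub>R v)" "acts w (\<lambda>x v. m x *\<^sub>R v)"
    "acts W' (\<lambda>x v. m' x *\<^sub>R v)" "acts w' (\<lambda>x v. m' x *\<^sub>R v)"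
  shows "entry (W o\<^sub>L A o\<^sub>L W') i j = w o\<^sub>L entry A i j o\<^sub>L w'"
proof -
  have 1: "component_op i o\<^sub>L W = w o\<^sub>L component_op i"
    by (rule acts_eqI[OF acts_compose[OF acts_component_op assms(1)]
          acts_compose[OF assms(2) acts_component_op]]) simp
  have 2: "W' o\<^sub>L axis_op j = axis_op j o\<^sub>L w'"
    by (rule acts_eqI[OF acts_compose[OF assms(3) acts_axis_op]
          acts_compose[OF acts_axis_op assms(4)]]) (simp add: axis_def vec_eq_iff)
  have 1: "component_op i (W f) = w (component_op i f)" for f
    using arg_cong[OF 1, of "\<lambda>B. blinfun_apply B f"] by simp
  have 2: "W' (axis_op j f) = axis_op j (w' f)" for f
    using arg_cong[OF 2, of "\<lambda>B. blinfun_apply B f"] by simp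
  show ?thesis
    by (rule blinfun_eqI) (simp add: entry_def 1 2)
qed

lemma entry_bounded_ops: "A \<in> bounded_ops \<Longrightarrow> entry A i j \<in> bounded_ops"
  by (rule bounded_opsI) (simp add: entry_def axis_op_scaleC component_op_scaleC bounded_ops_scaleC)

lemma entry_add: "entry (A + B) i j = entry A i j + entry B i j"
  by (rule blinfun_eqI) (simp add: entry_def blinfun.add_left blinfun.add_right)

lemma entry_scaleC: "entry (c *\<^sub>C A) i j = c *\<^sub>C entry A i j"
  by (rule blinfun_eqI) (simp add: entry_def blinfun_apply_scaleC component_op_scaleC)

lemma entry_Lambda:
  "entry (Lambda ((*v) A)) i j = (A $ i $ j) *\<^sub>C Lambda id"
proof (rule acts_eqI)
  show "acts (entry (Lambda ((*v) A)) i j) (\<lambda>x v. (exp (- x) *\<^sub>R (A *v axis j v)) $ i)"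
    unfolding entry_def
    by (intro acts_compose acts_component_op acts_axis_op acts_Lambda)
      (simp add: matrix_vector_mul_bounded_linear)
  show "acts ((A $ i $ j) *\<^sub>C Lambda id) (\<lambda>x v. (A $ i $ j) *\<^sub>C (exp (- x) *\<^sub>R id v))"
    by (intro acts_scaleC acts_Lambda) (simp add: id_def)
  show "(exp (- x) *\<^sub>R (A *v axis j v)) $ i = (A $ i $ j) *\<^sub>C (exp (- x) *\<^sub>R id v)" for x v
    by (simp add: matrix_vector_mult_def axis_def if_distrib scaleC_complex_def cong: if_cong)
qed

lemma entry_id: "entry id_blinfun i j = (if i = j then id_blinfun else 0)"
proof (cases "i = j")
  case True
  have "entry id_blinfun i i = id_blinfun"
    unfolding entry_def
    by (rule acts_eqI[OF acts_compose[OF acts_compose[OF acts_component_op acts_id] acts_axis_op] acts_id])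
      (simp add: axis_def)
  then show ?thesis using True by simp
next
  case False
  have "entry id_blinfun i j = 0 *\<^sub>C id_blinfun"
    unfolding entry_def
    by (rule acts_eqI[OF acts_compose[OF acts_compose[OF acts_component_op acts_id] acts_axis_op]
          acts_scaleC[OF acts_id]]) (use False in \<open>simp add: axis_def\<close>)
  then show ?thesis using False by simp
qed



section \<open>Constructions with normal functionals\<close>

lemma sums_interleave:
  fixes f g :: "nat \<Rightarrow> complex"
  assumes "f sums a" "g sums b"
  shows "(\<lambda>n. if even n then f (n div 2) else g ((n - 1) div 2)) sums (a + b)"
proof -
  have "(\<lambda>n. if even n then Re (f (n div 2)) else Re (g ((n - 1) div 2))) sums (Re b + Re a)"
    "(\<lambda>n. if even n then Im (f (n div 2)) else Im (g ((n - 1) div 2))) sums (Im b + Im a)"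
    using assms by (auto intro!: sums_if simp: sums_complex_iff)
  then show ?thesis by (simp add: sums_complex_iff if_distrib add.commute cong: if_cong)
qed

lemma summable_interleave:
  fixes f g :: "nat \<Rightarrow> 'a::real_normed_vector"
  assumes "summable (\<lambda>k. (norm (f k))\<^sup>2)" "summable (\<lambda>k. (norm (g k))\<^sup>2)"
  shows "summable (\<lambda>n. (norm (if even n then f (n div 2) else g ((n - 1) div 2)))\<^sup>2)"
proof -
  have eq: "(norm (if even n then f (n div 2) else g ((n - 1) div 2)))\<^sup>2
      = (if even n then (norm (f (n div 2)))\<^sup>2 else (norm (g ((n - 1) div 2)))\<^sup>2)" for n
    by simp
  show ?thesis
    unfolding eq by (rule sums_summable[OF sums_if[OF assms(2,1)[THEN summable_sums]]])
qed

lemma normal_functionalI: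
  assumes "summable (\<lambda>k. (norm (f k))\<^sup>2)" "summable (\<lambda>k. (norm (g k))\<^sup>2)"
    "\<And>A. A \<in> bounded_ops \<Longrightarrow> (\<lambda>k. cinner (f k) (blinfun_apply A (g k))) sums \<eta> A"
  shows "normal_functional \<eta>"
  using assms unfolding normal_functional_def by blast

text \<open>
  The two sequences of vectors are interleaved.
\<close>

lemma normal_functional_add:
  assumes "normal_functional \<eta>" "normal_functional \<theta>"
  shows "normal_functional (\<lambda>A. \<eta> A + \<theta> A)"
proof -
  obtain f g where 1: "summable (\<lambda>k. (norm (f k))\<^sup>2)" "summable (\<lambda>k. (norm (g k))\<^sup>2)"
    "\<And>A. A \<in> bounded_ops \<Longrightarrow> (\<lambda>k. cinner (f k) (blinfun_apply A (g k))) sums \<eta> A"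
    using assms(1) by (auto simp: normal_functional_def)
  obtain f' g' where 2: "summable (\<lambda>k. (norm (f' k))\<^sup>2)" "summable (\<lambda>k. (norm (g' k))\<^sup>2)"
    "\<And>A. A \<in> bounded_ops \<Longrightarrow> (\<lambda>k. cinner (f' k) (blinfun_apply A (g' k))) sums \<theta> A"
    using assms(2) by (auto simp: normal_functional_def)
  let ?F = "\<lambda>n. if even n then f (n div 2) else f' ((n - 1) div 2)"
  let ?G = "\<lambda>n. if even n then g (n div 2) else g' ((n - 1) div 2)"
  have "(\<lambda>k. cinner (?F k) (blinfun_apply A (?G k))) sums (\<eta> A + \<theta> A)" if "A \<in> bounded_ops" for A
    by (rule sums_cong[THEN iffD1, OF _ sums_interleave[OF 1(3)[OF that] 2(3)[OF that]]]) simp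
  then show ?thesis
    by (rule normal_functionalI[OF summable_interleave[OF 1(1) 2(1)] summable_interleave[OF 1(2) 2(2)]])
qed

lemma normal_functional_scale:
  assumes "normal_functional \<eta>"
  shows "normal_functional (\<lambda>A. c * \<eta> A)"
proof -
  obtain f g where 1: "summable (\<lambda>k::nat. (norm (f k))\<^sup>2)" "summable (\<lambda>k. (norm (g k))\<^sup>2)"
    "\<And>A. A \<in> bounded_ops \<Longrightarrow> (\<lambda>k. cinner (f k) (blinfun_apply A (g k))) sums \<eta> A"
    using assms(1) by (auto simp: normal_functional_def)
  have "(\<lambda>k. cinner (f k) (blinfun_apply A (c *\<^sub>C g k))) sums (c * \<eta> A)" if "A \<in> bounded_ops" for A
    using sums_mult[OF 1(3)[OF that], of c] by (simp add: bounded_ops_scaleC[OF that] cinner_scaleC_right)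
  moreover have "summable (\<lambda>k. (norm (c *\<^sub>C g k))\<^sup>2)"
    using summable_mult[OF 1(2), of "(cmod c)\<^sup>2"] by (simp add: norm_scaleC power_mult_distrib)
  ultimately show ?thesis by (intro normal_functionalI[OF 1(1)])
qed

lemma normal_functional_zero: "normal_functional (\<lambda>A. 0)"
  unfolding normal_functional_def by (intro exI[of _ "\<lambda>k. 0"]) simp

lemma normal_functional_sum:
  "(\<And>i. i \<in> I \<Longrightarrow> normal_functional (\<eta> i)) \<Longrightarrow> normal_functional (\<lambda>A. \<Sum>i\<in>I. \<eta> i A)"
  by (induction I rule: infinite_finite_induct)
    (auto simp: normal_functional_zero intro: normal_functional_add)

lemma normal_functional_compress:
  assumes \<eta>: "normal_functional \<eta>" and V: "adjoint_pair V V'"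
    and b: "\<And>A. A \<in> bounded_ops \<Longrightarrow> V' o\<^sub>L A o\<^sub>L W \<in> bounded_ops"
  shows "normal_functional (\<lambda>A. \<eta> (V' o\<^sub>L A o\<^sub>L W))"
proof -
  obtain f g where 1: "summable (\<lambda>k::nat. (norm (f k))\<^sup>2)" "summable (\<lambda>k. (norm (g k))\<^sup>2)"
    "\<And>A. A \<in> bounded_ops \<Longrightarrow> (\<lambda>k. cinner (f k) (blinfun_apply A (g k))) sums \<eta> A"
    using \<eta> by (auto simp: normal_functional_def)
  have s: "summable (\<lambda>k. (norm (blinfun_apply B (h k)))\<^sup>2)" if "summable (\<lambda>k. (norm (h k))\<^sup>2)"
    for B :: "'a \<Rightarrow>\<^sub>L 'b" and h :: "nat \<Rightarrow> 'a"
  proof (rule summable_comparison_test'[OF summable_mult[OF that]])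
    show "norm ((norm (B (h k)))\<^sup>2) \<le> (norm B)\<^sup>2 * (norm (h k))\<^sup>2" for k
      using power_mono[OF norm_blinfun[of B "h k"], of 2] by (simp add: power_mult_distrib)
  qed
  have "(\<lambda>k. cinner (V (f k)) (A (W (g k)))) sums \<eta> (V' o\<^sub>L A o\<^sub>L W)" if "A \<in> bounded_ops" for A
    using 1(3)[OF b[OF that]] V by (simp add: adjoint_pair_def)
  then show ?thesis by (rule normal_functionalI[OF s[OF 1(1)] s[OF 1(2)]])
qed

lemma normal_functional_entry:
  fixes \<eta> :: "(complex L2 \<Rightarrow>\<^sub>L complex L2) \<Rightarrow> complex"
  assumes "normal_functional \<eta>"
  shows "normal_functional (\<lambda>A::'n::finite hilbert_ops. \<eta> (entry A i j))"
  using normal_functional_compress[OF assms adjoint_axis_op[of i], of "axis_op j"]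
    entry_bounded_ops[of _ i j]
  by (simp add: entry_def)

section \<open>Positive functionals\<close>

text \<open>
  Comparing $z = 1$ and $z = i$ shows that $q$ is the conjugate of $p$; then $z$ is chosen such that
  $zp = -|p|$.
\<close>

lemma phase_bound:
  assumes "\<And>z. cmod z = 1 \<Longrightarrow> of_real r + z * p + cnj z * q \<in> \<real>\<^sub>\<ge>\<^sub>0"
  shows "2 * cmod p \<le> r"
proof -
  have "Im (of_real r + z * p + cnj z * q) = 0" if "cmod z = 1" for z
    using assms[OF that] by (simp add: complex_nonneg_Reals_iff)
  from this[of 1] this[of \<i>] have q: "q = cnj p"
    by (simp add: complex_eq_iff)
  define z where "z = (if p = 0 then 1 else - cnj p / cmod p)"
  have z: "cmod z = 1" by (simp add: z_def norm_divide)
  have zp: "z * p = - of_real (cmod p)"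
  proof (cases "p = 0")
    case False
    have "cnj p * p = of_real (cmod p) * of_real (cmod p)"
      by (metis complex_norm_square mult.commute of_real_power power2_eq_square)
    then show ?thesis using False by (simp add: z_def)
  qed simp
  have "cnj z * q = cnj (z * p)" by (simp add: q)
  then have "of_real r + z * p + cnj z * q = of_real (r - 2 * cmod p)"
    by (simp add: zp)
  with assms[OF z] show ?thesis by (simp add: complex_nonneg_Reals_iff)
qed

lemma Re_cinner_lower_bound:
  assumes "norm w \<le> K * norm (v::'a::complex_inner)"
  shows "0 \<le> K * (norm v)\<^sup>2 + Re (cinner v w)"
proof -
  have "cmod (cinner v w) \<le> norm v * (K * norm v)"
    by (rule order_trans[OF cmod_cinner_le]) (use assms in \<open>auto intro: mult_left_mono\<close>)
  then show ?thesis
    using abs_Re_le_cmod[of "cinner v w"] by (simp add: power2_eq_square algebra_simps)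
qed

definition positive_functional :: "('a::complex_inner \<Rightarrow>\<^sub>L 'a) set \<Rightarrow> (('a \<Rightarrow>\<^sub>L 'a) \<Rightarrow> complex) \<Rightarrow> bool" where
  "positive_functional D \<eta> \<longleftrightarrow> clinear_on D \<eta> \<and> (\<forall>B\<in>D. positive_op B \<longrightarrow> \<eta> B \<in> \<real>\<^sub>\<ge>\<^sub>0)"

lemma clinear_on_add: "clinear_on D \<eta> \<Longrightarrow> A \<in> D \<Longrightarrow> B \<in> D \<Longrightarrow> \<eta> (A + B) = \<eta> A + \<eta> B"
  by (simp add: clinear_on_def)

lemma clinear_on_scaleC: "clinear_on D \<eta> \<Longrightarrow> A \<in> D \<Longrightarrow> \<eta> (c *\<^sub>C A) = c *\<^sub>C \<eta> A"
  by (simp add: clinear_on_def)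

definition csubspace :: "'a::complex_normed set \<Rightarrow> bool" where
  "csubspace D \<longleftrightarrow> 0 \<in> D \<and> (\<forall>x\<in>D. \<forall>y\<in>D. x + y \<in> D) \<and> (\<forall>c. \<forall>x\<in>D. c *\<^sub>C x \<in> D)"

lemma csubspace_bounded_ops: "csubspace bounded_ops"
  by (simp add: csubspace_def bounded_ops_zero bounded_ops_add bounded_ops_cscale)

lemma csubspace_sum: "csubspace D \<Longrightarrow> (\<And>i. i \<in> I \<Longrightarrow> x i \<in> D) \<Longrightarrow> sum x I \<in> D"
  by (induction I rule: infinite_finite_induct) (auto simp: csubspace_def)

lemma clinear_on_sum:
  assumes "csubspace D" "clinear_on D \<eta>" "\<And>i. i \<in> I \<Longrightarrow> x i \<in> D"
  shows "\<eta> (sum x I) = (\<Sum>i\<in>I. \<eta> (x i))"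
proof -
  have 0: "\<eta> 0 = 0"
    using clinear_on_scaleC[OF assms(2), of 0 0] assms(1) by (simp add: csubspace_def)
  from assms(3) show ?thesis
    by (induction I rule: infinite_finite_induct)
      (auto simp: 0 clinear_on_add[OF assms(2)] csubspace_sum[OF assms(1)])
qed

text \<open>
  If $B$ is adjoint to $A$ and $|z| = 1$, then $2\|A\| + zA + \bar z B$ is a positive operator.
  Applying $\eta$ and optimizing over $z$ gives $|\eta(A)| \le \eta(1)\|A\|$.
\<close>

lemma positive_functional_bound:
  assumes \<eta>: "positive_functional bounded_ops \<eta>" and n: "normal_functional \<eta>"
    and T: "T \<in> bounded_ops"
  shows "cmod (\<eta> T) \<le> Re (\<eta> id_blinfun) * norm T"
proof -
  have lin: "clinear_on bounded_ops \<eta>" and pos: "\<And>B. B \<in> bounded_ops \<Longrightarrow> positive_op B \<Longrightarrow> \<eta> B \<in> \<real>\<^sub>\<ge>\<^sub>0"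
    using \<eta> by (auto simp: positive_functional_def)
  have "\<eta> id_blinfun \<in> \<real>\<^sub>\<ge>\<^sub>0"
    by (rule pos) (simp_all add: bounded_ops_id positive_op_def cinner_self)
  then have id: "\<eta> id_blinfun = of_real (Re (\<eta> id_blinfun))" and id0: "0 \<le> Re (\<eta> id_blinfun)"
    by (simp_all add: complex_nonneg_Reals_iff complex_eq_iff)
  show ?thesis
  proof (rule normal_functional_bound[OF n _ T id0])
    fix A B :: "'a \<Rightarrow>\<^sub>L 'a"
    assume A: "A \<in> bounded_ops" and B: "B \<in> bounded_ops" and AB: "adjoint_pair A B"
    have "2 * cmod (\<eta> A) \<le> 2 * (Re (\<eta> id_blinfun) * norm A)"
    proof (rule phase_bound)
      fix z :: complex assume z: "cmod z = 1"
      let ?X = "of_real (2 * norm A) *\<^sub>C id_blinfun + z *\<^sub>C A + cnj z *\<^sub>C B"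
      have X: "?X \<in> bounded_ops"
        by (intro bounded_ops_add bounded_ops_cscale bounded_ops_id A B)
      have "positive_op ?X"
        unfolding positive_op_def
      proof
        fix f
        have "cinner f (B f) = cnj (cinner f (A f))"
          using AB cinner_commute[of f "A f"] by (simp add: adjoint_pair_def)
        then have "cinner f (?X f) = of_real (2 * norm A * (norm f)\<^sup>2)
            + (cinner f (z *\<^sub>C A f) + cnj (cinner f (z *\<^sub>C A f)))"
          by (simp add: blinfun.add_left blinfun_apply_scaleC cinner_add_right cinner_scaleC_right
              cinner_self)
        also have "\<dots> = of_real (2 * (norm A * (norm f)\<^sup>2 + Re (cinner f (z *\<^sub>C A f))))"
          by (simp add: complex_add_cnj)
        finally show "cinner f (?X f) \<in> \<real>\<^sub>\<ge>\<^sub>0"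
          using Re_cinner_lower_bound[of "z *\<^sub>C A f" "norm A" f] norm_blinfun[of A f]
          by (simp add: norm_scaleC z del: of_real_mult of_real_add)
      qed
      from pos[OF X this]
      show "of_real (2 * (Re (\<eta> id_blinfun) * norm A)) + z * \<eta> A + cnj z * \<eta> B \<in> \<real>\<^sub>\<ge>\<^sub>0"
        using A B by (simp add: clinear_on_add[OF lin] clinear_on_scaleC[OF lin] bounded_ops_add
            bounded_ops_cscale bounded_ops_id scaleC_complex_def mult_ac flip: id)
    qed
    then show "cmod (\<eta> A) \<le> Re (\<eta> id_blinfun) * norm A" by simp
  qed
qed

section \<open>The map $\Omega$\<close>

lemma cinner_matrix_vector:
  fixes h :: "complex ^ 'n::finite"
  shows "cinner h (X *v k) = (\<Sum>a\<in>UNIV. \<Sum>b\<in>UNIV. cnj (h $ a) * X $ a $ b * k $ b)"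
  by (simp add: cinner_vec cinner_complex matrix_vector_mult_def sum_distrib_left mult.assoc)

text \<open>
  For $h_i \in \mathbb{C}^n$ the number
  $\sum_{ij} \langle h_i, \Omega_\eta(A_{ij}) h_j\rangle$ is $\eta(T)$ with
  $T = \sum_{ij} W_i^* A_{ij} W_j$, where $W_i f = h_i \otimes f$; the operator $T$ is positive.
  The set \<open>D\<close> is the null boundary algebra for a boundary weight and
  $B(L^2(0,\infty))$ for its truncations.
\<close>

lemma Omega_positive_block:
  fixes A :: "nat \<Rightarrow> nat \<Rightarrow> 'n::finite hilbert_ops"
  assumes D: "csubspace D" and \<eta>: "positive_functional D \<eta>"
    and A: "\<And>i j a b. i < m \<Longrightarrow> j < m \<Longrightarrow> entry (A i j) a b \<in> D"
    and lin: "\<And>i j. i < m \<Longrightarrow> j < m \<Longrightarrow> A i j \<in> bounded_ops"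
    and pos: "positive_block m (\<lambda>i j. blinfun_apply (A i j))"
  shows "positive_block m (\<lambda>i j. (*v) (Omega \<eta> (A i j)))"
  unfolding positive_block_def
proof
  fix h :: "nat \<Rightarrow> complex ^ 'n"
  have \<eta>lin: "clinear_on D \<eta>" using \<eta> by (simp add: positive_functional_def)
  let ?T = "\<Sum>i<m. \<Sum>j<m. \<Sum>a\<in>UNIV. \<Sum>b\<in>UNIV. (cnj (h i $ a) * h j $ b) *\<^sub>C entry (A i j) a b"
  have cs: "c *\<^sub>C entry (A i j) a b \<in> D" if "i < m" "j < m" for c i j a b
    using D A[OF that] by (simp add: csubspace_def)
  have T: "?T \<in> D"
    by (intro csubspace_sum[OF D] cs) auto
  have "positive_op ?T"
    unfolding positive_op_def
  proof
    fix f
    let ?W = "\<lambda>i. \<Sum>a\<in>UNIV. h i $ a *\<^sub>C axis_op a f"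
    have "cinner f (?T f) = (\<Sum>i<m. \<Sum>j<m. cinner (?W i) (A i j (?W j)))"
      unfolding blinfun.sum_left cinner_sum_right
    proof (intro sum.cong refl)
      fix i j assume "i \<in> {..<m}" "j \<in> {..<m}"
      then have Aij: "A i j \<in> bounded_ops" by (simp add: lin)
      have adj: "cinner (axis_op a f) g = cinner f (component_op a g)" for a :: 'n and g
        using adjoint_axis_op[of a] by (simp add: adjoint_pair_def)
      have "cinner (?W i) (A i j (?W j)) = (\<Sum>a\<in>UNIV. cnj (h i $ a) * cinner (axis_op a f) (A i j (?W j)))"
        by (simp only: cinner_sum_left cinner_scaleC_left)
      also have "\<dots> = (\<Sum>a\<in>UNIV. \<Sum>b\<in>UNIV.
          cnj (h i $ a) * h j $ b * cinner (axis_op a f) (A i j (axis_op b f)))"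
        by (simp add: clinear_sum[OF bounded_ops_clinear[OF Aij]] bounded_ops_scaleC[OF Aij]
            cinner_sum_right cinner_scaleC_right sum_distrib_left mult_ac)
      also have "\<dots> = (\<Sum>a\<in>UNIV. \<Sum>b\<in>UNIV.
          cinner f (((cnj (h i $ a) * h j $ b) *\<^sub>C entry (A i j) a b) f))"
        by (simp add: adj blinfun_apply_scaleC cinner_scaleC_right entry_def)
      finally show "(\<Sum>a\<in>UNIV. \<Sum>b\<in>UNIV. cinner f (((cnj (h i $ a) * h j $ b) *\<^sub>C entry (A i j) a b) f))
          = cinner (?W i) (A i j (?W j))" by simp
    qed
    also have "\<dots> \<in> \<real>\<^sub>\<ge>\<^sub>0" using pos by (simp add: positive_block_def)
    finally show "cinner f (?T f) \<in> \<real>\<^sub>\<ge>\<^sub>0" .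
  qed
  then have "\<eta> ?T \<in> \<real>\<^sub>\<ge>\<^sub>0" using \<eta> T by (simp add: positive_functional_def)
  also have "\<eta> ?T = (\<Sum>i<m. \<Sum>j<m. \<Sum>a\<in>UNIV. \<Sum>b\<in>UNIV.
      \<eta> ((cnj (h i $ a) * h j $ b) *\<^sub>C entry (A i j) a b))"
    by (subst clinear_on_sum[OF D \<eta>lin], (intro csubspace_sum[OF D] cs; simp), intro sum.cong refl)+
  also have "\<dots> = (\<Sum>i<m. \<Sum>j<m. cinner (h i) (Omega \<eta> (A i j) *v h j))"
    unfolding cinner_matrix_vector
    by (intro sum.cong refl)
      (simp add: clinear_on_scaleC[OF \<eta>lin A] scaleC_complex_def Omega_def mult_ac)
  finally show "(\<Sum>i<m. \<Sum>j<m. cinner (h i) (Omega \<eta> (A i j) *v h j)) \<in> \<real>\<^sub>\<ge>\<^sub>0" .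
qed

lemma clinear_on_Omega:
  fixes N :: "'n::finite hilbert_ops set"
  assumes "clinear_on D \<eta>" "\<And>A a b. A \<in> N \<Longrightarrow> entry A a b \<in> D"
  shows "clinear_on N (Omega \<eta>)"
  unfolding clinear_on_def
proof (intro conjI ballI allI)
  show "Omega \<eta> (A + B) = Omega \<eta> A + Omega \<eta> B" if "A \<in> N" "B \<in> N" for A B
    by (simp add: vec_eq_iff Omega_def entry_add clinear_on_add[OF assms(1)] assms(2) that)
  show "Omega \<eta> (c *\<^sub>C A) = c *\<^sub>C Omega \<eta> A" if "A \<in> N" for c A
    by (simp add: vec_eq_iff Omega_def entry_scaleC clinear_on_scaleC[OF assms(1)] assms(2) that
        scaleC_vec_nth)
qed

lemma clinear_matrix_expand:
  fixes \<rho> :: "'n::finite cmat \<Rightarrow> complex"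
  assumes "clinear \<rho>"
  shows "\<rho> X = (\<Sum>i\<in>UNIV. \<Sum>j\<in>UNIV. \<rho> (axis i (axis j 1)) * X $ i $ j)"
proof -
  have "X = (\<Sum>i\<in>UNIV. \<Sum>j\<in>UNIV. X $ i $ j *\<^sub>C axis i (axis j 1))"
  proof (rule vec_eq_iff[THEN iffD2], rule allI, rule vec_eq_iff[THEN iffD2], rule allI)
    fix a b
    have 1: "X $ i $ j * axis i (axis j 1) $ a $ b = (if j = b then if i = a then X $ i $ b else 0 else 0)" for i j
      by (simp add: axis_def)
    have "(\<Sum>i\<in>UNIV. \<Sum>j\<in>UNIV. X $ i $ j *\<^sub>C axis i (axis j 1)) $ a $ b
        = (\<Sum>i\<in>UNIV. \<Sum>j\<in>UNIV. X $ i $ j * axis i (axis j 1) $ a $ b)"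
      by (simp add: scaleC_vec_nth scaleC_complex_def)
    also have "\<dots> = X $ a $ b" unfolding 1 by simp
    finally show "X $ a $ b = (\<Sum>i\<in>UNIV. \<Sum>j\<in>UNIV. X $ i $ j *\<^sub>C axis i (axis j 1)) $ a $ b" ..
  qed
  then have "\<rho> X = \<rho> (\<Sum>i\<in>UNIV. \<Sum>j\<in>UNIV. X $ i $ j *\<^sub>C axis i (axis j 1))"
    by (rule arg_cong)
  also have "\<dots> = (\<Sum>i\<in>UNIV. \<Sum>j\<in>UNIV. \<rho> (axis i (axis j 1)) * X $ i $ j)"
    by (simp only: clinear_sum[OF assms] clinear_scaleC[OF assms] scaleC_complex_def mult.commute)
  finally show ?thesis .
qed

lemma normal_functional_Omega:
  fixes \<rho> :: "'n::finite cmat \<Rightarrow> complex"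
  assumes "clinear \<rho>" "normal_functional \<eta>"
  shows "normal_functional (\<lambda>A. \<rho> (Omega \<eta> A))"
proof -
  have "\<rho> (Omega \<eta> A) = (\<Sum>i\<in>UNIV. \<Sum>j\<in>UNIV. \<rho> (axis i (axis j 1)) * \<eta> (entry A i j))" for A
    by (rule trans[OF clinear_matrix_expand[OF assms(1)]]) (simp add: Omega_def)
  then show ?thesis
    by (simp, intro normal_functional_sum normal_functional_scale
        normal_functional_entry[OF assms(2)])
qed



section \<open>The null boundary algebra\<close>

lemma sqrt_complement_bounded_ops: "sqrt_complement \<in> bounded_ops"
  by (rule acts_real_multiplier[OF acts_sqrt_complement])

lemma null_boundary_algebraI:
  "B \<in> bounded_ops \<Longrightarrow> sqrt_complement o\<^sub>L B o\<^sub>L sqrt_complement \<in> null_boundary_algebra"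
  by (auto simp: null_boundary_algebra_def)

lemma null_boundary_algebra_subset: "null_boundary_algebra \<subseteq> bounded_ops"
  by (auto simp: null_boundary_algebra_def intro!: bounded_ops_compose sqrt_complement_bounded_ops)

lemma sandwich_add: "W o\<^sub>L (A + B) o\<^sub>L V = (W o\<^sub>L A o\<^sub>L V) + (W o\<^sub>L B o\<^sub>L V)"
  by (rule blinfun_eqI) (simp add: blinfun.add_left blinfun.add_right)

lemma sandwich_scaleC: "W \<in> bounded_ops \<Longrightarrow> W o\<^sub>L (c *\<^sub>C A) o\<^sub>L V = c *\<^sub>C (W o\<^sub>L A o\<^sub>L V)"
  by (rule blinfun_eqI) (simp add: blinfun_apply_scaleC bounded_ops_scaleC)

lemma csubspace_null_boundary_algebra: "csubspace null_boundary_algebra"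
  unfolding csubspace_def
proof (intro conjI ballI allI)
  have "sqrt_complement o\<^sub>L 0 o\<^sub>L sqrt_complement = (0 :: 'a L2 \<Rightarrow>\<^sub>L 'a L2)"
    by (rule blinfun_eqI) simp
  then show "0 \<in> (null_boundary_algebra :: ('a L2 \<Rightarrow>\<^sub>L 'a L2) set)"
    by (metis null_boundary_algebraI[OF bounded_ops_zero])
next
  fix A B :: "'a L2 \<Rightarrow>\<^sub>L 'a L2" assume "A \<in> null_boundary_algebra" "B \<in> null_boundary_algebra"
  then show "A + B \<in> null_boundary_algebra"
    by (auto simp: null_boundary_algebra_def intro: bounded_ops_add simp flip: sandwich_add)
next
  fix c and A :: "'a L2 \<Rightarrow>\<^sub>L 'a L2" assume "A \<in> null_boundary_algebra"
  then show "c *\<^sub>C A \<in> null_boundary_algebra"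
    by (auto simp: null_boundary_algebra_def intro: bounded_ops_cscale
        simp flip: sandwich_scaleC[OF sqrt_complement_bounded_ops])
qed

lemma entry_null_boundary_algebra:
  "A \<in> null_boundary_algebra \<Longrightarrow> entry A i j \<in> null_boundary_algebra"
  by (auto simp: null_boundary_algebra_def intro!: entry_bounded_ops
      entry_sandwich acts_sqrt_complement)

lemma cutoff_real_multiplier:
  "0 \<le> t \<Longrightarrow> acts (cutoff t) (\<lambda>x v. (if t < x then 1 else 0 :: real) *\<^sub>R v)"
  by (rule back_subst[where P = "acts (cutoff t)", OF acts_cutoff]) (auto simp: fun_eq_iff)

lemmas cutoff_bounded_ops = acts_real_multiplier(1)[OF cutoff_real_multiplier]
lemmas adjoint_cutoff = acts_real_multiplier(2)[OF cutoff_real_multiplier]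

lemma cinner_cutoff:
  fixes f g :: "'a::{complex_inner, second_countable_topology} L2"
  assumes "0 \<le> t"
  shows "cinner (cutoff t f) g = cinner f (cutoff t g)"
proof -
  have "adjoint_pair (cutoff t :: 'a L2 \<Rightarrow>\<^sub>L 'a L2) (cutoff t)" by (rule adjoint_cutoff[OF assms])
  then show ?thesis by (simp add: adjoint_pair_def)
qed

text \<open>
  The quotient of $E_t$ by $\sqrt{I - \Lambda(I)}$. It is bounded by $(1 - e^{-t})^{-1/2}$, which
  places $E_t A E_t$ in the null boundary algebra for every bounded $A$.
\<close>

definition cutoff_quotient :: "real \<Rightarrow> 'a::{complex_inner, second_countable_topology} L2 \<Rightarrow>\<^sub>L 'a L2" where
  "cutoff_quotient t = mult_op (\<lambda>x. if t < x then 1 / sqrt (1 - exp (- x)) else 0)"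

lemma acts_cutoff_quotient:
  assumes t: "0 < t"
  shows "acts (cutoff_quotient t) (\<lambda>x v. (if t < x then 1 / sqrt (1 - exp (- x)) else 0) *\<^sub>R v)"
  unfolding cutoff_quotient_def
proof (rule acts_mult_op)
  show "(\<lambda>x. if t < x then 1 / sqrt (1 - exp (- x)) else 0) \<in> borel_measurable borel"
    by measurable
  show "\<bar>if t < x then 1 / sqrt (1 - exp (- x)) else 0\<bar> \<le> 1 / sqrt (1 - exp (- t))" for x
    using t by (auto intro!: divide_left_mono)
qed

lemma cutoff_sandwich:
  fixes A :: "'a::{complex_inner, second_countable_topology} L2 \<Rightarrow>\<^sub>L 'a L2"
  assumes t: "0 < t"
  shows "cutoff t o\<^sub>L A o\<^sub>L cutoff t
    = sqrt_complement o\<^sub>L (cutoff_quotient t o\<^sub>L A o\<^sub>L cutoff_quotient t) o\<^sub>L sqrt_complement"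
proof -
  have "sqrt_complement o\<^sub>L cutoff_quotient t = (cutoff t :: 'a L2 \<Rightarrow>\<^sub>L 'a L2)"
    by (rule acts_eqI[OF acts_compose[OF acts_sqrt_complement acts_cutoff_quotient[OF t]] acts_cutoff])
      (use t in auto)
  then have 1: "sqrt_complement (cutoff_quotient t f) = cutoff t f" for f :: "'a L2"
    by (metis blinfun_apply_blinfun_compose)
  have "cutoff_quotient t o\<^sub>L sqrt_complement = (cutoff t :: 'a L2 \<Rightarrow>\<^sub>L 'a L2)"
    by (rule acts_eqI[OF acts_compose[OF acts_cutoff_quotient[OF t] acts_sqrt_complement] acts_cutoff])
      (use t in auto)
  then have 2: "cutoff_quotient t (sqrt_complement f) = cutoff t f" for f :: "'a L2"
    by (metis blinfun_apply_blinfun_compose)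
  show ?thesis by (rule blinfun_eqI) (simp add: 1 2)
qed

lemma cutoff_null_boundary_algebra:
  assumes t: "0 < t" and A: "A \<in> bounded_ops"
  shows "cutoff t o\<^sub>L A o\<^sub>L cutoff t \<in> null_boundary_algebra"
  unfolding cutoff_sandwich[OF t]
  by (intro null_boundary_algebraI bounded_ops_compose A
      acts_real_multiplier(1)[OF acts_cutoff_quotient[OF t]])

section \<open>Truncated boundary weights\<close>

definition truncated_weight ::
  "((complex L2 \<Rightarrow>\<^sub>L complex L2) \<Rightarrow> complex) \<Rightarrow> real \<Rightarrow> (complex L2 \<Rightarrow>\<^sub>L complex L2) \<Rightarrow> complex" where
  "truncated_weight \<nu> t A = \<nu> (cutoff t o\<^sub>L A o\<^sub>L cutoff t)"

text \<open>
  The number $a_t = \nu_t(\Lambda(1))$.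
\<close>

definition mass :: "((complex L2 \<Rightarrow>\<^sub>L complex L2) \<Rightarrow> complex) \<Rightarrow> real \<Rightarrow> real" where
  "mass \<nu> t = Re (truncated_weight \<nu> t (Lambda id))"

lemma truncated_omega:
  assumes "0 < t"
  shows "truncated (omega \<phi> \<nu>) t \<rho> A = \<rho> (\<phi> (Omega (truncated_weight \<nu> t) A))"
proof -
  have "shift t o\<^sub>L adj (shift t) o\<^sub>L A o\<^sub>L shift t o\<^sub>L adj (shift t) = cutoff t o\<^sub>L A o\<^sub>L cutoff t"
    by (rule blinfun_eqI) (simp add: cutoff_def)
  moreover have "entry (cutoff t o\<^sub>L A o\<^sub>L cutoff t) i j = cutoff t o\<^sub>L entry A i j o\<^sub>L cutoff t" for i j
    by (rule entry_sandwich) (use assms in \<open>auto intro!: cutoff_real_multiplier\<close>)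
  ultimately show ?thesis
    by (simp add: truncated_def omega_def Omega_def truncated_weight_def)
qed

lemma positive_op_sandwich:
  assumes "adjoint_pair V W" "positive_op A"
  shows "positive_op (W o\<^sub>L A o\<^sub>L V)"
  using assms by (simp add: positive_op_def) (metis adjoint_pair_def)

lemma positive_op_id: "positive_op id_blinfun"
  by (simp add: positive_op_def cinner_self)

text \<open>
  $\Lambda(I)$ is the square of multiplication by $e^{-x/2}$.
\<close>

lemma positive_op_Lambda_id:
  "positive_op (Lambda id :: 'a::{complex_inner, second_countable_topology} L2 \<Rightarrow>\<^sub>L 'a L2)"
proof -
  have m: "acts (mult_op (\<lambda>x. exp (- x / 2)) :: 'a L2 \<Rightarrow>\<^sub>L 'a L2) (\<lambda>x v. exp (- x / 2) *\<^sub>R v)"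
    by (rule acts_mult_op[where K = 1]) auto
  have "(Lambda id :: 'a L2 \<Rightarrow>\<^sub>L 'a L2)
      = mult_op (\<lambda>x. exp (- x / 2)) o\<^sub>L id_blinfun o\<^sub>L mult_op (\<lambda>x. exp (- x / 2))"
    by (rule acts_eqI[OF acts_Lambda acts_compose[OF acts_compose[OF m acts_id] m]])
      (simp_all add: id_def flip: exp_add)
  then show ?thesis
    by (simp only: positive_op_sandwich[OF acts_real_multiplier(2)[OF m] positive_op_id])
qed

lemma Lambda_id_real_multiplier: "acts (Lambda id) (\<lambda>x v. exp (- x) *\<^sub>R v)"
  using acts_Lambda[of id] by (simp add: id_def)

lemmas Lambda_id_bounded_ops = acts_real_multiplier(1)[OF Lambda_id_real_multiplier]

lemma norm_cutoff_le: 
  assumes "0 \<le> t" 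
  shows "norm (blinfun_apply (cutoff t) f) \<le> norm f"
proof (rule power2_le_imp_le)
  have cc: "cutoff t o\<^sub>L cutoff t = (cutoff t :: 'a L2 \<Rightarrow>\<^sub>L 'a L2)"
    by (rule acts_eqI[OF acts_compose[OF acts_cutoff acts_cutoff] acts_cutoff]) (use assms in auto)
  have "cutoff t (cutoff t f) = cutoff t f" using arg_cong[OF cc, of "\<lambda>B. blinfun_apply B f"] by simp
  then have "cinner (cutoff t f) (cutoff t f) = cinner f (cutoff t f)"
    by (simp add: cinner_cutoff assms)
  then have "(norm (cutoff t f))\<^sup>2 = Re (cinner f (cutoff t f))" by (simp add: cinner_self complex_eq_iff)
  also have "\<dots> \<le> norm f * norm (cutoff t f)"
    using complex_Re_le_cmod cmod_cinner_le by (rule order_trans)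
  finally have "norm (cutoff t f) \<le> norm f"
    by (cases "norm (cutoff t f) = 0") (simp_all add: power2_eq_square)
  then show "(norm (cutoff t f))\<^sup>2 \<le> (norm f)\<^sup>2" by (rule power_mono) simp
qed simp

text \<open>
  The squared norm of $f - E_s f$ is the integral of $\|f(x)\|^2$ over $(0,s]$; dominated
  convergence applies.
\<close>

lemma cutoff_tendsto:
  fixes f :: "'a::{complex_inner, second_countable_topology} L2"
  assumes s: "s \<longlonglongrightarrow> 0" and s0: "\<And>n. 0 \<le> s n"
  shows "(\<lambda>n. blinfun_apply (cutoff (s n)) f) \<longlonglongrightarrow> f"
proof -
  let ?D = "\<lambda>n. id_blinfun + (-1) *\<^sub>C cutoff (s n)"
  have D: "AE x in half_line. rep_L2 (?D n f) x = (if s n < x then 0 else rep_L2 f x)" for n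
    using actsD[OF acts_add[OF acts_id acts_scaleC[OF acts_cutoff[OF s0[of n]], of "-1"]], of f]
    by eventually_elim (use scaleC_of_real[of "-1" "rep_L2 f _"] in \<open>auto split: if_splits\<close>)
  have m: "rep_L2 g \<in> borel_measurable half_line" for g :: "'a L2"
    using square_integrable_rep by (auto simp: square_integrable_def)
  have "(\<lambda>n. \<integral>x. (norm (rep_L2 (?D n f) x))\<^sup>2 \<partial>half_line) \<longlonglongrightarrow> (\<integral>x. 0 \<partial>half_line)"
  proof (rule integral_dominated_convergence)
    show "integrable half_line (\<lambda>x. (norm (rep_L2 f x))\<^sup>2)"
      using square_integrable_rep by (auto simp: square_integrable_def)
    have "AE x in half_line. \<forall>n. rep_L2 (?D n f) x = (if s n < x then 0 else rep_L2 f x)"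
      using D by (simp add: AE_all_countable)
    then show "AE x in half_line. (\<lambda>n. (norm (rep_L2 (?D n f) x))\<^sup>2) \<longlonglongrightarrow> 0"
      using AE_half_line_pos
    proof eventually_elim
      case (elim x)
      have "\<forall>\<^sub>F n in sequentially. s n < x" using order_tendstoD(2)[OF s elim(2)] .
      then have "\<forall>\<^sub>F n in sequentially. (norm (rep_L2 (?D n f) x))\<^sup>2 = 0"
        by eventually_elim (simp add: elim(1)[rule_format])
      then show ?case by (rule tendsto_eventually)
    qed
    show "AE x in half_line. norm ((norm (rep_L2 (?D n f) x))\<^sup>2) \<le> (norm (rep_L2 f x))\<^sup>2" for n
      using D[of n] by eventually_elim simp
  qed (simp, intro borel_measurable_power measurable_compose[OF m borel_measurable_norm])
  then have "(\<lambda>n. (norm (?D n f))\<^sup>2) \<longlonglongrightarrow> 0" by (simp add: power2_norm_L2)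
  then have "(\<lambda>n. sqrt ((norm (?D n f))\<^sup>2)) \<longlonglongrightarrow> sqrt 0" by (rule tendsto_real_sqrt)
  moreover have "norm (?D n f) = norm (cutoff (s n) f - f)" for n
    using scaleC_of_real[of "-1" "cutoff (s n) f"]
    by (simp add: blinfun.add_left blinfun_apply_scaleC norm_minus_commute)
  ultimately have "(\<lambda>n. norm (cutoff (s n) f - f)) \<longlonglongrightarrow> 0" by simp
  then show ?thesis by (simp add: LIM_zero_iff tendsto_norm_zero_iff)
qed

lemma normal_functional_cutoff_tendsto:
  assumes \<eta>: "normal_functional \<eta>" and B: "B \<in> bounded_ops"
    and s: "s \<longlonglongrightarrow> 0" and s0: "\<And>n. 0 \<le> s n"
  shows "(\<lambda>n. \<eta> (cutoff (s n) o\<^sub>L B o\<^sub>L cutoff (s n))) \<longlonglongrightarrow> \<eta> B"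
proof -
  obtain f g where fg: "summable (\<lambda>k::nat. (norm (f k))\<^sup>2)" "summable (\<lambda>k. (norm (g k))\<^sup>2)"
    and *: "\<And>A. A \<in> bounded_ops \<Longrightarrow> (\<lambda>k. cinner (f k) (blinfun_apply A (g k))) sums \<eta> A"
    using \<eta> by (auto simp: normal_functional_def)
  let ?c = "\<lambda>n. cutoff (s n) :: 'a L2 \<Rightarrow>\<^sub>L 'a L2"
  let ?B = "\<lambda>n. ?c n o\<^sub>L B o\<^sub>L ?c n"
  have Bb: "?B n \<in> bounded_ops" for n by (intro bounded_ops_compose cutoff_bounded_ops s0 B)
  have eq: "cinner (f k) (?B n (g k)) = cinner (?c n (f k)) (B (?c n (g k)))" for k n
    by (simp add: cinner_cutoff s0)
  have "(\<lambda>n. \<Sum>k. cinner (f k) (?B n (g k))) \<longlonglongrightarrow> (\<Sum>k. cinner (f k) (B (g k)))"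
  proof (rule tannerys_theorem[THEN conjunct2, THEN conjunct2])
    show "(\<lambda>n. cinner (f k) (?B n (g k))) \<longlonglongrightarrow> cinner (f k) (B (g k))" for k
      unfolding eq unfolding cinner_def complex_eq
      by (intro tendsto_intros cutoff_tendsto s s0 blinfun.tendsto
          bounded_linear.tendsto[OF bounded_linear_scaleC])
    show "summable (\<lambda>k. norm B * (norm (f k) * norm (g k)))"
      by (intro summable_mult summable_product fg)
    have "norm (cinner (f k) (?B n (g k))) \<le> norm B * (norm (f k) * norm (g k))" for k n
    proof -
      have "norm (cinner (f k) (?B n (g k))) \<le> norm (?c n (f k)) * norm (B (?c n (g k)))"
        unfolding eq by (rule cmod_cinner_le)
      also have "\<dots> \<le> norm (f k) * (norm B * norm (g k))"
        by (intro mult_mono norm_cutoff_le s0 order_trans[OF norm_blinfun mult_left_mono]) auto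
      finally show ?thesis by (simp add: algebra_simps)
    qed
    then show "\<forall>\<^sub>F (k, n) in sequentially \<times>\<^sub>F sequentially.
        norm (cinner (f k) (?B n (g k))) \<le> norm B * (norm (f k) * norm (g k))"
      by (intro always_eventually) (simp only: split_beta, blast)
  qed simp
  then show ?thesis
    by (simp only: sums_unique[OF *[OF B], symmetric] sums_unique[OF *[OF Bb], symmetric])
qed

context
  fixes \<nu> :: "(complex L2 \<Rightarrow>\<^sub>L complex L2) \<Rightarrow> complex"
  assumes bw: "boundary_weight \<nu>" and pw: "positive_weight \<nu>"
begin

lemma positive_functional_weight: "positive_functional null_boundary_algebra \<nu>"
  using bw pw by (simp add: positive_functional_def boundary_weight_def positive_weight_def)

lemma normal_truncated_weight: "0 < t \<Longrightarrow> normal_functional (truncated_weight \<nu> t)"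
  unfolding truncated_weight_def cutoff_sandwich
  by (rule normal_functional_compress[OF _ acts_real_multiplier(2)[OF acts_cutoff_quotient]])
    (use bw in \<open>auto simp: boundary_weight_def intro!: bounded_ops_compose
      acts_real_multiplier(1)[OF acts_cutoff_quotient]\<close>)

lemma positive_truncated_weight:
  assumes t: "0 < t"
  shows "positive_functional bounded_ops (truncated_weight \<nu> t)"
  unfolding positive_functional_def clinear_on_def truncated_weight_def
proof (intro conjI ballI allI impI)
  have lin: "clinear_on null_boundary_algebra \<nu>" using bw by (simp add: boundary_weight_def)
  fix A B :: "complex L2 \<Rightarrow>\<^sub>L complex L2" and c assume A: "A \<in> bounded_ops"
  show "\<nu> (cutoff t o\<^sub>L c *\<^sub>C A o\<^sub>L cutoff t) = c *\<^sub>C \<nu> (cutoff t o\<^sub>L A o\<^sub>L cutoff t)"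
    using t by (simp add: sandwich_scaleC cutoff_bounded_ops clinear_on_scaleC[OF lin]
        cutoff_null_boundary_algebra[OF t A])
  show "\<nu> (cutoff t o\<^sub>L A o\<^sub>L cutoff t) \<in> \<real>\<^sub>\<ge>\<^sub>0" if "positive_op A"
    using pw cutoff_null_boundary_algebra[OF t A]
      positive_op_sandwich[OF adjoint_cutoff[OF less_imp_le[OF t]] that]
    by (simp add: positive_weight_def)
  assume B: "B \<in> bounded_ops"
  show "\<nu> (cutoff t o\<^sub>L (A + B) o\<^sub>L cutoff t)
      = \<nu> (cutoff t o\<^sub>L A o\<^sub>L cutoff t) + \<nu> (cutoff t o\<^sub>L B o\<^sub>L cutoff t)"
    using t by (simp add: sandwich_add clinear_on_add[OF lin] cutoff_null_boundary_algebra[OF t] A B)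
qed

lemma truncated_weight_Lambda:
  assumes "0 < t"
  shows "truncated_weight \<nu> t (Lambda id) = of_real (mass \<nu> t)" "0 \<le> mass \<nu> t"
  using positive_truncated_weight[OF assms] positive_op_Lambda_id Lambda_id_bounded_ops
  unfolding positive_functional_def mass_def
  by (auto simp: complex_nonneg_Reals_iff complex_eq_iff)

lemma truncated_weight_id:
  assumes "0 < t"
  shows "truncated_weight \<nu> t id_blinfun = of_real (Re (truncated_weight \<nu> t id_blinfun))"
    "0 \<le> Re (truncated_weight \<nu> t id_blinfun)"
  using positive_truncated_weight[OF assms] positive_op_id bounded_ops_id
  unfolding positive_functional_def
  by (auto simp: complex_nonneg_Reals_iff complex_eq_iff)

text \<open>
  Pointwise, $1 - e^{-x}$ is the sum of its restrictions to $(t,\infty)$ and to $(0,t]$, that is,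
  $I - \Lambda(1) = E_t (I - \Lambda(1)) E_t + R$ with $R \ge 0$ in the null boundary algebra. Apply
  $\nu$ and use $\nu(R) \ge 0$.
\<close>

lemma truncated_weight_id_le:
  assumes nw: "normalized_weight \<nu>" and t: "0 < t"
  shows "Re (truncated_weight \<nu> t id_blinfun) \<le> 1 + mass \<nu> t"
proof -
  have lin: "clinear_on null_boundary_algebra \<nu>" using bw by (simp add: boundary_weight_def)
  define D :: "complex L2 \<Rightarrow>\<^sub>L complex L2" where "D = id_blinfun + (-1) *\<^sub>C cutoff t"
  have D: "acts D (\<lambda>x v. (if t < x then 0 else 1 :: real) *\<^sub>R v)"
  proof -
    have "acts D (\<lambda>x v. v + (-1) *\<^sub>C (if t < x then v else 0))"
      unfolding D_def by (intro acts_add acts_id acts_scaleC acts_cutoff) (use t in simp)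
    moreover have "(\<lambda>x v. v + (-1) *\<^sub>C (if t < x then v else 0))
        = (\<lambda>x v::complex. (if t < x then 0 else 1 :: real) *\<^sub>R v)"
      by (auto simp: fun_eq_iff scaleC_complex_def)
    ultimately show ?thesis by simp
  qed
  let ?S = "sqrt_complement :: complex L2 \<Rightarrow>\<^sub>L complex L2"
  let ?I = "cutoff t o\<^sub>L id_blinfun o\<^sub>L cutoff t :: complex L2 \<Rightarrow>\<^sub>L complex L2"
  let ?L = "cutoff t o\<^sub>L Lambda id o\<^sub>L cutoff t :: complex L2 \<Rightarrow>\<^sub>L complex L2"
  let ?R = "?S o\<^sub>L (D o\<^sub>L id_blinfun o\<^sub>L D) o\<^sub>L ?S"
  have c: "acts (cutoff t :: complex L2 \<Rightarrow>\<^sub>L complex L2) (\<lambda>x v. if t < x then v else 0)"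
    using t by (simp add: acts_cutoff)
  have eq: "?S o\<^sub>L ?S = ?I + (-1) *\<^sub>C ?L + ?R"
    by (rule acts_eqI[OF acts_compose[OF acts_sqrt_complement acts_sqrt_complement]
          acts_add[OF acts_add[OF acts_compose[OF acts_compose[OF c acts_id] c]
              acts_scaleC[OF acts_compose[OF acts_compose[OF c Lambda_id_real_multiplier] c]]]
            acts_compose[OF acts_compose[OF acts_sqrt_complement
                acts_compose[OF acts_compose[OF D acts_id] D]] acts_sqrt_complement]]])
      (auto simp: scaleC_complex_def algebra_simps scaleR_conv_of_real simp flip: of_real_mult)
  have mem: "?I \<in> null_boundary_algebra" "?L \<in> null_boundary_algebra" "?R \<in> null_boundary_algebra"
    "(-1) *\<^sub>C ?L \<in> null_boundary_algebra"
    using csubspace_null_boundary_algebra[where ?'a = complex]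
    by (auto simp: csubspace_def intro!: cutoff_null_boundary_algebra t bounded_ops_id Lambda_id_bounded_ops
        null_boundary_algebraI bounded_ops_compose acts_real_multiplier(1)[OF D])
  have pos: "positive_op ?R"
    by (intro positive_op_sandwich acts_real_multiplier(2)[OF D] positive_op_id
        acts_real_multiplier(2)[OF acts_sqrt_complement])
  have "1 = \<nu> (?S o\<^sub>L ?S)"
    using nw by (simp add: normalized_weight_def sqrt_complement_square)
  also have "\<dots> = truncated_weight \<nu> t id_blinfun - truncated_weight \<nu> t (Lambda id) + \<nu> ?R"
    unfolding eq truncated_weight_def using mem csubspace_null_boundary_algebra[where ?'a = complex]
    by (simp add: clinear_on_add[OF lin] clinear_on_scaleC[OF lin] csubspace_def scaleC_complex_def)
  finally have "1 = Re (truncated_weight \<nu> t id_blinfun) - mass \<nu> t + Re (\<nu> ?R)"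
    by (simp add: mass_def complex_eq_iff)
  moreover have "0 \<le> Re (\<nu> ?R)"
    using pw mem(3) pos by (auto simp: positive_weight_def complex_nonneg_Reals_iff)
  ultimately show ?thesis by simp
qed

text \<open>
  If $a_t \le C$ for all $t$, then $|\nu_t(A)| \le \nu_t(1)\|A\| \le (1 + C)\|A\|$. For $A$ in the
  null boundary algebra $\nu_t(A) \to \nu(A)$ as $t \to 0$, so $\nu$ would be bounded.
\<close>

lemma mass_unbounded:
  assumes nw: "normalized_weight \<nu>" and uw: "unbounded_weight \<nu>"
  shows "\<exists>t>0. C < mass \<nu> t"
proof (rule ccontr)
  assume "\<not> ?thesis"
  then have C: "\<And>t. 0 < t \<Longrightarrow> mass \<nu> t \<le> C" by force
  have C0: "0 \<le> C" using C[of 1] truncated_weight_Lambda(2)[of 1] by simp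
  have "cmod (\<nu> A) \<le> (1 + C) * norm A" if A: "A \<in> null_boundary_algebra" for A
  proof -
    obtain B where AB: "A = sqrt_complement o\<^sub>L B o\<^sub>L sqrt_complement" and B: "B \<in> bounded_ops"
      using A by (auto simp: null_boundary_algebra_def)
    define s where "s n = inverse (real (Suc n))" for n
    have s: "0 < s n" for n by (simp add: s_def)
    have "sqrt_complement (cutoff (s n) f) = cutoff (s n) (sqrt_complement f)" for n and f :: "complex L2"
    proof -
      have "sqrt_complement o\<^sub>L cutoff (s n) = cutoff (s n) o\<^sub>L (sqrt_complement :: complex L2 \<Rightarrow>\<^sub>L complex L2)"
        by (rule acts_eqI[OF acts_compose[OF acts_sqrt_complement acts_cutoff]
              acts_compose[OF acts_cutoff acts_sqrt_complement]]) (use s[of n] in auto)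
      from arg_cong[OF this, of "\<lambda>B. blinfun_apply B f"] show ?thesis by simp
    qed
    then have "truncated_weight \<nu> (s n) A
        = \<nu> (sqrt_complement o\<^sub>L (cutoff (s n) o\<^sub>L B o\<^sub>L cutoff (s n)) o\<^sub>L sqrt_complement)" for n
      unfolding truncated_weight_def AB
      by (intro arg_cong[where f = \<nu>] blinfun_eqI) simp
    moreover have "(\<lambda>n. \<nu> (sqrt_complement o\<^sub>L (cutoff (s n) o\<^sub>L B o\<^sub>L cutoff (s n)) o\<^sub>L sqrt_complement)) \<longlonglongrightarrow> \<nu> A"
      unfolding AB
    proof (rule normal_functional_cutoff_tendsto[OF _ B])
      show "normal_functional (\<lambda>B. \<nu> (sqrt_complement o\<^sub>L B o\<^sub>L sqrt_complement))"
        using bw by (simp add: boundary_weight_def)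
      show "s \<longlonglongrightarrow> 0" unfolding s_def by (rule LIMSEQ_inverse_real_of_nat)
    qed (use s in \<open>auto intro: less_imp_le\<close>)
    ultimately have "(\<lambda>n. truncated_weight \<nu> (s n) A) \<longlonglongrightarrow> \<nu> A" by simp
    then have lim: "(\<lambda>n. cmod (truncated_weight \<nu> (s n) A)) \<longlonglongrightarrow> cmod (\<nu> A)" by (rule tendsto_norm)
    have "cmod (truncated_weight \<nu> (s n) A) \<le> (1 + C) * norm A" for n
    proof -
      have "cmod (truncated_weight \<nu> (s n) A) \<le> Re (truncated_weight \<nu> (s n) id_blinfun) * norm A"
        using A null_boundary_algebra_subset
        by (intro positive_functional_bound positive_truncated_weight normal_truncated_weight s) auto
      also have "\<dots> \<le> (1 + C) * norm A"
        using truncated_weight_id_le[OF nw s, of n] C[OF s, of n] by (intro mult_right_mono) auto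
      finally show ?thesis .
    qed
    then show ?thesis by (intro LIMSEQ_le_const2[OF lim]) blast
  qed
  then show False using uw C0 unfolding unbounded_weight_def
    by (metis add_pos_nonneg zero_less_one)
qed

end



section \<open>Positive block matrices\<close>

lemma positive_blockD:
  "positive_block m A \<Longrightarrow> (\<Sum>i<m. \<Sum>j<m. cinner (h i) (A i j (h j))) \<in> \<real>\<^sub>\<ge>\<^sub>0"
  by (simp add: positive_block_def)

text \<open>
  Integrate the pointwise positivity. The real and the imaginary part are treated apart because the
  inner product of \<open>L2\<close> as a real space is the integral of the pointwise one.
\<close>

lemma acts_positive_block:
  fixes W :: "nat \<Rightarrow> nat \<Rightarrow> 'a::{complex_inner, second_countable_topology} L2 \<Rightarrow>\<^sub>L 'a L2"
  assumes W: "\<And>i j. acts (W i j) (T i j)"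
    and T: "\<And>x. 0 < x \<Longrightarrow> positive_block m (\<lambda>i j. T i j x)"
  shows "positive_block m (\<lambda>i j. blinfun_apply (W i j))"
  unfolding positive_block_def
proof
  fix h :: "nat \<Rightarrow> 'a L2"
  define z where "z = (\<Sum>i<m. \<Sum>j<m. cinner (h i) (W i j (h j)))"
  define p where "p x = (\<Sum>i<m. \<Sum>j<m. cinner (rep_L2 (h i) x) (T i j x (rep_L2 (h j) x)))" for x
  have p: "p x \<in> \<real>\<^sub>\<ge>\<^sub>0" if "0 < x" for x
    unfolding p_def by (rule positive_blockD[OF T[OF that], of "\<lambda>i. rep_L2 (h i) x"])
  have W': "AE x in half_line. \<forall>i j. rep_L2 (W i j (h j)) x = T i j x (rep_L2 (h j) x)"
    by (simp add: AE_all_countable actsD[OF W])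
  have i: "AE x in half_line. \<forall>i. rep_L2 (\<i> *\<^sub>C h i) x = \<i> *\<^sub>C rep_L2 (h i) x"
    by (simp add: AE_all_countable rep_scaleC_AE)
  have sum: "(\<Sum>i<m. \<Sum>j<m. u i \<bullet> v i j) = (\<integral>x. (\<Sum>i<m. \<Sum>j<m. rep_L2 (u i) x \<bullet> rep_L2 (v i j) x) \<partial>half_line)"
    for u :: "nat \<Rightarrow> 'a L2" and v :: "nat \<Rightarrow> nat \<Rightarrow> 'a L2"
    by (simp add: inner_L2_rep Bochner_Integration.integral_sum Bochner_Integration.integrable_sum
        integrable_inner square_integrable_rep)
  have "Re z = (\<Sum>i<m. \<Sum>j<m. h i \<bullet> W i j (h j))"
    by (simp add: z_def cinner_def)
  also have "\<dots> \<ge> 0"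
    unfolding sum
  proof (rule integral_nonneg_AE)
    show "AE x in half_line. 0 \<le> (\<Sum>i<m. \<Sum>j<m. rep_L2 (h i) x \<bullet> rep_L2 (W i j (h j)) x)"
      using W' AE_half_line_pos
      by eventually_elim (use p in \<open>simp add: p_def cinner_def complex_nonneg_Reals_iff\<close>)
  qed
  finally have "0 \<le> Re z" .
  moreover have "Im z = 0"
  proof -
    have "Im z = (\<Sum>i<m. \<Sum>j<m. (\<i> *\<^sub>C h i) \<bullet> W i j (h j))"
      by (simp add: z_def cinner_def)
    also have "\<dots> = 0"
      unfolding sum
    proof (rule integral_eq_zero_AE)
      show "AE x in half_line. (\<Sum>i<m. \<Sum>j<m. rep_L2 (\<i> *\<^sub>C h i) x \<bullet> rep_L2 (W i j (h j)) x) = 0"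
        using W' i AE_half_line_pos
        by eventually_elim (use p in \<open>simp add: p_def cinner_def complex_nonneg_Reals_iff\<close>)
    qed
    finally show ?thesis .
  qed
  ultimately show "z \<in> \<real>\<^sub>\<ge>\<^sub>0" by (simp add: complex_nonneg_Reals_iff)
qed

lemma Lambda_matrix_acts: "acts (Lambda ((*v) B)) (\<lambda>x v. exp (- x) *\<^sub>R (B *v v))"
  for B :: "'n::finite cmat"
  by (rule acts_Lambda) (rule matrix_vector_mul_bounded_linear)

lemma clinear_matrix_vector: "clinear ((*v) (B :: 'n::finite cmat))"
  by (simp add: clinear_def vec_eq_iff matrix_vector_mult_def scaleC_vec_nth scaleC_complex_def
      sum_distrib_left sum.distrib algebra_simps)

lemma Lambda_matrix_bounded_ops: "Lambda ((*v) B) \<in> bounded_ops" for B :: "'n::finite cmat"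
  by (rule bounded_opsI, rule acts_apply_scaleC[OF Lambda_matrix_acts])
    (simp add: clinear_scaleC[OF clinear_matrix_vector] scaleC_scaleR_commute)

lemma positive_block_scaleR:
  assumes "positive_block m A" "0 \<le> r"
  shows "positive_block m (\<lambda>i j v. r *\<^sub>R A i j v)"
  unfolding positive_block_def
proof
  fix h
  have "(\<Sum>i<m. \<Sum>j<m. cinner (h i) (r *\<^sub>R A i j (h j)))
      = of_real r * (\<Sum>i<m. \<Sum>j<m. cinner (h i) (A i j (h j)))"
    by (simp add: cinner_scaleR sum_distrib_left)
  also have "\<dots> \<in> \<real>\<^sub>\<ge>\<^sub>0"
    using assms(2) by (intro nonneg_Reals_mult_I positive_blockD[OF assms(1)]) simp
  finally show "(\<Sum>i<m. \<Sum>j<m. cinner (h i) (r *\<^sub>R A i j (h j))) \<in> \<real>\<^sub>\<ge>\<^sub>0" .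
qed

lemma positive_block_add:
  assumes "positive_block m A" "positive_block m B"
  shows "positive_block m (\<lambda>i j v. A i j v + B i j v)"
  unfolding positive_block_def
  by (simp add: cinner_add_right sum.distrib nonneg_Reals_add_I positive_blockD[OF assms(1)]
      positive_blockD[OF assms(2)])

lemma positive_block_cong:
  "(\<And>i j v. i < m \<Longrightarrow> j < m \<Longrightarrow> A i j v = B i j v) \<Longrightarrow> positive_block m A \<longleftrightarrow> positive_block m B"
  by (simp add: positive_block_def)

section \<open>Norm bounds for completely positive maps\<close>

text \<open>
  The matrix with rows $(K, A)$ and $(A^*, K)$ is positive when $\|A\| \le K$, hence so is its image
  under $\psi$, whose diagonal entries are the scalar $r$. Evaluating at the pair $(u, zv)$ of unit
  vectors with $|z| = 1$ gives $|\langle u, \psi(A) v\rangle| \le r$. Here \<open>J\<close> is the element of the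
  domain that acts as the scalar \<open>K\<close>.
\<close>

lemma completely_positive_adjoint_bound:
  assumes cp: "completely_positive D act act' \<psi>"
    and D: "A \<in> D" "A' \<in> D" "J \<in> D" and K: "0 \<le> K"
    and adj: "\<And>f g. cinner (act A f) g = cinner f (act A' g)"
    and bound: "\<And>f. norm (act A f) \<le> K * norm f"
    and J: "\<And>f. act J f = K *\<^sub>R f" and \<psi>J: "\<And>v. act' (\<psi> J) v = r *\<^sub>R v"
    and lin: "\<And>X. clinear (act' X)"
  shows "cmod (cinner x (act' (\<psi> A) y)) \<le> r * (norm x * norm y)"
proof (cases "x = 0 \<or> y = 0")
  case True
  then show ?thesis by (auto simp: clinear_zero[OF lin])
next
  case False
  then have x: "norm x > 0" and y: "norm y > 0" by auto
  define u where "u = inverse (norm x) *\<^sub>R x"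
  define v where "v = inverse (norm y) *\<^sub>R y"
  have uv: "norm u = 1" "norm v = 1" using x y by (simp_all add: u_def v_def)
  define B where "B i j = (if i = j then J else if i = 0 then A else A')" for i j :: nat
  have two_by_two: "(\<Sum>i<2. \<Sum>j<2. F i j) = F 0 0 + F 0 1 + F 1 0 + F 1 1" for F :: "nat \<Rightarrow> nat \<Rightarrow> complex"
    by (simp add: numeral_2_eq_2)
  have "positive_block 2 (\<lambda>i j. act (B i j))"
    unfolding positive_block_def two_by_two
  proof
    fix h
    have "cinner (h 1) (act A' (h 0)) = cnj (cinner (h 0) (act A (h 1)))"
      using adj[of "h 1" "h 0"] cinner_commute[of "h 0" "act A (h 1)"] by simp
    then have "cinner (h 0) (act (B 0 0) (h 0)) + cinner (h 0) (act (B 0 1) (h 1))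
        + cinner (h 1) (act (B 1 0) (h 0)) + cinner (h 1) (act (B 1 1) (h 1))
        = of_real (K * (norm (h 0))\<^sup>2 + K * (norm (h 1))\<^sup>2)
          + (cinner (h 0) (act A (h 1)) + cnj (cinner (h 0) (act A (h 1))))"
      by (simp add: B_def J cinner_scaleR cinner_self)
    also have "\<dots> = of_real (K * (norm (h 0))\<^sup>2 + K * (norm (h 1))\<^sup>2
          + 2 * Re (cinner (h 0) (act A (h 1))))"
      by (simp add: complex_add_cnj)
    also have "\<dots> \<in> \<real>\<^sub>\<ge>\<^sub>0"
    proof -
      have "cmod (cinner (h 0) (act A (h 1))) \<le> norm (h 0) * (K * norm (h 1))"
        by (rule order_trans[OF cmod_cinner_le mult_left_mono[OF bound]]) simp
      moreover have "0 \<le> K * (norm (h 0) - norm (h 1))\<^sup>2" using K by simp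
      ultimately have "0 \<le> K * (norm (h 0))\<^sup>2 + K * (norm (h 1))\<^sup>2
          + 2 * Re (cinner (h 0) (act A (h 1)))"
        using abs_Re_le_cmod[of "cinner (h 0) (act A (h 1))"]
        by (simp add: power2_eq_square algebra_simps)
      then show ?thesis by (simp only: nonneg_Reals_of_real_iff)
    qed
    finally show "cinner (h 0) (act (B 0 0) (h 0)) + cinner (h 0) (act (B 0 1) (h 1))
        + cinner (h 1) (act (B 1 0) (h 0)) + cinner (h 1) (act (B 1 1) (h 1)) \<in> \<real>\<^sub>\<ge>\<^sub>0" .
  qed
  moreover have "\<forall>i<2. \<forall>j<2. B i j \<in> D" using D by (simp add: B_def)
  ultimately have pos: "positive_block 2 (\<lambda>i j. act' (\<psi> (B i j)))"
    using cp unfolding completely_positive_def by blast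
  have "2 * cmod (cinner u (act' (\<psi> A) v)) \<le> 2 * r"
  proof (rule phase_bound)
    fix z :: complex assume z: "cmod z = 1"
    have zz: "z * cnj z = 1" using z by (simp flip: complex_norm_square)
    have "of_real (2 * r) + z * cinner u (act' (\<psi> A) v) + cnj z * cinner v (act' (\<psi> A') u)
        = (\<Sum>i<2. \<Sum>j<2. cinner ((if i = 0 then u else z *\<^sub>C v)) (act' (\<psi> (B i j)) ((if j = 0 then u else z *\<^sub>C v))))"
      unfolding two_by_two
      by (simp add: B_def \<psi>J cinner_scaleR clinear_scaleC[OF lin] cinner_scaleC_left
          cinner_scaleC_right cinner_self norm_scaleC z zz uv)
    also have "\<dots> \<in> \<real>\<^sub>\<ge>\<^sub>0"
      using positive_blockD[OF pos, of "\<lambda>i. if i = 0 then u else z *\<^sub>C v"] .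
    finally show "of_real (2 * r) + z * cinner u (act' (\<psi> A) v) + cnj z * cinner v (act' (\<psi> A') u)
        \<in> \<real>\<^sub>\<ge>\<^sub>0" .
  qed
  then have *: "cmod (cinner u (act' (\<psi> A) v)) \<le> r" by simp
  have "x = norm x *\<^sub>R u" "y = norm y *\<^sub>R v" using x y by (simp_all add: u_def v_def)
  then have "cinner x (act' (\<psi> A) y) = cinner (norm x *\<^sub>R u) (act' (\<psi> A) (norm y *\<^sub>R v))" by simp
  also have "\<dots> = of_real (norm x * norm y) * cinner u (act' (\<psi> A) v)"
    by (simp add: clinear_scaleR[OF lin] cinner_scaleR)
  finally have "cmod (cinner x (act' (\<psi> A) y)) = norm x * norm y * cmod (cinner u (act' (\<psi> A) v))"
    by (simp add: norm_mult)
  then show ?thesis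
    using mult_left_mono[OF *, of "norm x * norm y"] by (simp add: mult_ac)
qed

lemma onorm_le_of_cinner_le:
  fixes T :: "'a::complex_inner \<Rightarrow> 'b::complex_inner"
  assumes "\<And>x y. cmod (cinner x (T y)) \<le> K * (norm x * norm y)" "0 \<le> K"
  shows "onorm T \<le> K"
proof (rule onorm_bound[OF assms(2)])
  fix y
  have "norm (T y) * norm (T y) \<le> (K * norm y) * norm (T y)"
    using assms(1)[of "T y" y] by (simp add: cinner_self norm_mult power2_eq_square mult_ac flip: of_real_mult)
  then show "norm (T y) \<le> K * norm y"
    using assms(2) by (cases "norm (T y) = 0") auto
qed

lemma matrix_adjoint:
  fixes X :: "'n::finite cmat"
  shows "cinner (X *v f) g = cinner f ((\<chi> i j. cnj (X $ j $ i)) *v g)"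
proof -
  have "cinner (X *v f) g = (\<Sum>i\<in>UNIV. \<Sum>j\<in>UNIV. cnj (X $ i $ j) * cnj (f $ j) * g $ i)"
    by (simp add: cinner_vec cinner_complex matrix_vector_mult_def sum_distrib_right)
  also have "\<dots> = (\<Sum>j\<in>UNIV. \<Sum>i\<in>UNIV. cnj (X $ i $ j) * cnj (f $ j) * g $ i)"
    by (rule sum.swap)
  also have "\<dots> = cinner f ((\<chi> i j. cnj (X $ j $ i)) *v g)"
    by (simp add: cinner_matrix_vector mult_ac)
  finally show ?thesis .
qed

lemma scaleR_matrix_vector: "(r *\<^sub>R X) *v v = r *\<^sub>R (X *v (v :: complex ^ 'n::finite))"
  by (simp add: vec_eq_iff matrix_vector_mult_def scaleR_sum_right)

lemma onorm_scaleR_matrix: "onorm ((*v) (r *\<^sub>R X)) = \<bar>r\<bar> * onorm ((*v) (X :: 'n::finite cmat))"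
proof -
  have "(*v) (r *\<^sub>R X) = (\<lambda>v. r *\<^sub>R (X *v v))" by (rule ext) (rule scaleR_matrix_vector)
  then show ?thesis by (simp add: onorm_scaleR[OF matrix_vector_mul_bounded_linear])
qed

lemma scaleR_mat_vector: "(r *\<^sub>R mat 1) *v v = r *\<^sub>R (v :: complex ^ 'n::finite)"
  by (simp add: scaleR_matrix_vector)

text \<open>
  The adjoint of $X$ is its conjugate transpose, and $\psi$ maps the scalar $\|X\|$ to the scalar
  $c\|X\|$.
\<close>

lemma cp_matrix_onorm_le:
  fixes \<psi> :: "'n::finite cmat \<Rightarrow> 'n cmat"
  assumes cp: "completely_positive UNIV (*v) (*v) \<psi>" and c: "\<psi> (mat 1) = c *\<^sub>R mat 1" "0 \<le> c"
  shows "onorm ((*v) (\<psi> X)) \<le> c * onorm ((*v) X)"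
proof (rule onorm_le_of_cinner_le)
  let ?K = "onorm ((*v) X)"
  have bl: "bounded_linear ((*v) X)" by (rule matrix_vector_mul_bounded_linear)
  have K: "0 \<le> ?K" by (rule onorm_pos_le[OF bl])
  have lin: "clinear \<psi>" using cp by (simp add: completely_positive_def clinear_on_UNIV)
  show "cmod (cinner x (\<psi> X *v y)) \<le> c * ?K * (norm x * norm y)" for x y
  proof (rule completely_positive_adjoint_bound[OF cp,
        of X "\<chi> i j. cnj (X $ j $ i)" "?K *\<^sub>R mat 1" ?K "c * ?K" x y])
    show "cinner (X *v f) g = cinner f ((\<chi> i j. cnj (X $ j $ i)) *v g)" for f g
      by (rule matrix_adjoint)
    show "norm (X *v f) \<le> ?K * norm f" for f by (rule onorm[OF bl])
    show "(?K *\<^sub>R mat 1) *v f = ?K *\<^sub>R f" for f :: "complex ^ 'n" by (rule scaleR_mat_vector)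
    show "\<psi> (?K *\<^sub>R mat 1) *v v = (c * ?K) *\<^sub>R v" for v
      by (simp add: clinear_scaleR[OF lin] c scaleR_mat_vector mult.commute)
    show "clinear ((*v) Y)" for Y :: "'n cmat" by (rule clinear_matrix_vector)
  qed (simp_all add: K)
  show "0 \<le> c * ?K" using c K by simp
qed

section \<open>Resolvents\<close>

definition resolvent :: "('n::finite cmat \<Rightarrow> 'n cmat) \<Rightarrow> real \<Rightarrow> 'n cmat \<Rightarrow> 'n cmat" where
  "resolvent \<phi> s = inv (\<lambda>X. X + s *\<^sub>R \<phi> X)"

text \<open>
  The iterates, starting at $0$, of the fixed point equation
  $Y = \psi_s(X) + (s - r)\,\psi_s(Y)$, where $\psi_s(X) = \phi((I + s\phi)^{-1}X)$. Its solution is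
  $\psi_r(X)$ by \<open>resolvent_identity\<close>.
\<close>

primrec resolvent_approx ::
  "('n::finite cmat \<Rightarrow> 'n cmat) \<Rightarrow> real \<Rightarrow> real \<Rightarrow> nat \<Rightarrow> 'n cmat \<Rightarrow> 'n cmat" where
  "resolvent_approx \<phi> r s 0 X = 0"
| "resolvent_approx \<phi> r s (Suc k) X
    = \<phi> (resolvent \<phi> s X) + (s - r) *\<^sub>R \<phi> (resolvent \<phi> s (resolvent_approx \<phi> r s k X))"

lemma clinear_shifted:
  assumes "clinear \<phi>"
  shows "clinear (\<lambda>X. X + s *\<^sub>R \<phi> X)"
  by (simp add: clinear_def clinear_add[OF assms] clinear_scaleC[OF assms] scaleR_add_right
      scaleC_add_right scaleC_scaleR_commute)

context
  fixes \<phi> :: "'n::finite cmat \<Rightarrow> 'n cmat"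
  assumes lin: "clinear \<phi>" and nn: "no_negative_eigenvalues \<phi>"
begin

lemma bij_shifted:
  assumes "0 \<le> s"
  shows "bij (\<lambda>X. X + s *\<^sub>R \<phi> X)"
proof -
  let ?R = "\<lambda>X. X + s *\<^sub>R \<phi> X"
  have l: "linear ?R" by (rule clinear_linear[OF clinear_shifted[OF lin]])
  have "X = 0" if "X + s *\<^sub>R \<phi> X = 0" for X
  proof (rule ccontr)
    \<comment> \<open>A kernel vector would be an eigenvector of $\phi$ for the eigenvalue $-1/s$.\<close>
    assume X: "X \<noteq> 0"
    then have s: "0 < s" using assms that by (cases "s = 0") auto
    have "s *\<^sub>R \<phi> X = - X" using that by (simp add: add_eq_0_iff)
    then have "(1 / s) *\<^sub>R s *\<^sub>R \<phi> X = (- 1 / s) *\<^sub>R X" by simp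
    then have "\<phi> X = (- 1 / s) *\<^sub>R X" using s by simp
    moreover have "- 1 / s < 0" using s by simp
    ultimately show False using nn X unfolding no_negative_eigenvalues_def by blast
  qed
  then have inj: "inj ?R" unfolding linear_injective_0[OF l] by blast
  then show ?thesis using linear_injective_imp_surjective[OF l] by (simp add: bij_def)
qed

lemma shifted_resolvent: "0 \<le> s \<Longrightarrow> resolvent \<phi> s X + s *\<^sub>R \<phi> (resolvent \<phi> s X) = X"
  unfolding resolvent_def by (rule surj_f_inv_f[OF bij_is_surj[OF bij_shifted]])

lemma resolvent_shifted: "0 \<le> s \<Longrightarrow> resolvent \<phi> s (X + s *\<^sub>R \<phi> X) = X"
  unfolding resolvent_def by (rule inv_f_f[OF bij_is_inj[OF bij_shifted]])

lemma resolvent_eqI: "0 \<le> s \<Longrightarrow> Y + s *\<^sub>R \<phi> Y = X \<Longrightarrow> resolvent \<phi> s X = Y"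
  using resolvent_shifted by blast

lemma clinear_resolvent:
  assumes s: "0 \<le> s"
  shows "clinear (resolvent \<phi> s)"
  unfolding clinear_def
proof (intro conjI allI; rule resolvent_eqI[OF s])
  fix X Y c
  let ?r = "resolvent \<phi> s"
  show "?r X + ?r Y + s *\<^sub>R \<phi> (?r X + ?r Y) = X + Y"
    using clinear_add[OF clinear_shifted[OF lin, of s], of "?r X" "?r Y"] by (simp add: shifted_resolvent[OF s])
  show "c *\<^sub>C ?r X + s *\<^sub>R \<phi> (c *\<^sub>C ?r X) = c *\<^sub>C X"
    using clinear_scaleC[OF clinear_shifted[OF lin, of s], of c "?r X"] by (simp add: shifted_resolvent[OF s])
qed

lemma resolvent_commute:
  assumes s: "0 \<le> s"
  shows "resolvent \<phi> s (\<phi> X) = \<phi> (resolvent \<phi> s X)"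
  by (rule resolvent_eqI[OF s])
    (metis clinear_add[OF lin] clinear_scaleR[OF lin] shifted_resolvent[OF s])

lemma clinear_phi_resolvent: "0 \<le> s \<Longrightarrow> clinear (\<lambda>X. \<phi> (resolvent \<phi> s X))"
  by (intro clinear_compose[OF lin] clinear_resolvent)

lemma phi_resolvent_unit:
  assumes s: "0 \<le> s" and unit: "\<phi> (mat 1) = mat 1"
  shows "\<phi> (resolvent \<phi> s (mat 1)) = (1 / (1 + s)) *\<^sub>R mat 1"
proof -
  have "resolvent \<phi> s (mat 1) = (1 / (1 + s)) *\<^sub>R mat 1"
  proof (rule resolvent_eqI[OF s])
    have "1 / (1 + s) + s / (1 + s) = 1" using s by (simp flip: add_divide_distrib)
    then show "(1 / (1 + s)) *\<^sub>R mat 1 + s *\<^sub>R \<phi> ((1 / (1 + s)) *\<^sub>R mat 1) = mat 1"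
      by (simp add: clinear_scaleR[OF lin] unit flip: scaleR_add_left)
  qed
  then show ?thesis by (simp add: clinear_scaleR[OF lin] unit)
qed

lemma resolvent_identity:
  assumes r: "0 \<le> r" and s: "0 \<le> s"
  shows "\<phi> (resolvent \<phi> r X)
    = \<phi> (resolvent \<phi> s X) + (s - r) *\<^sub>R \<phi> (resolvent \<phi> s (\<phi> (resolvent \<phi> r X)))"
proof -
  define Z where "Z = resolvent \<phi> r X"
  have X: "X = Z + r *\<^sub>R \<phi> Z" by (simp add: Z_def shifted_resolvent[OF r])
  have "X + (s - r) *\<^sub>R \<phi> Z = Z + s *\<^sub>R \<phi> Z"
    by (simp add: X scaleR_diff_left)
  then have "\<phi> (resolvent \<phi> s (X + (s - r) *\<^sub>R \<phi> Z)) = \<phi> Z"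
    by (simp add: resolvent_shifted[OF s])
  then show ?thesis
    by (simp add: clinear_add[OF clinear_phi_resolvent[OF s]]
        clinear_scaleR[OF clinear_phi_resolvent[OF s]] flip: Z_def)
qed

text \<open>
  For $r \le s$ each iterate is a sum of powers of $\psi_s$ with nonnegative coefficients, hence
  completely positive in $X$. Each step applies $(s - r)\,\psi_s$ to the error. Since $\psi_s$ sends the
  identity matrix to $1/(1 + s)$ times itself, \<open>cp_matrix_onorm_le\<close> shows that the norm of the
  error shrinks by the factor $q = (s - r)/(1 + s) < 1$, so the iterates converge to $\psi_r(X)$.
\<close>

lemma resolvent_cp_mono:
  assumes unit: "\<phi> (mat 1) = mat 1" and r: "0 \<le> r" "r \<le> s"
    and cp: "completely_positive UNIV (*v) (*v) (\<lambda>X. \<phi> (resolvent \<phi> s X))"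
  shows "completely_positive UNIV (*v) (*v) (\<lambda>X. \<phi> (resolvent \<phi> r X))"
  unfolding completely_positive_def clinear_on_UNIV
proof (intro conjI allI impI)
  have s: "0 \<le> s" using r by simp
  define \<psi> where "\<psi> = (\<lambda>X. \<phi> (resolvent \<phi> s X))"
  note \<psi>lin = clinear_phi_resolvent[OF s, folded \<psi>_def]
  let ?y = "\<lambda>X. \<phi> (resolvent \<phi> r X)"
  show "clinear ?y" by (rule clinear_phi_resolvent[OF r(1)])
  define q where "q = (s - r) / (1 + s)"
  have q: "0 \<le> q" "q < 1" using r by (simp_all add: q_def)
  have err: "onorm ((*v) (?y X - resolvent_approx \<phi> r s k X)) \<le> q ^ k * onorm ((*v) (?y X))" for k X
  proof (induction k)
    case (Suc k)
    let ?e = "?y X - resolvent_approx \<phi> r s k X"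
    \<comment> \<open>The error after a step is $(s - r)\,\psi_s$ of the error before it.\<close>
    have "\<psi> ?e = \<psi> (?y X) - \<psi> (resolvent_approx \<phi> r s k X)"
      by (rule linear_diff[OF clinear_linear[OF \<psi>lin]])
    moreover have "?y X - \<psi> X = (s - r) *\<^sub>R \<psi> (?y X)"
      unfolding \<psi>_def by (subst resolvent_identity[OF r(1) s, of X]) simp
    ultimately have "?y X - resolvent_approx \<phi> r s (Suc k) X = (s - r) *\<^sub>R \<psi> ?e"
      by (simp add: \<psi>_def scaleR_diff_right)
    then have "onorm ((*v) (?y X - resolvent_approx \<phi> r s (Suc k) X)) = (s - r) * onorm ((*v) (\<psi> ?e))"
      using r by (simp only: onorm_scaleR_matrix)
    also have "\<dots> \<le> (s - r) * (1 / (1 + s) * onorm ((*v) ?e))"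
      using r s by (intro mult_left_mono cp_matrix_onorm_le cp[folded \<psi>_def])
        (simp_all add: \<psi>_def phi_resolvent_unit[OF s unit])
    also have "\<dots> = q * onorm ((*v) ?e)" by (simp add: q_def)
    also have "\<dots> \<le> q * (q ^ k * onorm ((*v) (?y X)))"
      by (rule mult_left_mono[OF Suc q(1)])
    finally show ?case by simp
  qed simp
  have lim: "(\<lambda>k. cinner h (resolvent_approx \<phi> r s k X *v g)) \<longlonglongrightarrow> cinner h (?y X *v g)" for h g X
  proof (rule LIM_zero_cancel, rule Lim_null_comparison)
    have "norm (cinner h (resolvent_approx \<phi> r s k X *v g) - cinner h (?y X *v g))
        \<le> q ^ k * (norm h * onorm ((*v) (?y X)) * norm g)" for k
    proof -
      let ?e = "?y X - resolvent_approx \<phi> r s k X"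
      have "norm (cinner h (resolvent_approx \<phi> r s k X *v g) - cinner h (?y X *v g))
          = norm (cinner h (?e *v g))"
        by (simp add: matrix_vector_mult_diff_rdistrib cinner_diff norm_minus_commute)
      also have "\<dots> \<le> norm h * (onorm ((*v) ?e) * norm g)"
        by (rule order_trans[OF cmod_cinner_le mult_left_mono[OF onorm[OF matrix_vector_mul_bounded_linear]]]) simp
      also have "\<dots> \<le> norm h * (q ^ k * onorm ((*v) (?y X)) * norm g)"
        by (intro mult_left_mono mult_right_mono err) auto
      finally show ?thesis by (simp add: mult_ac)
    qed
    then show "\<forall>\<^sub>F k in sequentially. norm (cinner h (resolvent_approx \<phi> r s k X *v g) - cinner h (?y X *v g))
        \<le> q ^ k * (norm h * onorm ((*v) (?y X)) * norm g)" by simp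
    show "(\<lambda>k. q ^ k * (norm h * onorm ((*v) (?y X)) * norm g)) \<longlonglongrightarrow> 0"
      using q by (intro tendsto_mult_left_zero LIMSEQ_realpow_zero)
  qed
  fix m and B :: "nat \<Rightarrow> nat \<Rightarrow> 'n cmat"
  assume B: "positive_block m (\<lambda>i j. (*v) (B i j))"
  have \<psi>pos: "positive_block m (\<lambda>i j. (*v) (\<psi> (C i j)))" if "positive_block m (\<lambda>i j. (*v) (C i j))" for C
    using cp that by (simp add: completely_positive_def \<psi>_def)
  have approx: "positive_block m (\<lambda>i j. (*v) (resolvent_approx \<phi> r s k (B i j)))" for k
  proof (induction k)
    case 0
    show ?case by (simp add: positive_block_def)
  next
    case (Suc k)
    have "positive_block m (\<lambda>i j v. \<psi> (B i j) *v v + (s - r) *\<^sub>R (\<psi> (resolvent_approx \<phi> r s k (B i j)) *v v))"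
      using r by (intro positive_block_add positive_block_scaleR \<psi>pos B Suc) simp
    then show ?case
      by (simp add: \<psi>_def matrix_vector_mult_add_rdistrib scaleR_matrix_vector)
  qed
  show "positive_block m (\<lambda>i j. (*v) (?y (B i j)))"
    unfolding positive_block_def
  proof
    fix h
    show "(\<Sum>i<m. \<Sum>j<m. cinner (h i) (?y (B i j) *v h j)) \<in> \<real>\<^sub>\<ge>\<^sub>0"
      by (rule nonneg_Reals_tendsto[where F = sequentially and
            f = "\<lambda>k. \<Sum>i<m. \<Sum>j<m. cinner (h i) (resolvent_approx \<phi> r s k (B i j) *v h j)"])
        (auto intro!: tendsto_sum lim positive_blockD[OF approx])
  qed
qed

end



section \<open>The weight map and its boundary representation\<close>

text \<open>
  Conjugation by $\sqrt{I - \Lambda(I)}$ commutes with taking entries, so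
  $A \mapsto \omega(\rho)(\sqrt{I - \Lambda(I)}\,A\sqrt{I - \Lambda(I)})$ is a finite linear combination
  of the normal functional attached to $\nu$, evaluated at the entries of $A$.
\<close>

lemma boundary_weight_omega:
  fixes \<phi> :: "'n::finite cmat \<Rightarrow> 'n cmat"
  assumes \<phi>: "clinear \<phi>" and \<nu>: "boundary_weight \<nu>" and \<rho>: "clinear \<rho>"
  shows "boundary_weight (omega \<phi> \<nu> \<rho>)"
  unfolding boundary_weight_def
proof
  have "clinear_on null_boundary_algebra \<nu>" using \<nu> by (simp add: boundary_weight_def)
  then have "clinear_on null_boundary_algebra (Omega \<nu> :: 'n hilbert_ops \<Rightarrow> 'n cmat)"
    by (rule clinear_on_Omega) (rule entry_null_boundary_algebra)
  then show "clinear_on null_boundary_algebra (omega \<phi> \<nu> \<rho>)"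
    by (simp add: clinear_on_def omega_def clinear_add[OF \<phi>] clinear_scaleC[OF \<phi>]
        clinear_add[OF \<rho>] clinear_scaleC[OF \<rho>])
  let ?\<eta> = "\<lambda>B. \<nu> (sqrt_complement o\<^sub>L B o\<^sub>L sqrt_complement)"
  have "Omega \<nu> (sqrt_complement o\<^sub>L A o\<^sub>L sqrt_complement) = Omega ?\<eta> A" for A :: "'n hilbert_ops"
    by (simp add: Omega_def entry_sandwich[OF acts_sqrt_complement acts_sqrt_complement
        acts_sqrt_complement acts_sqrt_complement])
  moreover have "normal_functional ?\<eta>" using \<nu> by (simp add: boundary_weight_def)
  note normal_functional_Omega[OF clinear_compose[OF \<rho> \<phi>] this]
  ultimately show "normal_functional (\<lambda>A. omega \<phi> \<nu> \<rho> (sqrt_complement o\<^sub>L A o\<^sub>L sqrt_complement))"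
    by (simp add: omega_def)
qed

lemma cp_weight_map_omega:
  fixes \<phi> :: "'n::finite cmat \<Rightarrow> 'n cmat"
  assumes \<phi>: "completely_positive UNIV (*v) (*v) \<phi>"
    and \<nu>: "boundary_weight \<nu>" "positive_weight \<nu>"
  shows "cp_weight_map (omega \<phi> \<nu>)"
  unfolding cp_weight_map_def
proof (intro allI impI)
  fix m and \<rho> :: "nat \<Rightarrow> nat \<Rightarrow> 'n cmat \<Rightarrow> complex" and A :: "nat \<Rightarrow> nat \<Rightarrow> 'n hilbert_ops"
  assume \<rho>: "\<forall>B. positive_block m (\<lambda>i j. (*v) (B i j)) \<longrightarrow> (\<Sum>i<m. \<Sum>j<m. \<rho> i j (B i j)) \<in> \<real>\<^sub>\<ge>\<^sub>0"
    and A: "\<forall>i<m. \<forall>j<m. A i j \<in> null_boundary_algebra"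
    and pos: "positive_block m (\<lambda>i j. blinfun_apply (A i j))"
  have "positive_block m (\<lambda>i j. (*v) (Omega \<nu> (A i j)))"
    using A null_boundary_algebra_subset
    by (intro Omega_positive_block[OF csubspace_null_boundary_algebra
          positive_functional_weight[OF \<nu>] _ _ pos])
      (auto intro: entry_null_boundary_algebra)
  then have "positive_block m (\<lambda>i j. (*v) (\<phi> (Omega \<nu> (A i j))))"
    using \<phi> by (simp add: completely_positive_def)
  from \<rho>[rule_format, OF this]
  show "(\<Sum>i<m. \<Sum>j<m. omega \<phi> \<nu> (\<rho> i j) (A i j)) \<in> \<real>\<^sub>\<ge>\<^sub>0" by (simp add: omega_def)
qed

lemma completely_positiveD:
  assumes "completely_positive D act act' \<psi>" "\<And>i j. i < m \<Longrightarrow> j < m \<Longrightarrow> B i j \<in> D"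
    "positive_block m (\<lambda>i j. act (B i j))"
  shows "positive_block m (\<lambda>i j. act' (\<psi> (B i j)))"
  using assms unfolding completely_positive_def by blast

lemma completely_positive_compose:
  assumes \<psi>: "completely_positive D act act' \<psi>" and \<theta>: "completely_positive UNIV act' act'' \<theta>"
  shows "completely_positive D act act'' (\<lambda>A. \<theta> (\<psi> A))"
  unfolding completely_positive_def
proof (intro conjI allI impI)
  show "clinear_on D (\<lambda>A. \<theta> (\<psi> A))"
    using \<psi> \<theta> by (simp add: completely_positive_def clinear_on_def)
  show "positive_block m (\<lambda>i j. act'' (\<theta> (\<psi> (B i j))))"
    if "\<forall>i<m. \<forall>j<m. B i j \<in> D" "positive_block m (\<lambda>i j. act (B i j))" for m B
    using that by (intro completely_positiveD[OF \<theta>] completely_positiveD[OF \<psi>]) auto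
qed

lemma completely_positive_cong:
  assumes D: "csubspace D" and eq: "\<And>A. A \<in> D \<Longrightarrow> \<pi> A = \<pi>' A"
  shows "completely_positive D act act' \<pi> \<longleftrightarrow> completely_positive D act act' \<pi>'"
proof -
  have "clinear_on D \<pi> \<longleftrightarrow> clinear_on D \<pi>'"
    using D by (simp add: clinear_on_def csubspace_def eq)
  moreover have "positive_block m (\<lambda>i j. act' (\<pi> (B i j))) \<longleftrightarrow> positive_block m (\<lambda>i j. act' (\<pi>' (B i j)))"
    if "\<forall>i<m. \<forall>j<m. B i j \<in> D" for m B
    by (rule positive_block_cong) (use that eq in simp)
  ultimately show ?thesis unfolding completely_positive_def by (simp cong: imp_cong)
qed

lemma matrix_dual_separates:
  fixes X Y :: "'n::finite cmat"
  assumes "\<And>\<rho>. \<rho> \<in> matrix_dual \<Longrightarrow> \<rho> X = \<rho> Y"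
  shows "X = Y"
proof -
  have "(\<lambda>Z::'n cmat. Z $ i $ j) \<in> matrix_dual" for i j
    by (simp add: matrix_dual_def clinear_def scaleC_vec_nth)
  from assms[OF this] show ?thesis by (simp add: vec_eq_iff)
qed

abbreviation truncated_Omega ::
  "((complex L2 \<Rightarrow>\<^sub>L complex L2) \<Rightarrow> complex) \<Rightarrow> real \<Rightarrow> 'n::finite hilbert_ops \<Rightarrow> 'n cmat" where
  "truncated_Omega \<nu> t \<equiv> Omega (truncated_weight \<nu> t)"

context
  fixes \<nu> :: "(complex L2 \<Rightarrow>\<^sub>L complex L2) \<Rightarrow> complex"
  assumes bw: "boundary_weight \<nu>" and pw: "positive_weight \<nu>"
begin

lemma truncated_lin: "0 < t \<Longrightarrow> clinear_on bounded_ops (truncated_weight \<nu> t)"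
  using positive_truncated_weight[OF bw pw] by (simp add: positive_functional_def)

lemma truncated_Omega_Lambda:
  assumes t: "0 < t"
  shows "truncated_Omega \<nu> t (Lambda ((*v) A)) = mass \<nu> t *\<^sub>R A"
  using truncated_weight_Lambda(1)[OF bw pw t]
  by (simp add: vec_eq_iff Omega_def entry_Lambda clinear_on_scaleC[OF truncated_lin[OF t] Lambda_id_bounded_ops]
      scaleC_complex_def scaleR_conv_of_real[where 'a = complex])

lemma truncated_Omega_id:
  assumes t: "0 < t"
  shows "truncated_Omega \<nu> t (r *\<^sub>R id_blinfun :: 'n::finite hilbert_ops)
    = (r * Re (truncated_weight \<nu> t id_blinfun)) *\<^sub>R mat 1"
proof -
  have "truncated_weight \<nu> t (entry (r *\<^sub>R id_blinfun :: 'n hilbert_ops) i j)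
      = of_real r * (if i = j then of_real (Re (truncated_weight \<nu> t id_blinfun)) else 0)" for i j
  proof -
    have "truncated_weight \<nu> t (c *\<^sub>C 0) = c *\<^sub>C truncated_weight \<nu> t 0" for c
      by (rule clinear_on_scaleC[OF truncated_lin[OF t] bounded_ops_zero])
    from this[of 0] have 0: "truncated_weight \<nu> t 0 = 0" by simp
    show ?thesis
      using truncated_weight_id(1)[OF bw pw t]
      by (simp add: entry_scaleC entry_id clinear_on_scaleC[OF truncated_lin[OF t] bounded_ops_id] 0
          scaleC_complex_def flip: scaleC_of_real)
  qed
  then show ?thesis
    by (simp add: vec_eq_iff Omega_def mat_def scaleR_conv_of_real[where 'a = complex])
qed

lemma truncated_Omega_lin: "0 < t \<Longrightarrow> clinear_on bounded_ops (truncated_Omega \<nu> t)"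
  by (intro clinear_on_Omega[OF truncated_lin] entry_bounded_ops)

lemma truncated_Omega_cp:
  assumes t: "0 < t"
  shows "completely_positive bounded_ops blinfun_apply (*v) (truncated_Omega \<nu> t)"
  unfolding completely_positive_def
  using truncated_Omega_lin[OF t]
  by (auto intro!: Omega_positive_block[OF csubspace_bounded_ops positive_truncated_weight[OF bw pw t]]
      entry_bounded_ops)

end

text \<open>
  The map $\pi_t^\#$, see \<open>pi_hat_omega\<close>.
\<close>

definition generalized_rep ::
  "('n::finite cmat \<Rightarrow> 'n cmat) \<Rightarrow> ((complex L2 \<Rightarrow>\<^sub>L complex L2) \<Rightarrow> complex) \<Rightarrow> real \<Rightarrow>
    'n hilbert_ops \<Rightarrow> 'n cmat" where
  "generalized_rep \<phi> \<nu> t A = \<phi> (resolvent \<phi> (mass \<nu> t) (truncated_Omega \<nu> t A))"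

context
  fixes \<phi> :: "'n::finite cmat \<Rightarrow> 'n cmat" and \<nu> :: "(complex L2 \<Rightarrow>\<^sub>L complex L2) \<Rightarrow> complex"
  assumes lin: "clinear \<phi>" and nn: "no_negative_eigenvalues \<phi>"
    and bw: "boundary_weight \<nu>" and pw: "positive_weight \<nu>"
begin

lemma resolvent_map_omega:
  assumes t: "0 < t" and \<rho>: "\<rho> \<in> matrix_dual"
  shows "resolvent_map (omega \<phi> \<nu>) t \<rho> = (\<lambda>A. \<rho> (A + mass \<nu> t *\<^sub>R \<phi> A))"
  using \<rho> by (simp add: fun_eq_iff resolvent_map_def Lambda_hat_def truncated_omega[OF t]
      truncated_Omega_Lambda[OF bw pw t] clinear_scaleR[OF lin] clinear_add matrix_dual_def)

text \<open>
  The map is $\rho \mapsto \rho \circ (I + a_t\phi)$, with inverse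
  $\rho \mapsto \rho \circ (I + a_t\phi)^{-1}$.
\<close>

lemma resolvent_map_bij:
  assumes t: "0 < t"
  shows "bij_betw (resolvent_map (omega \<phi> \<nu>) t) matrix_dual matrix_dual"
    and "\<rho> \<in> matrix_dual \<Longrightarrow> inv_into matrix_dual (resolvent_map (omega \<phi> \<nu>) t) \<rho>
      = (\<lambda>A. \<rho> (resolvent \<phi> (mass \<nu> t) A))"
proof -
  let ?a = "mass \<nu> t" and ?M = "resolvent_map (omega \<phi> \<nu>) t"
  have a: "0 \<le> ?a" by (rule truncated_weight_Lambda(2)[OF bw pw t])
  let ?I = "\<lambda>\<rho> A. \<rho> (resolvent \<phi> ?a A)"
  have M: "?M \<rho> \<in> matrix_dual" if "\<rho> \<in> matrix_dual" for \<rho>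
    using that clinear_compose[OF _ clinear_shifted[OF lin]]
    by (simp add: resolvent_map_omega[OF t that] matrix_dual_def)
  have I: "?I \<rho> \<in> matrix_dual" if "\<rho> \<in> matrix_dual" for \<rho>
    using that by (simp add: matrix_dual_def clinear_compose[OF _ clinear_resolvent[OF lin nn a]])
  have MI: "?M (?I \<rho>) = \<rho>" if "\<rho> \<in> matrix_dual" for \<rho>
    by (simp add: resolvent_map_omega[OF t I[OF that]] resolvent_shifted[OF lin nn a])
  have IM: "?I (?M \<rho>) = \<rho>" if "\<rho> \<in> matrix_dual" for \<rho>
    by (simp add: resolvent_map_omega[OF t that] shifted_resolvent[OF lin nn a])
  show bij: "bij_betw ?M matrix_dual matrix_dual"
    by (rule bij_betwI[where g = ?I]) (auto simp: M I MI IM)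
  show "inv_into matrix_dual ?M \<rho> = ?I \<rho>" if "\<rho> \<in> matrix_dual"
    by (rule inv_into_f_eq[OF bij_betw_imp_inj_on[OF bij]]) (fact I[OF that], fact MI[OF that])
qed

lemma pi_hat_omega:
  assumes t: "0 < t" and \<rho>: "\<rho> \<in> matrix_dual"
  shows "pi_hat (omega \<phi> \<nu>) t \<rho> A = \<rho> (generalized_rep \<phi> \<nu> t A)"
  unfolding pi_hat_def resolvent_map_bij(2)[OF t \<rho>] truncated_omega[OF t] generalized_rep_def
  by (simp add: resolvent_commute[OF lin nn truncated_weight_Lambda(2)[OF bw pw t]])

lemma normal_generalized_rep:
  assumes t: "0 < t"
  shows "normal_map (generalized_rep \<phi> \<nu> t)"
  unfolding normal_map_def generalized_rep_def
proof
  fix \<rho> :: "'n cmat \<Rightarrow> complex" assume \<rho>: "\<rho> \<in> matrix_dual"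
  show "normal_functional (\<lambda>A. \<rho> (\<phi> (resolvent \<phi> (mass \<nu> t) (truncated_Omega \<nu> t A))))"
    using normal_functional_Omega[OF clinear_compose[of \<rho>,
          OF _ clinear_phi_resolvent[OF lin nn truncated_weight_Lambda(2)[OF bw pw t]]]
        normal_truncated_weight[OF bw pw t]] \<rho>
    by (simp add: matrix_dual_def)
qed

lemma generalized_rep_cp:
  assumes t: "0 < t"
    and res: "completely_positive UNIV (*v) (*v) (\<lambda>X. \<phi> (resolvent \<phi> (mass \<nu> t) X))"
  shows "completely_positive bounded_ops blinfun_apply (*v) (generalized_rep \<phi> \<nu> t)"
  unfolding generalized_rep_def
  by (rule completely_positive_compose[OF truncated_Omega_cp[OF bw pw t] res])

text \<open>
  The map sends $I$ to $c I$ with $c = \nu_t(1)/(1 + a_t) \le 1$. For operators with an adjoint,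
  complete positivity turns this into a norm bound; normality extends the bound to all of $B(H)$.
\<close>

lemma generalized_rep_contraction:
  assumes t: "0 < t" and unit: "\<phi> (mat 1) = mat 1" and nw: "normalized_weight \<nu>"
    and rep: "completely_positive bounded_ops blinfun_apply (*v) (generalized_rep \<phi> \<nu> t)"
  shows "contraction (generalized_rep \<phi> \<nu> t)"
  unfolding contraction_def
proof (intro ballI onorm_le_of_cinner_le)
  have a: "0 \<le> mass \<nu> t" by (rule truncated_weight_Lambda(2)[OF bw pw t])
  define c where "c = Re (truncated_weight \<nu> t id_blinfun) / (1 + mass \<nu> t)"
  have c: "c \<le> 1" using truncated_weight_id_le[OF bw pw nw t] a by (simp add: c_def)
  have gid: "generalized_rep \<phi> \<nu> t (r *\<^sub>R id_blinfun) = (r * c) *\<^sub>R mat 1" for r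
    by (simp add: generalized_rep_def truncated_Omega_id[OF bw pw t] c_def
        clinear_scaleR[OF clinear_phi_resolvent[OF lin nn a]] phi_resolvent_unit[OF lin nn a unit])
  fix A :: "'n hilbert_ops" and x y :: "complex ^ 'n"
  assume A: "A \<in> bounded_ops"
  define \<rho> where "\<rho> X = cinner x (X *v y)" for X :: "'n cmat"
  have "\<rho> \<in> matrix_dual"
    by (simp add: \<rho>_def matrix_dual_def clinear_def matrix_vector_mult_add_rdistrib cinner_add_right
        cinner_matrix_vector scaleC_vec_nth scaleC_complex_def sum_distrib_left mult_ac)
  then have n: "normal_functional (\<lambda>A. \<rho> (generalized_rep \<phi> \<nu> t A))"
    using normal_generalized_rep[OF t] by (simp add: normal_map_def)
  have "cmod (\<rho> (generalized_rep \<phi> \<nu> t A)) \<le> (norm x * norm y) * norm A"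
  proof (rule normal_functional_bound[OF n _ A])
    fix B B' :: "'n hilbert_ops"
    assume B: "B \<in> bounded_ops" "B' \<in> bounded_ops" "adjoint_pair B B'"
    have "cmod (cinner x (generalized_rep \<phi> \<nu> t B *v y)) \<le> (norm B * c) * (norm x * norm y)"
    proof (rule completely_positive_adjoint_bound[OF rep, of B B' "norm B *\<^sub>R id_blinfun" "norm B" "norm B * c" x y])
      show "norm B *\<^sub>R id_blinfun \<in> (bounded_ops :: 'n hilbert_ops set)"
        using bounded_ops_cscale[OF bounded_ops_id, of "of_real (norm B)"] by (simp add: scaleC_of_real)
      show "generalized_rep \<phi> \<nu> t (norm B *\<^sub>R id_blinfun) *v v = (norm B * c) *\<^sub>R v" for v
        by (simp only: gid scaleR_mat_vector)
    qed (use B in \<open>auto simp: adjoint_pair_def norm_blinfun clinear_matrix_vector blinfun.scaleR_left\<close>)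
    also have "\<dots> \<le> (norm B * 1) * (norm x * norm y)"
      using c by (intro mult_right_mono mult_left_mono) auto
    finally show "cmod (\<rho> (generalized_rep \<phi> \<nu> t B)) \<le> (norm x * norm y) * norm B"
      by (simp add: \<rho>_def mult_ac)
  qed simp
  then show "cmod (cinner x (generalized_rep \<phi> \<nu> t A *v y)) \<le> norm A * (norm x * norm y)"
    by (simp add: \<rho>_def mult_ac)
qed simp

text \<open>
  Every positive matrix $(B_{ij})$ lifts to the positive matrix $(\Lambda(B_{ij}))$, and
  $\pi_t^\#(\Lambda(B)) = a_t\,\psi_{a_t}(B)$.
\<close>

lemma resolvent_cp_of_generalized_rep:
  assumes t: "0 < t" and a: "0 < mass \<nu> t"
    and rep: "completely_positive bounded_ops blinfun_apply (*v) (generalized_rep \<phi> \<nu> t)"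
  shows "completely_positive UNIV (*v) (*v) (\<lambda>X. \<phi> (resolvent \<phi> (mass \<nu> t) X))"
  unfolding completely_positive_def clinear_on_UNIV
proof (intro conjI allI impI)
  let ?a = "mass \<nu> t"
  show psi: "clinear (\<lambda>X. \<phi> (resolvent \<phi> ?a X))"
    using a by (intro clinear_phi_resolvent lin nn) simp
  fix m and B :: "nat \<Rightarrow> nat \<Rightarrow> 'n cmat"
  assume B: "positive_block m (\<lambda>i j. (*v) (B i j))"
  have "positive_block m (\<lambda>i j. blinfun_apply (Lambda ((*v) (B i j))))"
    by (rule acts_positive_block[OF Lambda_matrix_acts]) (intro positive_block_scaleR B, simp)
  then have "positive_block m (\<lambda>i j. (*v) (generalized_rep \<phi> \<nu> t (Lambda ((*v) (B i j)))))"
    by (rule completely_positiveD[OF rep Lambda_matrix_bounded_ops])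
  then have "positive_block m (\<lambda>i j v. (1 / ?a) *\<^sub>R (generalized_rep \<phi> \<nu> t (Lambda ((*v) (B i j))) *v v))"
    using a by (intro positive_block_scaleR) simp_all
  moreover have "generalized_rep \<phi> \<nu> t (Lambda ((*v) X)) = ?a *\<^sub>R \<phi> (resolvent \<phi> ?a X)" for X
    by (simp add: generalized_rep_def truncated_Omega_Lambda[OF bw pw t] clinear_scaleR[OF psi])
  ultimately show "positive_block m (\<lambda>i j. (*v) (\<phi> (resolvent \<phi> ?a (B i j))))"
    using a by (simp add: scaleR_matrix_vector)
qed

end

theorem proposition3p2:
  fixes \<phi> :: "complex ^ 'n ^ 'n \<Rightarrow> complex ^ 'n ^ 'n"
    and \<nu> :: "(complex L2 \<Rightarrow>\<^sub>L complex L2) \<Rightarrow> complex"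
  assumes "completely_positive UNIV (*v) (*v) \<phi>"
    and "\<phi> (mat 1) = mat 1"
    and "no_negative_eigenvalues \<phi>"
    and "boundary_weight \<nu>"
    and "positive_weight \<nu>"
    and "normalized_weight \<nu>"
    and "unbounded_weight \<nu>"
  shows "(\<forall>\<rho>\<in>matrix_dual. boundary_weight (omega \<phi> \<nu> \<rho>)) \<and>
    cp_weight_map (omega \<phi> \<nu>) \<and>
    (\<forall>t>0. bij_betw (resolvent_map (omega \<phi> \<nu>) t) matrix_dual matrix_dual) \<and>
    ((\<forall>t>0. \<exists>\<pi>.
        (\<forall>\<rho>\<in>matrix_dual. \<forall>A\<in>bounded_ops. pi_hat (omega \<phi> \<nu>) t \<rho> A = \<rho> (\<pi> A)) \<and>
        normal_map \<pi> \<and>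
        completely_positive bounded_ops blinfun_apply (*v) \<pi> \<and>
        contraction \<pi>) \<longleftrightarrow>
      q_positive \<phi>)"
proof (intro conjI)
  note \<nu> = assms(4,5)
  have lin: "clinear \<phi>" using assms(1) by (simp add: completely_positive_def clinear_on_UNIV)
  note ctx = lin assms(3-5)
  have comp: "\<phi> \<circ> inv (\<lambda>X. X + s *\<^sub>R \<phi> X) = (\<lambda>X. \<phi> (resolvent \<phi> s X))" for s
    by (simp add: fun_eq_iff resolvent_def)
  show "\<forall>\<rho>\<in>matrix_dual. boundary_weight (omega \<phi> \<nu> \<rho>)"
    using boundary_weight_omega[OF lin assms(4)] by (simp add: matrix_dual_def)
  show "cp_weight_map (omega \<phi> \<nu>)" by (rule cp_weight_map_omega[OF assms(1) \<nu>])
  show "\<forall>t>0. bij_betw (resolvent_map (omega \<phi> \<nu>) t) matrix_dual matrix_dual"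
    using resolvent_map_bij(1)[OF ctx] by blast
  show "(\<forall>t>0. \<exists>\<pi>.
        (\<forall>\<rho>\<in>matrix_dual. \<forall>A\<in>bounded_ops. pi_hat (omega \<phi> \<nu>) t \<rho> A = \<rho> (\<pi> A)) \<and>
        normal_map \<pi> \<and>
        completely_positive bounded_ops blinfun_apply (*v) \<pi> \<and>
        contraction \<pi>) \<longleftrightarrow> q_positive \<phi>" (is "?L \<longleftrightarrow> _")
  proof
    assume L: ?L
    show "q_positive \<phi>"
      unfolding q_positive_def comp
    proof (intro conjI allI impI assms(3))
      fix s :: real assume s: "0 \<le> s"
      obtain t where t: "0 < t" "s < mass \<nu> t"
        using mass_unbounded[OF \<nu> assms(6,7)] by blast
      obtain \<pi> where \<pi>: "\<forall>\<rho>\<in>matrix_dual. \<forall>A\<in>bounded_ops. pi_hat (omega \<phi> \<nu>) t \<rho> A = \<rho> (\<pi> A)"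
        and cp: "completely_positive bounded_ops blinfun_apply (*v) \<pi>"
        using L t(1) by blast
      have eq: "\<pi> A = generalized_rep \<phi> \<nu> t A" if "A \<in> bounded_ops" for A
        using \<pi> that pi_hat_omega[OF ctx t(1)] by (intro matrix_dual_separates) metis
      have "completely_positive bounded_ops blinfun_apply (*v) (generalized_rep \<phi> \<nu> t)"
        by (rule completely_positive_cong[THEN iffD1, OF csubspace_bounded_ops _ cp]) (rule eq)
      then have "completely_positive UNIV (*v) (*v) (\<lambda>X. \<phi> (resolvent \<phi> (mass \<nu> t) X))"
        using t s by (intro resolvent_cp_of_generalized_rep[OF ctx]) simp_all
      then show "completely_positive UNIV (*v) (*v) (\<lambda>X. \<phi> (resolvent \<phi> s X))"
        by (rule resolvent_cp_mono[OF lin assms(3,2) s less_imp_le[OF t(2)]])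
    qed
  next
    assume q: "q_positive \<phi>"
    show ?L
    proof (intro allI impI)
      fix t :: real assume t: "0 < t"
      have "completely_positive UNIV (*v) (*v) (\<lambda>X. \<phi> (resolvent \<phi> (mass \<nu> t) X))"
        using q truncated_weight_Lambda(2)[OF \<nu> t] by (simp add: q_positive_def comp)
      note rep = generalized_rep_cp[OF ctx t this]
      show "\<exists>\<pi>. (\<forall>\<rho>\<in>matrix_dual. \<forall>A\<in>bounded_ops. pi_hat (omega \<phi> \<nu>) t \<rho> A = \<rho> (\<pi> A)) \<and>
          normal_map \<pi> \<and> completely_positive bounded_ops blinfun_apply (*v) \<pi> \<and> contraction \<pi>"
        using pi_hat_omega[OF ctx t] normal_generalized_rep[OF ctx t] rep
          generalized_rep_contraction[OF ctx t assms(2,6) rep] by blast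
    qed
  qed
qed

end
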